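(* For line arrangements in $\mathbb{P}^2$ with $d<9$ lines, the minimal degree of a Jacobian relation is determined by the intersection lattice: if $\mathcal{A}: f=0$ and $\mathcal{A}': f'=0$ are line arrangements of $d<9$ lines with isomorphic intersection lattices $L(\mathcal{A})\cong L(\mathcal{A}')$, then $\mathrm{mdr}(f)=\mathrm{mdr}(f')$. In particular, there are no classical Ziegler pairs with fewer than nine lines.
   Context: Let $S=\mathbb{C}[x,y,z]$ with the standard grading. A line arrangement $\mathcal{A}: f=0$ in $\mathbb{P}^2=\mathbb{P}^2_{\mathbb{C}}$ is given by $f=\ell_1\cdots\ell_d$ with $\ell_i\in S_1$ pairwise non-proportional. $L(\mathcal{A})$ is the intersection lattice of the corresponding central arrangement of planes in $\mathbb{C}^3$. Let $AR(f)=\{(a,b,c)\in S^3: af_x+bf_y+cf_z=0\}$, graded by the common degree of $a,b,c$, and $\mathrm{mdr}(f)=\min\{q\geq 0: AR(f)_q\neq 0\}$. The Milnor (Jacobian) algebra is $M(f)=S/(f_x,f_y,f_z)$. A Ziegler pair is a pair of line arrangements $\mathcal{A}: f=0$, $\mathcal{A}': f'=0$ with isomorphic intersection lattices such that the minimal graded free resolutions of $M(f)$ and $M(f')$ have distinct graded Betti tables; it is a classical Ziegler pair if $\mathrm{mdr}(f)\neq\mathrm{mdr}(f')$. *)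

theory Defs
  imports "HOL-Analysis.Analysis" "HOL-Library.Poly_Mapping"
begin

text \<open>
  The ring \<open>S = \<complex>[x,y,z]\<close>: an element maps each exponent vector to its coefficient.
  The variables \<open>x, y, z\<close> carry the indices \<open>1, 2, 3\<close> of the type \<^typ>\<open>3\<close>
  (where the numeral \<open>3\<close> equals \<open>0\<close>).
\<close>

type_synonym monom3 = "3 \<Rightarrow>\<^sub>0 nat"
type_synonym poly3 = "monom3 \<Rightarrow>\<^sub>0 complex"

definition const3 :: "complex \<Rightarrow> poly3" where
  "const3 c = Poly_Mapping.single 0 c"

definition monom_degree :: "monom3 \<Rightarrow> nat" where
  "monom_degree m = (\<Sum>i\<in>UNIV. Poly_Mapping.lookup m i)"

text \<open>
  Membership in the graded piece \<open>S\<^sub>q\<close>. The zero polynomial lies in every piece, and it is the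
  only element for negative \<open>q\<close>.
\<close>

definition homogeneous :: "int \<Rightarrow> poly3 \<Rightarrow> bool" where
  "homogeneous q p \<longleftrightarrow> (\<forall>m\<in>Poly_Mapping.keys p. int (monom_degree m) = q)"

definition eval3 :: "poly3 \<Rightarrow> complex ^ 3 \<Rightarrow> complex" where
  "eval3 p v =
     (\<Sum>m\<in>Poly_Mapping.keys p.
        Poly_Mapping.lookup p m * (\<Prod>i\<in>UNIV. (v $ i) ^ Poly_Mapping.lookup m i))"

text \<open>
  Formal partial derivative. If \<open>lookup m i = 0\<close>, the truncated exponent is harmless because
  the coefficient vanishes.
\<close>

definition partial :: "3 \<Rightarrow> poly3 \<Rightarrow> poly3" where
  "partial i p =
     (\<Sum>m\<in>Poly_Mapping.keys p.
        Poly_Mapping.single (m - Poly_Mapping.single i 1)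
          (of_nat (Poly_Mapping.lookup m i) * Poly_Mapping.lookup p m))"


section \<open>Line arrangements and their intersection lattices\<close>

text \<open>
  A line arrangement is given by the list of its linear forms; the arrangement of \<open>d\<close> lines
  is \<open>f = 0\<close> with \<open>f\<close> the product of the list.
\<close>

definition proportional :: "poly3 \<Rightarrow> poly3 \<Rightarrow> bool" where
  "proportional l l' \<longleftrightarrow> (\<exists>c. c \<noteq> 0 \<and> l = const3 c * l')"

definition line_arrangement :: "poly3 list \<Rightarrow> bool" where
  "line_arrangement A \<longleftrightarrow>
     (\<forall>l\<in>set A. homogeneous 1 l \<and> l \<noteq> 0) \<and>
     (\<forall>i<length A. \<forall>j<length A. i \<noteq> j \<longrightarrow> \<not> proportional (A ! i) (A ! j))"

definition defining_poly :: "poly3 list \<Rightarrow> poly3" where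
  "defining_poly A = prod_list A"

definition plane :: "poly3 \<Rightarrow> (complex ^ 3) set" where
  "plane l = {v. eval3 l v = 0}"

text \<open>The empty family is included; its intersection is the whole space \<open>\<complex>\<^sup>3\<close>.\<close>

definition intersection_lattice :: "poly3 list \<Rightarrow> (complex ^ 3) set set" where
  "intersection_lattice A = {\<Inter>\<H> | \<H>. \<H> \<subseteq> plane ` set A}"

text \<open>The lattices are ordered by reverse inclusion.\<close>

definition lattice_isomorphic :: "poly3 list \<Rightarrow> poly3 list \<Rightarrow> bool" where
  "lattice_isomorphic A A' \<longleftrightarrow>
     (\<exists>\<phi>. bij_betw \<phi> (intersection_lattice A) (intersection_lattice A') \<and>
       (\<forall>X\<in>intersection_lattice A. \<forall>Y\<in>intersection_lattice A. X \<supseteq> Y \<longleftrightarrow> \<phi> X \<supseteq> \<phi> Y))"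


section \<open>Jacobian relations\<close>

definition AR :: "poly3 \<Rightarrow> (poly3 ^ 3) set" where
  "AR f = {r. r $ 1 * partial 1 f + r $ 2 * partial 2 f + r $ 3 * partial 3 f = 0}"

definition AR_graded :: "poly3 \<Rightarrow> nat \<Rightarrow> (poly3 ^ 3) set" where
  "AR_graded f q = {r \<in> AR f. \<forall>i. homogeneous (int q) (r $ i)}"

text \<open>The minimum is attained, since \<open>AR f\<close> contains the Koszul relations.\<close>

definition mdr :: "poly3 \<Rightarrow> nat" where
  "mdr f = (LEAST q. AR_graded f q \<noteq> {0})"


section \<open>Graded Betti tables of Milnor algebras\<close>

definition jacobian_ideal :: "poly3 \<Rightarrow> poly3 set" where
  "jacobian_ideal f = {a * partial 1 f + b * partial 2 f + c * partial 3 f | a b c. True}"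

definition free_module :: "nat \<Rightarrow> (nat \<Rightarrow> poly3) set" where
  "free_module n = {v. \<forall>k\<ge>n. v k = 0}"

definition mat_apply ::
    "nat \<Rightarrow> nat \<Rightarrow> (nat \<Rightarrow> nat \<Rightarrow> poly3) \<Rightarrow> (nat \<Rightarrow> poly3) \<Rightarrow> (nat \<Rightarrow> poly3)" where
  "mat_apply n m M v = (\<lambda>j. if j < n then \<Sum>k<m. M j k * v k else 0)"

text \<open>
  Minimal graded free resolutions
  \<open>\<dots> \<rightarrow> F\<^sub>2 \<rightarrow> F\<^sub>1 \<rightarrow> F\<^sub>0 \<rightarrow> S/I \<rightarrow> 0\<close> with \<open>F\<^sub>i\<close> the direct sum of the modules \<open>S(-s)\<close>
  for \<open>s\<close> in the list \<open>sh i\<close>, that is, with basis elements in the degrees listed by \<open>sh i\<close>.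
  The matrix of \<open>F\<^sub>i\<^sub>+\<^sub>1 \<rightarrow> F\<^sub>i\<close> is \<open>D i\<close>. The map \<open>F\<^sub>0 \<rightarrow> S/I\<close> sends the
  \<open>k\<close>-th basis element to the class of \<open>e k\<close>, so that its surjectivity and its kernel are
  expressed by representatives modulo \<open>I\<close>. The conjuncts say: all maps are homogeneous of
  degree \<open>0\<close>; the augmentation is surjective; exactness at \<open>F\<^sub>0\<close>; exactness at
  \<open>F\<^sub>i\<^sub>+\<^sub>1\<close>; and minimality, i.e. the entries of all differentials lie in \<open>(x,y,z)\<close>.
\<close>

definition minimal_graded_free_resolution ::
    "poly3 set \<Rightarrow> (nat \<Rightarrow> int list) \<Rightarrow> (nat \<Rightarrow> poly3) \<Rightarrow> (nat \<Rightarrow> nat \<Rightarrow> nat \<Rightarrow> poly3) \<Rightarrow> bool" where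
  "minimal_graded_free_resolution I sh e D \<longleftrightarrow>
     (let rk = (\<lambda>i. length (sh i));
          d = (\<lambda>i. mat_apply (rk i) (rk (Suc i)) (D i));
          aug = (\<lambda>v. \<Sum>k<rk 0. v k * e k)
      in (\<forall>k<rk 0. homogeneous (sh 0 ! k) (e k)) \<and>
         (\<forall>i. \<forall>j<rk i. \<forall>k<rk (Suc i). homogeneous (sh (Suc i) ! k - sh i ! j) (D i j k)) \<and>
         (\<forall>s. \<exists>v\<in>free_module (rk 0). s - aug v \<in> I) \<and>
         {v \<in> free_module (rk 0). aug v \<in> I} = d 0 ` free_module (rk 1) \<and>
         (\<forall>i. {v \<in> free_module (rk (Suc i)). d i v = (\<lambda>_. 0)}
                = d (Suc i) ` free_module (rk (Suc (Suc i)))) \<and>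
         (\<forall>i. \<forall>j<rk i. \<forall>k<rk (Suc i). Poly_Mapping.lookup (D i j k) 0 = 0))"

text \<open>
  The graded Betti table \<open>(i, j) \<mapsto> \<beta>\<^sub>i\<^sub>,\<^sub>j\<close>, the number of summands \<open>S(-j)\<close> of \<open>F\<^sub>i\<close>,
  of the Milnor algebra \<open>M(f) = S/(f\<^sub>x, f\<^sub>y, f\<^sub>z)\<close>. For homogeneous \<open>f\<close> a minimal resolution
  exists and is unique up to isomorphism, so the choice is immaterial.
\<close>

definition betti_table :: "poly3 \<Rightarrow> nat \<Rightarrow> int \<Rightarrow> nat" where
  "betti_table f =
     (SOME b. \<exists>sh e D. minimal_graded_free_resolution (jacobian_ideal f) sh e D \<and>
                b = (\<lambda>i j. count_list (sh i) j))"

definition Ziegler_pair :: "poly3 list \<Rightarrow> poly3 list \<Rightarrow> bool" where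
  "Ziegler_pair A A' \<longleftrightarrow>
     line_arrangement A \<and> line_arrangement A' \<and> lattice_isomorphic A A' \<and>
     betti_table (defining_poly A) \<noteq> betti_table (defining_poly A')"

definition classical_Ziegler_pair :: "poly3 list \<Rightarrow> poly3 list \<Rightarrow> bool" where
  "classical_Ziegler_pair A A' \<longleftrightarrow>
     Ziegler_pair A A' \<and> mdr (defining_poly A) \<noteq> mdr (defining_poly A')"

end

theory Submission
  imports Defs
begin

text \<open>
  Let \<open>Y\<close> be the set of planes of the arrangement, \<open>d\<close> their number, and for \<open>H\<close> in \<open>Y\<close> let
  \<open>n\<^sub>H\<close> be the number of lines in which \<open>H\<close> meets the other planes. A Jacobian relation of degree
  \<open>q\<close> is a homogeneous polynomial vector field \<open>\<theta>\<close> of degree \<open>q\<close> with \<open>\<theta> f = 0\<close>. Such a field is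
  tangent to all planes of \<open>Y\<close>, and a tangent field becomes one after subtracting a multiple of the
  Euler field. So \<open>mdr f\<close> is the least degree of a tangent field that is not everywhere radial
  (\<open>mdr_eq\<close>), and it suffices that for \<open>d < 9\<close> the existence of such a field in degree \<open>q\<close> depends
  only on which planes meet which others in the same line
  (\<open>has_tangent_field_combinatorial\<close>). This is an induction on \<open>d\<close> that deletes a plane.

  First, the component of \<open>\<theta>\<close> along \<open>H\<close> is, modulo the Euler field, a form of degree \<open>q + 1\<close> on the
  projective line of \<open>H\<close> which vanishes at the \<open>n\<^sub>H\<close> crossings. If \<open>n\<^sub>H \<ge> q + 2\<close>, it is zero, and
  \<open>\<theta>\<close> is a multiple of the Euler field plus the equation of \<open>H\<close> times a tangent field of degree
  \<open>q - 1\<close> of the remaining planes (\<open>has_tangent_field_delete_many_points\<close>).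

  Second, if \<open>\<theta>\<close> is tangent to the other planes, its component normal to \<open>H\<close> is a form of degree
  \<open>q\<close> on \<open>H\<close> that vanishes to order \<open>k - 1\<close> at a crossing with \<open>k\<close> other planes, hence has
  \<open>d - 1 - n\<^sub>H\<close> zeros. If that number exceeds \<open>q\<close>, then \<open>\<theta>\<close> is tangent to \<open>H\<close> as well
  (\<open>has_tangent_field_delete_redundant\<close>).

  Third, suppose neither case occurs for any plane. The same count of zeros shows that adding a
  plane to an arrangement imposes on tangent fields at most \<open>q + 1\<close> linear conditions less the number of
  forced zeros. Comparing with the \<open>(q + 1) (q + 3)\<close> dimensions of the space of fields modulo
  Euler multiples and using \<open>n\<^sub>H \<le> q + 1\<close>, one finds that a field exists
  (\<open>has_tangent_field_if_few_points\<close>). The estimate suffices for \<open>d < 9\<close> apart from one borderline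
  case: \<open>d = 8\<close>, \<open>q = 3\<close>, and every plane carrying three triple crossings and a double one.

  In this last case, the MacLane arrangement, no field exists (\<open>no_tangent_field_maclane\<close>). At a
  triple crossing the linear part of the foliation is scalar, so the Camacho-Sad index of each line
  through it is 1. As the indices along a line add up to 1, the index at the double crossing is
  \<open>-2\<close> for both lines, whereas the two indices at a nondegenerate crossing are inverse to each other.
\<close>

section \<open>Linear algebra in complex three-space\<close>

type_synonym cvec = "complex ^ 3"

text \<open>The bilinear pairing of a linear form with a vector, not the Hermitian inner product.\<close>

definition dot :: "cvec \<Rightarrow> cvec \<Rightarrow> complex" where
  "dot w v = w $ 1 * v $ 1 + w $ 2 * v $ 2 + w $ 3 * v $ 3"

definition cross :: "cvec \<Rightarrow> cvec \<Rightarrow> cvec" where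
  "cross v w = vector [v $ 2 * w $ 3 - v $ 3 * w $ 2, v $ 3 * w $ 1 - v $ 1 * w $ 3,
     v $ 1 * w $ 2 - v $ 2 * w $ 1]"

definition kern :: "cvec \<Rightarrow> cvec set" where
  "kern w = {v. dot w v = 0}"

lemma cvec_eq_iff: "(v :: cvec) = w \<longleftrightarrow> v $ 1 = w $ 1 \<and> v $ 2 = w $ 2 \<and> v $ 3 = w $ 3"
  by (simp add: vec_eq_iff forall_3)

lemma cross_nth [simp]:
  "cross v w $ 1 = v $ 2 * w $ 3 - v $ 3 * w $ 2"
  "cross v w $ 2 = v $ 3 * w $ 1 - v $ 1 * w $ 3"
  "cross v w $ 3 = v $ 1 * w $ 2 - v $ 2 * w $ 1"
  by (simp_all add: cross_def)

lemma dot_linear [simp]: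
  "dot w (u + v) = dot w u + dot w v" "dot w (u - v) = dot w u - dot w v"
  "dot w (c *s v) = c * dot w v" "dot w 0 = 0"
  by (simp_all add: dot_def algebra_simps)

lemma dot_linear_left [simp]:
  "dot (u + v) w = dot u w + dot v w" "dot (u - v) w = dot u w - dot v w"
  "dot (c *s v) w = c * dot v w" "dot 0 w = 0"
  by (simp_all add: dot_def algebra_simps)

lemma dot_commute: "dot v w = dot w v"
  by (simp add: dot_def algebra_simps)

lemma dot_axis [simp]: "dot (axis i 1) v = v $ i"
proof -
  have "i = 1 \<or> i = 2 \<or> i = 3" by (rule exhaust_3)
  then show ?thesis by (auto simp: dot_def axis_def)
qed

lemma cross_linear [simp]:
  "cross v (u + w) = cross v u + cross v w" "cross v (u - w) = cross v u - cross v w"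
  "cross v (c *s w) = c *s cross v w"
  "cross (u + w) v = cross u v + cross w v" "cross (c *s w) v = c *s cross w v"
  "cross v v = 0" "cross 0 v = 0" "cross v 0 = 0"
  by (simp_all add: cvec_eq_iff algebra_simps)

lemma cross_commute: "cross v w = - cross w v"
  by (simp add: cvec_eq_iff)

lemma dot_cross_self [simp]:
  "dot v (cross v w) = 0" "dot w (cross v w) = 0" "dot (cross v w) v = 0" "dot (cross v w) w = 0"
  by (simp_all add: dot_def algebra_simps)

lemma dot_cross_rotate: "dot (cross u v) w = dot u (cross v w)"
  by (simp add: dot_def algebra_simps)

lemma cross_eq_0_parallel:
  assumes "cross v w = 0" "v \<noteq> 0"
  obtains c where "w = c *s v"
proof -
  have e: "v $ 2 * w $ 3 = v $ 3 * w $ 2" "v $ 3 * w $ 1 = v $ 1 * w $ 3" "v $ 1 * w $ 2 = v $ 2 * w $ 1"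
    using assms(1) by (simp_all add: cvec_eq_iff)
  consider "v $ 1 \<noteq> 0" | "v $ 2 \<noteq> 0" | "v $ 3 \<noteq> 0"
    using assms(2) by (auto simp: cvec_eq_iff)
  then show thesis
  proof cases
    case 1
    then have "w = (w $ 1 / v $ 1) *s v" using e by (simp add: cvec_eq_iff field_simps)
    then show thesis by (rule that)
  next
    case 2
    then have "w = (w $ 2 / v $ 2) *s v" using e by (simp add: cvec_eq_iff field_simps)
    then show thesis by (rule that)
  next
    case 3
    then have "w = (w $ 3 / v $ 3) *s v" using e by (simp add: cvec_eq_iff field_simps)
    then show thesis by (rule that)
  qed
qed

lemma cross_cross: "cross w (cross u v) = dot w v *s u - dot w u *s v"
  by (simp add: cvec_eq_iff dot_def algebra_simps)

lemma cross_in_kern_parallel: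
  assumes "dot w u = 0" "dot w v = 0" "dot w' w = 1"
  shows "cross u v = dot w' (cross u v) *s w"
proof (cases "w = 0")
  case False
  have "cross w (cross u v) = 0" using assms by (simp add: cross_cross)
  then obtain c where c: "cross u v = c *s w" by (rule cross_eq_0_parallel) (use False in auto)
  then show ?thesis using assms by simp
qed (use assms in simp)

lemma ex_dual_vector:
  assumes "w \<noteq> 0"
  obtains u where "dot w u = 1"
proof -
  obtain i where i: "w $ i \<noteq> 0" using assms by (metis vec_eq_iff zero_index)
  have "dot w ((1 / w $ i) *s axis i 1) = 1"
    using i by (simp add: dot_commute[of w])
  then show thesis by (rule that)
qed

lemma ex_dual_vector_kern:
  assumes "cross w x \<noteq> 0"
  obtains u where "dot w u = 1" "dot x u = 0"
proof -
  obtain y where y: "dot (cross w x) y = 1" by (rule ex_dual_vector[OF assms])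
  have "dot w (cross x y) = 1" using y unfolding dot_cross_rotate .
  moreover have "dot x (cross x y) = 0" by simp
  ultimately show thesis by (rule that)
qed

lemma kern_eq_iff:
  assumes "w \<noteq> 0" "x \<noteq> 0"
  shows "kern w = kern x \<longleftrightarrow> cross w x = 0"
proof
  assume eq: "kern w = kern x"
  show "cross w x = 0"
  proof (rule ccontr)
    assume "cross w x \<noteq> 0"
    then obtain u where "dot w u = 1" "dot x u = 0" by (rule ex_dual_vector_kern)
    then have "u \<in> kern x" "u \<notin> kern w" by (auto simp: kern_def)
    then show False using eq by blast
  qed
next
  assume "cross w x = 0"
  then obtain c where c: "x = c *s w" by (rule cross_eq_0_parallel) (use assms in auto)
  then have "c \<noteq> 0" using assms by auto
  then show "kern w = kern x" using c by (simp add: kern_def)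
qed

lemma kern_closed: "v \<in> kern w \<Longrightarrow> c *s v \<in> kern w" "v \<in> kern w \<Longrightarrow> u \<in> kern w \<Longrightarrow> v + u \<in> kern w"
  "0 \<in> kern w" "v \<in> kern w \<Longrightarrow> u \<in> kern w \<Longrightarrow> v - u \<in> kern w"
  by (auto simp: kern_def)

lemma kern_not_UNIV:
  assumes "w \<noteq> 0"
  shows "kern w \<noteq> UNIV"
proof
  assume "kern w = UNIV"
  moreover obtain u where "dot w u = 1" by (rule ex_dual_vector[OF assms])
  ultimately show False by (metis (mono_tags) UNIV_I kern_def mem_Collect_eq zero_neq_one)
qed

lemma kern_Int_kern:
  assumes "cross w x \<noteq> 0"
  shows "kern w \<inter> kern x = range (\<lambda>c. c *s cross w x)"
proof
  show "range (\<lambda>c. c *s cross w x) \<subseteq> kern w \<inter> kern x"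
    by (auto simp: kern_def)
  show "kern w \<inter> kern x \<subseteq> range (\<lambda>c. c *s cross w x)"
  proof
    fix v assume "v \<in> kern w \<inter> kern x"
    then have "cross v (cross w x) = 0" by (simp add: cross_cross kern_def dot_commute)
    then have "cross (cross w x) v = 0" by (subst cross_commute) (simp only: minus_zero)
    then obtain c where "v = c *s cross w x" by (rule cross_eq_0_parallel) (use assms in auto)
    then show "v \<in> range (\<lambda>c. c *s cross w x)" by blast
  qed
qed

section \<open>Homogeneous polynomial functions\<close>

text \<open>Generating the forms by multiplication with one linear form at a time makes every closure
  property an induction, and keeps the notion independent of coordinates.\<close>

inductive hom :: "nat \<Rightarrow> (cvec \<Rightarrow> complex) \<Rightarrow> bool" where
  hom_const: "hom 0 (\<lambda>v. c)"
| hom_add: "hom q F \<Longrightarrow> hom q G \<Longrightarrow> hom q (\<lambda>v. F v + G v)"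
| hom_dot: "hom q F \<Longrightarrow> hom (Suc q) (\<lambda>v. dot w v * F v)"

definition homv :: "nat \<Rightarrow> (cvec \<Rightarrow> cvec) \<Rightarrow> bool" where
  "homv q \<theta> \<longleftrightarrow> (\<forall>i. hom q (\<lambda>v. \<theta> v $ i))"

lemma hom_zero: "hom q (\<lambda>v. 0)"
proof (induction q)
  case (Suc q)
  then show ?case using hom_dot[OF Suc, of 0] by simp
qed (rule hom_const)

lemma hom_cmult: "hom q F \<Longrightarrow> hom q (\<lambda>v. c * F v)"
proof (induction rule: hom.induct)
  case (hom_const c') show ?case by (rule hom.hom_const)
next
  case (hom_add q F G)
  then show ?case using hom.hom_add[OF hom_add.IH] by (simp add: distrib_left)
next
  case (hom_dot q F w)
  then show ?case using hom.hom_dot[OF hom_dot.IH, of w] by (simp add: mult_ac)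
qed

lemma hom_diff: "hom q F \<Longrightarrow> hom q G \<Longrightarrow> hom q (\<lambda>v. F v - G v)"
  using hom_add[of q F "\<lambda>v. (-1) * G v"] hom_cmult[of q G "-1"] by simp

lemma hom_sum: "finite I \<Longrightarrow> (\<And>i. i \<in> I \<Longrightarrow> hom q (F i)) \<Longrightarrow> hom q (\<lambda>v. \<Sum>i\<in>I. F i v)"
  by (induction I rule: finite_induct) (simp_all add: hom_zero hom_add)

lemma hom_mult: "hom p F \<Longrightarrow> hom q G \<Longrightarrow> hom (p + q) (\<lambda>v. F v * G v)"
proof (induction arbitrary: G rule: hom.induct)
  case (hom_const c)
  then show ?case by (simp add: hom_cmult)
next
  case (hom_add p F F')
  then show ?case using hom.hom_add[of "p + q"] by (simp add: distrib_right)
next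
  case (hom_dot p F w)
  from hom.hom_dot[OF hom_dot.IH[OF hom_dot.prems], of w] show ?case by (simp add: mult_ac)
qed

lemma hom_dot1: "hom 1 (dot w)"
  using hom_dot[OF hom_const, of w 1] by simp

lemma hom_nth: "hom 1 (\<lambda>v. v $ i)"
proof -
  have "dot (axis i 1) = (\<lambda>v. v $ i)" by (rule ext) simp
  then show ?thesis using hom_dot1[of "axis i 1"] by simp
qed

lemma hom_power: "hom p F \<Longrightarrow> hom (n * p) (\<lambda>v. F v ^ n)"
  by (induction n) (auto intro: hom_const hom_mult)

lemma hom_power1: "hom (Suc 0) F \<Longrightarrow> hom n (\<lambda>v. F v ^ n)"
  using hom_power[of "Suc 0" F n] by simp

lemma hom_scale: "hom q F \<Longrightarrow> F (c *s v) = c ^ q * F v"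
  by (induction rule: hom.induct) (simp_all add: algebra_simps)

lemma hom_compose_linear:
  assumes "\<And>w. \<exists>w'. \<forall>v. dot w (L v) = dot w' v"
  shows "hom q F \<Longrightarrow> hom q (\<lambda>v. F (L v))"
proof (induction rule: hom.induct)
  case (hom_dot q F w)
  obtain w' where "\<And>v. dot w (L v) = dot w' v" using assms by blast
  then show ?case using hom.hom_dot[OF hom_dot.IH, of w'] by simp
qed (auto intro: hom.intros)

lemma hom_on_line:
  assumes "hom q F"
  obtains f :: "complex poly" where "degree f \<le> q" "\<And>t. F (a + t *s b) = poly f t"
proof -
  from assms have "\<exists>f. degree f \<le> q \<and> (\<forall>t. F (a + t *s b) = poly f t)"
  proof (induction rule: hom.induct)
    case (hom_const c)
    show ?case by (rule exI[of _ "[:c:]"]) simp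
  next
    case (hom_add q F G)
    then obtain f g where "degree f \<le> q" "\<forall>t. F (a + t *s b) = poly f t"
      "degree g \<le> q" "\<forall>t. G (a + t *s b) = poly g t" by blast
    then show ?case by (intro exI[of _ "f + g"]) (simp add: degree_add_le)
  next
    case (hom_dot q F w)
    then obtain f where "degree f \<le> q" "\<forall>t. F (a + t *s b) = poly f t" by blast
    moreover from this have "degree ([:dot w a, dot w b:] * f) \<le> Suc q"
      by (intro order_trans[OF degree_mult_le]) (auto simp: degree_pCons_eq_if)
    ultimately show ?case
      by (intro exI[of _ "[:dot w a, dot w b:] * f"]) (simp add: algebra_simps)
  qed
  then show thesis using that by blast
qed

lemma poly_eq_if_cofinite:
  fixes f :: "complex poly"
  assumes "finite S" "\<And>t. t \<notin> S \<Longrightarrow> poly f t = 0"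
  shows "f = 0"
proof (rule ccontr)
  assume "f \<noteq> 0"
  then have "finite {t. poly f t = 0}" by (rule poly_roots_finite)
  then have "finite (S \<union> {t. poly f t = 0})" using assms by simp
  moreover have "S \<union> {t. poly f t = 0} = UNIV" using assms(2) by auto
  ultimately show False using infinite_UNIV_char_0 by metis
qed

text \<open>On a line the function is a polynomial in one variable. This is how factors are cancelled
  at points where they vanish.\<close>

lemma hom_zero_by_line:
  assumes "hom q F" "finite S" "\<And>t. t \<notin> S \<Longrightarrow> F (v + t *s u) = 0"
  shows "F v = 0"
proof -
  obtain f where "degree f \<le> q" and f: "\<And>t. F (v + t *s u) = poly f t"
    using hom_on_line[OF assms(1), of v u] by blast
  have "f = 0" by (rule poly_eq_if_cofinite[OF assms(2)]) (use assms(3) f in auto)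
  then show ?thesis using f[of 0] by simp
qed

lemma hom_cancel_dot:
  assumes "hom q F" "w \<noteq> 0" "\<And>v. dot w v * F v = 0"
  shows "F v = 0"
proof -
  obtain u where u: "dot w u = 1" by (rule ex_dual_vector[OF assms(2)])
  show ?thesis
  proof (rule hom_zero_by_line[OF assms(1), of "{- dot w v}" v u])
    fix t assume "t \<notin> {- dot w v}"
    then have "dot w (v + t *s u) \<noteq> 0" using u by (simp add: eq_neg_iff_add_eq_0 add.commute)
    then show "F (v + t *s u) = 0" using assms(3)[of "v + t *s u"] by (simp only: mult_eq_0_iff simp_thms)
  qed simp
qed

lemma hom_cancel_dot_kern:
  assumes "hom q F" "cross w x \<noteq> 0" "\<And>v. v \<in> kern x \<Longrightarrow> dot w v * F v = 0" "v \<in> kern x"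
  shows "F v = 0"
proof -
  obtain u where u: "dot w u = 1" "dot x u = 0" by (rule ex_dual_vector_kern[OF assms(2)])
  show ?thesis
  proof (rule hom_zero_by_line[OF assms(1), of "{- dot w v}" v u])
    fix t assume "t \<notin> {- dot w v}"
    then have "dot w (v + t *s u) \<noteq> 0" using u by (simp add: eq_neg_iff_add_eq_0 add.commute)
    moreover have "v + t *s u \<in> kern x" using assms(4) u by (simp add: kern_def)
    ultimately show "F (v + t *s u) = 0"
      using assms(3)[of "v + t *s u"] by (simp only: mult_eq_0_iff simp_thms)
  qed simp
qed

text \<open>Division with remainder by the linear form \<open>w\<close>: the remainder is the pullback of \<open>F\<close> along
  the projection onto \<open>kern w\<close> with direction \<open>u\<close>, so it vanishes if \<open>F\<close> vanishes on \<open>kern w\<close>.\<close>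

lemma hom_split:
  assumes u: "dot w u = 1"
  shows "hom q F \<Longrightarrow> \<exists>G. hom (q - 1) G \<and> (q = 0 \<longrightarrow> G = (\<lambda>v. 0)) \<and>
    (\<forall>v. F v = F (v - dot w v *s u) + dot w v * G v)"
proof (induction rule: hom.induct)
  case (hom_const c)
  show ?case by (auto intro: hom_zero)
next
  case (hom_add q F F')
  then obtain G G' where "hom (q - 1) G" "q = 0 \<longrightarrow> G = (\<lambda>v. 0)"
     "\<forall>v. F v = F (v - dot w v *s u) + dot w v * G v"
     "hom (q - 1) G'" "q = 0 \<longrightarrow> G' = (\<lambda>v. 0)"
     "\<forall>v. F' v = F' (v - dot w v *s u) + dot w v * G' v"
    by blast
  note GG = this
  have "F v + F' v = F (v - dot w v *s u) + F' (v - dot w v *s u) + dot w v * (G v + G' v)" for v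
    using spec[OF GG(3), of v] spec[OF GG(6), of v] by (simp only: distrib_left) (simp only: ac_simps)
  moreover have "hom (q - 1) (\<lambda>v. G v + G' v)" "q = 0 \<longrightarrow> (\<lambda>v. G v + G' v) = (\<lambda>v. 0)"
    using GG(1,2,4,5) by (auto intro: hom.hom_add)
  ultimately show ?case by (intro exI[of _ "\<lambda>v. G v + G' v"]) (intro conjI allI)
next
  case (hom_dot q F x)
  then obtain G where G: "hom (q - 1) G" "q = 0 \<longrightarrow> G = (\<lambda>v. 0)"
     "\<forall>v. F v = F (v - dot w v *s u) + dot w v * G v"
    by blast
  define y where "y = x - dot x u *s w"
  have y: "dot x (v - dot w v *s u) = dot y v" for v
    by (simp add: y_def dot_commute[of _ v])
  have h: "hom q (\<lambda>v. dot y v * G v)"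
  proof (cases q)
    case 0
    then show ?thesis using G(2) by (simp add: hom_zero)
  next
    case (Suc r)
    then show ?thesis using hom.hom_dot[of r G y] G(1) by simp
  qed
  have "hom q (\<lambda>v. dot x u * F v + dot y v * G v)"
    by (intro hom.hom_add hom_cmult hom_dot.hyps h)
  moreover have "dot x v * F v = dot x (v - dot w v *s u) * F (v - dot w v *s u) +
      dot w v * (dot x u * F v + dot y v * G v)" for v
  proof -
    have arith: "a * e = b * f + d * (c * e + b * g)"
      if "a = b + c * d" "b * e = b * (f + d * g)" for a b c d e f g :: complex
      using that by (simp add: distrib_right distrib_left mult_ac)
    show ?thesis unfolding y
    proof (rule arith)
      show "dot x v = dot y v + dot x u * dot w v" by (simp add: y_def dot_commute[of _ v])
      show "dot y v * F v = dot y v * (F (v - dot w v *s u) + dot w v * G v)"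
        using spec[OF G(3), of v] by (rule arg_cong)
    qed
  qed
  ultimately show ?case
    unfolding diff_Suc_1 by (intro exI[of _ "\<lambda>v. dot x u * F v + dot y v * G v"]) blast
qed

lemma hom_divide:
  assumes "hom q F" "w \<noteq> 0" "\<And>v. v \<in> kern w \<Longrightarrow> F v = 0"
  obtains G where "hom (q - 1) G" "q = 0 \<Longrightarrow> G = (\<lambda>v. 0)" "\<And>v. F v = dot w v * G v"
proof -
  obtain u where u: "dot w u = 1" by (rule ex_dual_vector[OF assms(2)])
  have z: "F (v - dot w v *s u) = 0" for v
    by (rule assms(3)) (use u in \<open>simp add: kern_def\<close>)
  obtain G where G: "hom (q - 1) G" "q = 0 \<longrightarrow> G = (\<lambda>v. 0)"
    "\<forall>v. F v = F (v - dot w v *s u) + dot w v * G v"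
    using hom_split[OF u assms(1)] by blast
  show thesis
  proof (rule that[OF G(1)])
    show "q = 0 \<Longrightarrow> G = (\<lambda>v. 0)" using G(2) by blast
    show "F v = dot w v * G v" for v using spec[OF G(3), of v] unfolding z by simp
  qed
qed

section \<open>Vector fields tangent to planes\<close>

definition is_plane :: "cvec set \<Rightarrow> bool" where
  "is_plane H \<longleftrightarrow> (\<exists>w. w \<noteq> 0 \<and> H = kern w)"

definition normal :: "cvec set \<Rightarrow> cvec" where
  "normal H = (SOME w. w \<noteq> 0 \<and> H = kern w)"

lemma normal:
  assumes "is_plane H"
  shows "normal H \<noteq> 0" "H = kern (normal H)"
  using someI_ex[of "\<lambda>w. w \<noteq> 0 \<and> H = kern w"] assms by (auto simp: is_plane_def normal_def)

lemma cross_normals_nonzero: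
  assumes "is_plane H" "is_plane K" "H \<noteq> K"
  shows "cross (normal H) (normal K) \<noteq> 0"
  using assms normal kern_eq_iff by metis

definition tangent :: "(cvec \<Rightarrow> cvec) \<Rightarrow> cvec set \<Rightarrow> bool" where
  "tangent \<theta> H \<longleftrightarrow> \<theta> ` H \<subseteq> H"

text \<open>The last condition excludes the multiples of the Euler field, which are tangent to every
  plane.\<close>

definition has_tangent_field :: "cvec set set \<Rightarrow> nat \<Rightarrow> bool" where
  "has_tangent_field Y q \<longleftrightarrow> (\<exists>\<theta>. homv q \<theta> \<and> (\<forall>H\<in>Y. tangent \<theta> H) \<and> (\<exists>v. cross v (\<theta> v) \<noteq> 0))"

definition npoints :: "cvec set set \<Rightarrow> cvec set \<Rightarrow> nat" where
  "npoints Y H = card ((\<lambda>K. H \<inter> K) ` (Y - {H}))"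

lemma homv_dot: "homv q \<theta> \<Longrightarrow> hom q (\<lambda>v. dot w (\<theta> v))"
  unfolding homv_def dot_def by (intro hom_add hom_cmult) auto

lemma homv_cross:
  assumes "homv q \<theta>"
  shows "homv (Suc q) (\<lambda>v. cross v (\<theta> v))"
proof -
  have h: "hom (Suc q) (\<lambda>v. v $ i * \<theta> v $ j)" for i j
    using hom_dot[of q "\<lambda>v. \<theta> v $ j" "axis i 1"] assms by (simp add: homv_def)
  show ?thesis
    unfolding homv_def forall_3 by (simp add: hom_diff h)
qed

lemma plane_coordinates:
  assumes "w \<noteq> 0" "a \<in> kern w" "b \<in> kern w" "cross a b \<noteq> 0" "v \<in> kern w"
  obtains x y where "v = x *s a + y *s b"
proof -
  obtain u where u: "dot (cross a b) u = 1" by (rule ex_dual_vector[OF assms(4)])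
  obtain z where z: "dot w z = 1" by (rule ex_dual_vector[OF assms(1)])
  have "cross a b = dot z (cross a b) *s w"
    by (rule cross_in_kern_parallel) (use assms z in \<open>simp_all add: kern_def dot_commute\<close>)
  then have "dot (cross a b) v = dot z (cross a b) * dot w v" by (metis dot_linear_left(3))
  then have 0: "dot (cross a b) v = 0" using assms by (simp add: kern_def)
  have "dot (cross a b) u *s v =
      dot (cross v b) u *s a + dot (cross a v) u *s b + dot (cross a b) v *s u"
    by (simp add: cvec_eq_iff dot_def algebra_simps)
  then have "v = dot (cross v b) u *s a + dot (cross a v) u *s b" using u 0 by simp
  then show thesis by (rule that)
qed

lemma plane_basis:
  assumes "w \<noteq> 0"
  obtains a b where "a \<in> kern w" "b \<in> kern w" "cross a b \<noteq> 0"
proof -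
  have c: "cross (cross w x) (cross w y) = dot (cross w x) y *s w" for x y
    by (simp add: cvec_eq_iff dot_def algebra_simps)
  have "\<exists>x y. dot (cross w x) y \<noteq> 0"
  proof (rule ccontr)
    assume "\<not> ?thesis"
    then have "dot (cross w x) y = 0" for x y by blast
    then have "dot (cross w (axis 1 1)) (axis 2 1) = 0" "dot (cross w (axis 2 1)) (axis 3 1) = 0"
      "dot (cross w (axis 3 1)) (axis 1 1) = 0" by blast+
    then show False using assms by (simp add: cvec_eq_iff dot_def axis_def)
  qed
  then obtain x y where "dot (cross w x) y \<noteq> 0" by blast
  then have "cross (cross w x) (cross w y) \<noteq> 0" using assms by (simp add: c)
  moreover have "cross w x \<in> kern w" "cross w y \<in> kern w" by (simp_all add: kern_def)
  ultimately show thesis using that by blast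
qed

text \<open>An affine line in \<open>H\<close> that serves as coordinate on the projective line of \<open>H\<close>: its point
  at infinity \<open>b\<close> is chosen off all the planes of \<open>Y\<close>, so that each of them
  is met at one finite parameter.\<close>

definition chart :: "cvec set \<Rightarrow> cvec set set \<Rightarrow> cvec \<Rightarrow> cvec \<Rightarrow> (cvec set \<Rightarrow> complex) \<Rightarrow> bool" where
  "chart H Y a b \<tau> \<longleftrightarrow> a \<in> H \<and> b \<in> H \<and> cross a b \<noteq> 0 \<and>
     (\<forall>K\<in>Y. b \<notin> K \<and> (\<forall>s. a + s *s b \<in> K \<longleftrightarrow> s = \<tau> K)) \<and>
     (\<forall>K\<in>Y. \<forall>K'\<in>Y. H \<inter> K = H \<inter> K' \<longleftrightarrow> \<tau> K = \<tau> K')"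

lemma ex_chart:
  assumes H: "is_plane H" and Y: "finite Y" "\<And>K. K \<in> Y \<Longrightarrow> is_plane K" "H \<notin> Y"
  obtains a b \<tau> where "chart H Y a b \<tau>"
proof -
  define w where "w = normal H"
  have w: "w \<noteq> 0" "H = kern w" using normal[OF H] by (simp_all add: w_def)
  obtain a b0 where ab: "a \<in> kern w" "b0 \<in> kern w" "cross a b0 \<noteq> 0" by (rule plane_basis[OF w(1)])
  have K: "K = kern (normal K)" if "K \<in> Y" for K using normal Y(2) that by blast
  have fin: "finite {s. dot (normal K) (b0 + s *s a) = 0}" if "K \<in> Y" for K
  proof -
    let ?k = "normal K"
    have "dot ?k a \<noteq> 0 \<or> dot ?k b0 \<noteq> 0"
    proof (rule ccontr)
      assume "\<not> ?thesis"
      then have 0: "dot ?k a = 0" "dot ?k b0 = 0" by auto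
      have "cross ?k w \<noteq> 0" using cross_normals_nonzero[of K H] Y H that by (auto simp: w_def)
      then obtain u where u: "dot ?k u = 1" "dot w u = 0" by (rule ex_dual_vector_kern)
      have "u \<in> kern w" using u by (simp add: kern_def)
      then obtain x y where "u = x *s a + y *s b0" by (rule plane_coordinates[OF w(1) ab])
      then show False using 0 u by simp
    qed
    then have "{s. dot ?k (b0 + s *s a) = 0} \<subseteq> {- dot ?k b0 / dot ?k a}"
      by (cases "dot ?k a = 0") (auto simp: field_simps add_eq_0_iff)
    then show ?thesis by (rule finite_subset) simp
  qed
  \<comment> \<open>Each plane of \<open>Y\<close> excludes at most one point at infinity on the line through \<open>b0\<close> and \<open>a\<close>.\<close>
  then have "finite (\<Union>K\<in>Y. {s. dot (normal K) (b0 + s *s a) = 0})" using Y(1) by blast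
  then obtain s where s: "s \<notin> (\<Union>K\<in>Y. {s. dot (normal K) (b0 + s *s a) = 0})"
    using ex_new_if_finite[OF infinite_UNIV_char_0[where 'a = complex]] by metis
  define b where "b = b0 + s *s a"
  define \<tau> where "\<tau> = (\<lambda>K. - dot (normal K) a / dot (normal K) b)"
  have b: "b \<in> kern w" "cross a b \<noteq> 0"
    using ab by (auto simp: b_def kern_def)
  have nb: "dot (normal K) b \<noteq> 0" if "K \<in> Y" for K using s that by (auto simp: b_def)
  have in_K: "x *s a + y *s b \<in> K \<longleftrightarrow> y = x * \<tau> K" if "K \<in> Y" for K x y
  proof -
    have "x *s a + y *s b \<in> K \<longleftrightarrow> x * dot (normal K) a + y * dot (normal K) b = 0"
      by (subst K[OF that]) (simp add: kern_def)
    also have "\<dots> \<longleftrightarrow> y = x * \<tau> K"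
      using nb[OF that] by (simp add: \<tau>_def field_simps add_eq_0_iff)
    finally show ?thesis .
  qed
  have 1: "a + s *s b \<in> K \<longleftrightarrow> s = \<tau> K" if "K \<in> Y" for K s
    using in_K[OF that, of 1 s] by simp
  have HK: "H \<inter> K = {x *s a + (x * \<tau> K) *s b | x. True}" if "K \<in> Y" for K
  proof (intro equalityI subsetI)
    fix v assume v: "v \<in> H \<inter> K"
    then have "v \<in> kern w" using w by simp
    then obtain x y where "v = x *s a + y *s b" by (rule plane_coordinates[OF w(1) ab(1) b])
    then show "v \<in> {x *s a + (x * \<tau> K) *s b | x. True}" using v in_K[OF that] by auto
  next
    fix v assume "v \<in> {x *s a + (x * \<tau> K) *s b | x. True}"
    then show "v \<in> H \<inter> K" using in_K[OF that] ab b w by (auto simp: kern_closed)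
  qed
  have "H \<inter> K = H \<inter> K' \<longleftrightarrow> \<tau> K = \<tau> K'" if "K \<in> Y" "K' \<in> Y" for K K'
  proof
    assume "H \<inter> K = H \<inter> K'"
    moreover have "a + \<tau> K *s b \<in> H \<inter> K" using 1[OF that(1)] ab b w by (simp add: kern_closed)
    ultimately show "\<tau> K = \<tau> K'" using 1[OF that(2)] by blast
  next
    assume "\<tau> K = \<tau> K'"
    then show "H \<inter> K = H \<inter> K'" using HK that by simp
  qed
  moreover have "b \<notin> K" if "K \<in> Y" for K using nb[OF that] K[OF that] by (auto simp: kern_def)
  ultimately have "chart H Y a b \<tau>" unfolding chart_def using 1 ab b w by blast
  then show thesis by (rule that)
qed

lemma card_image_le_if_factors:
  assumes "finite Y" "\<And>x y. x \<in> Y \<Longrightarrow> y \<in> Y \<Longrightarrow> g x = g y \<Longrightarrow> f x = f y"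
  shows "card (f ` Y) \<le> card (g ` Y)"
proof -
  have "f x = f (inv_into Y g (g x))" if "x \<in> Y" for x
    by (rule assms(2)) (use that in \<open>auto simp: inv_into_into f_inv_into_f\<close>)
  then have "f ` Y = (\<lambda>t. f (inv_into Y g t)) ` (g ` Y)"
    by (simp add: image_image)
  then show ?thesis using assms(1) by (metis card_image_le finite_imageI)
qed

lemma card_image_eq_if_same_fibres:
  assumes "finite Y" "\<And>x y. x \<in> Y \<Longrightarrow> y \<in> Y \<Longrightarrow> g x = g y \<longleftrightarrow> f x = f y"
  shows "card (f ` Y) = card (g ` Y)"
  using assms by (intro antisym card_image_le_if_factors) auto

lemma card_chart:
  assumes "chart H Y a b \<tau>" "finite Y"
  shows "card ((\<lambda>K. H \<inter> K) ` Y) = card (\<tau> ` Y)"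
  using assms by (intro card_image_eq_if_same_fibres) (auto simp: chart_def)

lemma vanish_on_plane:
  assumes "hom q F" "w \<noteq> 0" "a \<in> kern w" "b \<in> kern w" "cross a b \<noteq> 0"
    and 0: "\<And>t. F (a + t *s b) = 0" and v: "v \<in> kern w"
  shows "F v = 0"
proof -
  obtain x y where xy: "v = x *s a + y *s b" by (rule plane_coordinates[OF assms(2-5) v])
  show ?thesis
  proof (rule hom_zero_by_line[OF assms(1), of "{- x}" v a])
    fix t assume "t \<notin> {- x}"
    then have "x + t \<noteq> 0" by (simp add: eq_neg_iff_add_eq_0 add.commute)
    then have "v + t *s a = (x + t) *s (a + (y / (x + t)) *s b)"
      by (simp add: xy vec.scale_right_distrib vec.scale_left_distrib)
    then show "F (v + t *s a) = 0" by (simp only: hom_scale[OF assms(1)] 0 mult_zero_right)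
  qed simp
qed

lemma sum_multiplicities_le_degree:
  fixes f :: "complex poly"
  assumes "finite T" "f \<noteq> 0" "\<And>t. t \<in> T \<Longrightarrow> [:-t, 1:] ^ n t dvd f"
  shows "(\<Sum>t\<in>T. n t) \<le> degree f"
proof -
  have "n t \<le> count (proots f) t" if "t \<in> T" for t
    using assms(2,3) that by (simp add: order_divides)
  then have "(\<Sum>t\<in>T. n t) \<le> (\<Sum>t\<in>T. count (proots f) t)" by (rule sum_mono)
  also have "\<dots> \<le> (\<Sum>t\<in>T \<union> set_mset (proots f). count (proots f) t)"
    by (rule sum_mono2) (use assms(1) in auto)
  also have "\<dots> = size (proots f)"
    unfolding size_multiset_overloaded_eq
    by (rule sum.mono_neutral_right) (use assms(1) in \<open>auto simp: count_eq_zero_iff\<close>)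
  also have "\<dots> \<le> degree f" by (rule size_proots_le)
  finally show ?thesis .
qed

section \<open>Deleting a plane\<close>

text \<open>Distinct linear forms are pairwise coprime: a factor already split off can be cancelled on the
  next plane.\<close>

lemma hom_divide_planes:
  assumes "finite S"
  shows "(\<And>K. K \<in> S \<Longrightarrow> is_plane K) \<Longrightarrow> hom q F \<Longrightarrow> (\<And>K v. K \<in> S \<Longrightarrow> v \<in> K \<Longrightarrow> F v = 0) \<Longrightarrow>
    (\<exists>p G. hom p G \<and> (\<forall>v. F v = (\<Prod>K\<in>S. dot (normal K) v) * G v)) \<and>
    (q < card S \<longrightarrow> (\<forall>v. F v = 0))"
  using assms
proof (induction S arbitrary: q F rule: finite_induct)
  case empty
  then show ?case by (auto intro!: exI[of _ q] exI[of _ F])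
next
  case (insert K S)
  have K: "normal K \<noteq> 0" "K = kern (normal K)" using normal insert.prems(1) by blast+
  have FK: "F v = 0" if "v \<in> kern (normal K)" for v
    using insert.prems(3)[of K v] K(2) that by simp
  obtain G where G: "hom (q - 1) G" "\<And>v. F v = dot (normal K) v * G v" "q = 0 \<Longrightarrow> G = (\<lambda>v. 0)"
    using hom_divide[OF insert.prems(2) K(1) FK] by blast
  have "G v = 0" if K': "K' \<in> S" "v \<in> K'" for K' v
  proof (rule hom_cancel_dot_kern[OF G(1), of "normal K" "normal K'"])
    have "K \<noteq> K'" using that insert.hyps by blast
    then show "cross (normal K) (normal K') \<noteq> 0"
      by (intro cross_normals_nonzero insert.prems) (use that in auto)
    have K'': "K' = kern (normal K')" using normal insert.prems(1) that by blast
    then show "v \<in> kern (normal K')" using that by simp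
    show "dot (normal K) v * G v = 0" if "v \<in> kern (normal K')" for v
      using insert.prems(3)[of K' v] K'(1) K'' that G(2)[of v] by simp
  qed
  then obtain p G' where G': "hom p G'" "\<forall>v. G v = (\<Prod>K\<in>S. dot (normal K) v) * G' v"
    and 0: "q - 1 < card S \<longrightarrow> (\<forall>v. G v = 0)"
    using insert.IH[OF _ G(1)] insert.prems(1) by blast
  have "F v = (\<Prod>K\<in>insert K S. dot (normal K) v) * G' v" for v
    using insert.hyps G(2)[of v] spec[OF G'(2), of v] by simp
  moreover have "F v = 0" if "q < card (insert K S)" for v
  proof (cases "q = 0")
    case False
    then have "q - 1 < card S" using that insert.hyps by simp
    then show ?thesis using 0 G(2) by simp
  qed (use G(2,3) in simp)
  ultimately show ?case using G'(1) by blast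
qed

text \<open>If \<open>\<theta>\<close> is tangent to \<open>k\<close> planes through the point \<open>p\<close> of \<open>H\<close>, the determinant of
  \<open>v\<close>, \<open>\<theta> v\<close>, \<open>p\<close> vanishes on each of them and is divisible by the product of their equations.
  On \<open>H\<close> this determinant is the normal component of \<open>\<theta>\<close> times a linear form vanishing
  at \<open>p\<close>, so the normal component vanishes at \<open>p\<close> to order at least \<open>k - 1\<close>.\<close>

lemma normal_component_order:
  assumes H: "is_plane H" and Y: "finite Y" "\<And>K. K \<in> Y \<Longrightarrow> is_plane K"
    and ch: "chart H Y a b \<tau>" and \<theta>: "homv q \<theta>" "\<And>K. K \<in> Y \<Longrightarrow> tangent \<theta> K"
    and f: "\<And>t. dot (normal H) (\<theta> (a + t *s b)) = poly f t"
  shows "[:-t, 1:] ^ (card {K \<in> Y. \<tau> K = t} - 1) dvd f"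
proof -
  define w where "w = normal H"
  have w: "w \<noteq> 0" "H = kern w" using normal[OF H] by (simp_all add: w_def)
  define S where "S = {K \<in> Y. \<tau> K = t}"
  define p where "p = a + t *s b"
  have S: "finite S" "\<And>K. K \<in> S \<Longrightarrow> is_plane K" "\<And>K. K \<in> S \<Longrightarrow> K \<in> Y"
    using Y by (auto simp: S_def)
  have ab: "a \<in> kern w" "b \<in> kern w" "cross a b \<noteq> 0" using ch w by (auto simp: chart_def)
  have pK: "p \<in> K" "b \<notin> K" if "K \<in> S" for K using ch that by (auto simp: chart_def p_def S_def)
  define G where "G = (\<lambda>v. dot p (cross v (\<theta> v)))"
  have "hom (Suc q) G" unfolding G_def by (intro homv_dot homv_cross \<theta>)
  moreover have "G v = 0" if "K \<in> S" "v \<in> K" for K v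
  proof -
    have K: "normal K \<noteq> 0" "K = kern (normal K)" using normal S(2) that by blast+
    obtain u where u: "dot (normal K) u = 1" by (rule ex_dual_vector[OF K(1)])
    have "\<theta> v \<in> K" using \<theta>(2)[of K] S(3) that by (auto simp: tangent_def)
    then have "cross v (\<theta> v) = dot u (cross v (\<theta> v)) *s normal K"
      using that K(2) u by (intro cross_in_kern_parallel) (auto simp: kern_def dot_commute[of u])
    then have "G v = dot u (cross v (\<theta> v)) * dot p (normal K)"
      unfolding G_def by (metis dot_linear(3))
    moreover have "dot p (normal K) = 0"
      using pK(1)[OF that(1)] K(2) by (metis (mono_tags) dot_commute kern_def mem_Collect_eq)
    ultimately show ?thesis by simp
  qed
  ultimately obtain r G' where G': "hom r G'" "\<forall>v. G v = (\<Prod>K\<in>S. dot (normal K) v) * G' v"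
    using hom_divide_planes[OF S(1,2)] by blast
  obtain g where g: "\<And>s. G' (a + s *s b) = poly g s" using hom_on_line[OF G'(1), of a b] by blast
  define C where "C = (\<Prod>K\<in>S. dot (normal K) b)"
  have prod: "(\<Prod>K\<in>S. dot (normal K) (a + s *s b)) = (s - t) ^ card S * C" for s
  proof -
    have "dot (normal K) (a + s *s b) = (s - t) * dot (normal K) b" if "K \<in> S" for K
    proof -
      have "dot (normal K) (a + t *s b) = 0"
        using pK(1)[OF that] normal S(2) that by (metis (mono_tags) p_def kern_def mem_Collect_eq)
      then show ?thesis by (simp add: algebra_simps eq_neg_iff_add_eq_0)
    qed
    then show ?thesis by (simp add: C_def prod.distrib)
  qed
  obtain w' where w': "dot w w' = 1" by (rule ex_dual_vector[OF w(1)])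
  define \<kappa> where "\<kappa> = dot w' (cross a b)"
  have cab: "cross a b = \<kappa> *s w"
    unfolding \<kappa>_def by (rule cross_in_kern_parallel) (use ab w' in \<open>simp_all add: kern_def dot_commute\<close>)
  then have \<kappa>: "\<kappa> \<noteq> 0" using ab by auto
  have G_line: "G (a + s *s b) = (s - t) * (\<kappa> * poly f s)" for s
  proof -
    have "G (a + s *s b) = dot (cross p (a + s *s b)) (\<theta> (a + s *s b))"
      by (simp add: G_def dot_cross_rotate)
    also have "cross p (a + s *s b) = (s - t) *s cross a b"
      by (simp add: p_def cvec_eq_iff algebra_simps)
    finally show ?thesis using f by (simp add: cab w_def algebra_simps)
  qed
  have "[:-t, 1:] * smult \<kappa> f - [:-t, 1:] ^ card S * smult C g = 0"
  proof (rule poly_eq_if_cofinite[of "{}"])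
    fix s
    have "(s - t) * (\<kappa> * poly f s) = (s - t) ^ card S * C * poly g s"
      using spec[OF G'(2), of "a + s *s b"] unfolding G_line prod g .
    then show "poly ([:-t, 1:] * smult \<kappa> f - [:-t, 1:] ^ card S * smult C g) s = 0"
      by (simp add: algebra_simps poly_power)
  qed simp
  then have eq: "[:-t, 1:] * smult \<kappa> f = [:-t, 1:] ^ card S * smult C g" by simp
  show ?thesis
  proof (cases "card S")
    case 0
    then show ?thesis by (simp add: S_def)
  next
    case (Suc j)
    have "[:-t, 1:] * smult \<kappa> f = [:-t, 1:] * ([:-t, 1:] ^ j * smult C g)"
      unfolding eq Suc by (simp only: power_Suc mult.assoc)
    then have "smult \<kappa> f = [:-t, 1:] ^ j * smult C g"
      by (rule mult_left_cancel[THEN iffD1, rotated]) simp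
    then have "[:-t, 1:] ^ j dvd smult \<kappa> f" by (metis dvd_triv_left)
    then show ?thesis using \<kappa> Suc by (simp add: S_def dvd_smult_iff)
  qed
qed

text \<open>The normal component has degree \<open>q\<close>, so enough zeros, counted with the multiplicities
  forced by the planes of \<open>Y\<close>, make it vanish identically.\<close>

lemma tangent_if_many_zeros:
  assumes H: "is_plane H" and Y: "finite Y" "\<And>K. K \<in> Y \<Longrightarrow> is_plane K"
    and ch: "chart H Y a b \<tau>" and \<theta>: "homv q \<theta>" "\<And>K. K \<in> Y \<Longrightarrow> tangent \<theta> K"
    and E: "finite E" "E \<inter> \<tau> ` Y = {}" "\<And>s. s \<in> E \<Longrightarrow> dot (normal H) (\<theta> (a + s *s b)) = 0"
    and many: "q + card (\<tau> ` Y) < card E + card Y"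
  shows "tangent \<theta> H"
proof -
  define w where "w = normal H"
  have w: "w \<noteq> 0" "H = kern w" using normal[OF H] by (simp_all add: w_def)
  have ab: "a \<in> kern w" "b \<in> kern w" "cross a b \<noteq> 0" using ch w by (auto simp: chart_def)
  obtain f where f: "degree f \<le> q" "\<And>t. dot w (\<theta> (a + t *s b)) = poly f t"
    using hom_on_line[OF homv_dot[OF \<theta>(1), of w], of a b] by blast
  define m where "m = (\<lambda>t. card {K \<in> Y. \<tau> K = t})"
  have m: "m t \<ge> 1" if "t \<in> \<tau> ` Y" for t
  proof -
    have "{K \<in> Y. \<tau> K = t} \<noteq> {}" "finite {K \<in> Y. \<tau> K = t}" using that Y(1) by auto
    then show ?thesis unfolding m_def by (metis One_nat_def Suc_leI card_gt_0_iff)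
  qed
  have sum_m: "(\<Sum>t\<in>\<tau> ` Y. m t) = card Y"
    unfolding m_def using card_eq_sum sum.image_gen[OF Y(1), of "\<lambda>_. 1::nat" \<tau>] by simp
  define n where "n = (\<lambda>t. if t \<in> E then 1 else m t - 1)"
  \<comment> \<open>The zeros at crossings number \<open>card Y\<close> minus the number of crossings.\<close>
  have "f = 0"
  proof (rule ccontr)
    assume "f \<noteq> 0"
    have "(\<Sum>t\<in>E \<union> \<tau> ` Y. n t) \<le> degree f"
    proof (rule sum_multiplicities_le_degree)
      fix t assume "t \<in> E \<union> \<tau> ` Y"
      show "[:-t, 1:] ^ n t dvd f"
      proof (cases "t \<in> E")
        case True
        then have "poly f t = 0" using E(3) f(2) by (simp add: w_def)
        then show ?thesis using True by (simp add: n_def poly_eq_0_iff_dvd)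
      next
        case False
        then show ?thesis
          using normal_component_order[OF H Y ch \<theta>, of f t] f(2) by (simp add: n_def m_def w_def)
      qed
    qed (use E Y \<open>f \<noteq> 0\<close> in auto)
    moreover have "(\<Sum>t\<in>E \<union> \<tau> ` Y. n t) = (\<Sum>t\<in>E. n t) + (\<Sum>t\<in>\<tau> ` Y. n t)"
      by (rule sum.union_disjoint) (use E Y in auto)
    moreover have "(\<Sum>t\<in>E. n t) = card E" by (simp add: n_def)
    moreover have "(\<Sum>t\<in>\<tau> ` Y. n t) + card (\<tau> ` Y) = card Y"
    proof -
      have "(\<Sum>t\<in>\<tau> ` Y. n t) + card (\<tau> ` Y) = (\<Sum>t\<in>\<tau> ` Y. n t + 1)"
        by (simp only: sum.distrib card_eq_sum)
      also have "\<dots> = (\<Sum>t\<in>\<tau> ` Y. m t)"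
      proof (rule sum.cong)
        fix t assume t: "t \<in> \<tau> ` Y"
        then have "t \<notin> E" using E(2) by blast
        then show "n t + 1 = m t" using m[OF t] by (simp add: n_def)
      qed simp
      finally show ?thesis using sum_m by simp
    qed
    ultimately show False using many f(1) by linarith
  qed
  then have z: "dot w (\<theta> (a + t *s b)) = 0" for t using f(2) by simp
  have "dot w (\<theta> v) = 0" if "v \<in> kern w" for v
    by (rule vanish_on_plane[OF homv_dot[OF \<theta>(1)] w(1) ab z that])
  then show ?thesis using w(2) by (auto simp: tangent_def kern_def)
qed

text \<open>Here the zeros forced at the crossings alone exceed the degree of the normal component.\<close>

lemma has_tangent_field_delete_redundant:
  assumes Y: "finite Y" "\<And>K. K \<in> Y \<Longrightarrow> is_plane K" and H: "H \<in> Y"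
    and n: "npoints Y H + q + 2 \<le> card Y"
  shows "has_tangent_field Y q \<longleftrightarrow> has_tangent_field (Y - {H}) q"
proof
  show "has_tangent_field Y q \<Longrightarrow> has_tangent_field (Y - {H}) q"
    unfolding has_tangent_field_def by blast
  assume "has_tangent_field (Y - {H}) q"
  then obtain \<theta> v where \<theta>: "homv q \<theta>" "\<And>K. K \<in> Y - {H} \<Longrightarrow> tangent \<theta> K" "cross v (\<theta> v) \<noteq> 0"
    unfolding has_tangent_field_def by blast
  have Y': "finite (Y - {H})" "\<And>K. K \<in> Y - {H} \<Longrightarrow> is_plane K" using Y by auto
  have pH: "is_plane H" using Y H by blast
  obtain a b \<tau> where ch: "chart H (Y - {H}) a b \<tau>" using ex_chart[OF pH Y'] by blast
  have "card (\<tau> ` (Y - {H})) = npoints Y H"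
    using card_chart[OF ch Y'(1)] by (simp add: npoints_def)
  moreover have "card (Y - {H}) = card Y - 1" using H by simp
  ultimately have many: "q + card (\<tau> ` (Y - {H})) < card ({}::complex set) + card (Y - {H})"
    using n by simp
  then have "tangent \<theta> H"
    using tangent_if_many_zeros[OF pH Y' ch \<theta>(1,2), of "{}"] by simp
  then have "\<forall>K\<in>Y. tangent \<theta> K" using \<theta>(2) by blast
  then show "has_tangent_field Y q" unfolding has_tangent_field_def using \<theta> by blast
qed

text \<open>The radial factor is a polynomial: for a second linear form \<open>x\<close>, the component \<open>x (\<theta> v)\<close>
  restricted to the plane vanishes where \<open>x\<close> does, and its quotient by \<open>x\<close> is the factor \<open>g\<close>.
  In degree 0 a constant vector would have to be parallel to all vectors of the plane.\<close>

lemma radial_on_plane_decomposition: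
  assumes w: "w \<noteq> 0" and \<theta>: "homv q \<theta>" and rad: "\<And>v. v \<in> kern w \<Longrightarrow> cross v (\<theta> v) = 0"
  obtains g \<eta> where "hom (q - 1) g" "homv (q - 1) \<eta>" "q = 0 \<Longrightarrow> \<theta> = (\<lambda>v. 0)"
    "\<And>v. \<theta> v = g v *s v + dot w v *s \<eta> v"
proof -
  have "\<exists>x. cross w x \<noteq> 0"
  proof -
    obtain a b where "a \<in> kern w" "b \<in> kern w" "cross a b \<noteq> 0" by (rule plane_basis[OF w])
    then show ?thesis using cross_eq_0_parallel[OF _ w] by (metis cross_linear(5,6) cross_linear(3,7) vec.scale_zero_right)
  qed
  then obtain x where x: "cross w x \<noteq> 0" by blast
  then have x': "cross x w \<noteq> 0" "x \<noteq> 0" by (auto simp: cross_commute[of x w])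
  obtain u where u: "dot w u = 1" "dot x u = 0" by (rule ex_dual_vector_kern[OF x])
  have pi: "v - dot w v *s u \<in> kern w" "dot x (v - dot w v *s u) = dot x v" for v
    using u by (simp_all add: kern_def)
  have pos: "0 < q \<or> \<theta> = (\<lambda>v. 0)"
  proof (cases q)
    case 0
    have const: "\<theta> v = \<theta> 0" for v
    proof -
      have "\<theta> (0 *s v) $ i = \<theta> v $ i" for i
        using hom_scale[of 0 "\<lambda>v. \<theta> v $ i" 0 v] \<theta> 0 by (simp add: homv_def)
      then show ?thesis by (simp add: vec_eq_iff)
    qed
    obtain a b where ab: "a \<in> kern w" "b \<in> kern w" "cross a b \<noteq> 0" by (rule plane_basis[OF w])
    have nz: "a \<noteq> 0" "b \<noteq> 0" using ab by auto
    have "cross a (\<theta> 0) = 0" "cross b (\<theta> 0) = 0" using rad ab const by metis+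
    then obtain c d where cd: "\<theta> 0 = c *s a" "\<theta> 0 = d *s b"
      using cross_eq_0_parallel nz by metis
    have "c *s cross a b = cross (\<theta> 0) b" using cd(1) by simp
    also have "\<dots> = 0" using cd(2) by simp
    finally have "c = 0" using ab by simp
    then have "\<theta> v = 0" for v using const cd by simp
    then show ?thesis by blast
  qed simp
  have "hom q (\<lambda>v. dot x (\<theta> (v - dot w v *s u)))"
  proof (rule hom_compose_linear[OF _ homv_dot[OF \<theta>, of x]])
    fix y
    show "\<exists>w'. \<forall>v. dot y (v - dot w v *s u) = dot w' v"
      by (rule exI[of _ "y + (- dot y u) *s w"]) simp
  qed
  moreover have "dot x (\<theta> (v - dot w v *s u)) = 0" if "v \<in> kern x" for v
  proof (cases "v - dot w v *s u = 0")
    case True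
    have "\<theta> 0 = 0"
    proof -
      have "\<theta> (0 *s v) $ i = 0" for i
        using hom_scale[of q "\<lambda>v. \<theta> v $ i" 0 v] \<theta> pos by (auto simp: homv_def)
      then show ?thesis by (simp add: vec_eq_iff)
    qed
    then show ?thesis using True by simp
  next
    case False
    obtain c where "\<theta> (v - dot w v *s u) = c *s (v - dot w v *s u)"
      by (rule cross_eq_0_parallel[OF rad[OF pi(1)] False])
    then show ?thesis using that pi(2)[of v] by (simp add: kern_def)
  qed
  ultimately obtain g where g: "hom (q - 1) g"
    "\<And>v. dot x (\<theta> (v - dot w v *s u)) = dot x v * g v"
    using hom_divide[OF _ x'(2)] by blast
  have gH: "dot x (\<theta> v) = dot x v * g v" if "v \<in> kern w" for v
    using g(2)[of v] that by (simp add: kern_def)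
  show thesis
  proof (cases "q = 0")
    case True
    then show thesis
      using that[of "\<lambda>v. 0" "\<lambda>v. 0"] pos by (auto simp: homv_def hom_zero)
  next
    case False
    have comp: "hom q (\<lambda>v. \<theta> v $ i - g v * v $ i)" for i
      using False \<theta> hom_mult[OF g(1) hom_nth[of i]] by (auto simp: homv_def intro: hom_diff)
    have "\<theta> v $ i - g v * v $ i = 0" if v: "v \<in> kern w" for v i
    proof (rule hom_cancel_dot_kern[OF comp x'(1) _ v])
      fix v assume v: "v \<in> kern w"
      show "dot x v * (\<theta> v $ i - g v * v $ i) = 0"
      proof (cases "dot x v = 0")
        case nz: False
        then have "v \<noteq> 0" by auto
        then obtain c where c: "\<theta> v = c *s v" using cross_eq_0_parallel[OF rad[OF v]] by blast
        then have "c = g v" using gH[OF v] nz by simp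
        then show ?thesis using c by simp
      qed simp
    qed
    then have "\<exists>G. hom (q - 1) G \<and> (\<forall>v. \<theta> v $ i - g v * v $ i = dot w v * G v)" for i
      using hom_divide[OF comp w] by metis
    then obtain G where G: "\<And>i. hom (q - 1) (G i)"
      "\<And>i v. \<theta> v $ i - g v * v $ i = dot w v * G i v" by metis
    show thesis
    proof (rule that[OF g(1)])
      show "homv (q - 1) (\<lambda>v. \<chi> i. G i v)" using G(1) by (simp add: homv_def)
      show "\<theta> v = g v *s v + dot w v *s (\<chi> i. G i v)" for v
        using G(2)[of v] by (simp add: vec_eq_iff flip: G(2))
    qed (use False in simp)
  qed
qed

text \<open>For \<open>v\<close> in \<open>H\<close> the vector \<open>cross v (\<theta> v)\<close> is a multiple of the normal, with a factor of degree
  \<open>q + 1\<close> in \<open>v\<close>. It vanishes at every crossing, because \<open>\<theta>\<close> preserves the line of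
  intersection.\<close>

lemma radial_on_plane_if_many_points:
  assumes H: "is_plane H" and Y: "finite Y" "\<And>K. K \<in> Y \<Longrightarrow> is_plane K" "H \<notin> Y"
    and \<theta>: "homv q \<theta>" "\<And>K. K \<in> insert H Y \<Longrightarrow> tangent \<theta> K"
    and n: "q + 2 \<le> card ((\<lambda>K. H \<inter> K) ` Y)" and v: "v \<in> H"
  shows "cross v (\<theta> v) = 0"
proof -
  define w where "w = normal H"
  have w: "w \<noteq> 0" "H = kern w" using normal[OF H] by (simp_all add: w_def)
  obtain w' where w': "dot w w' = 1" by (rule ex_dual_vector[OF w(1)])
  obtain a b \<tau> where ch: "chart H Y a b \<tau>" using ex_chart[OF H Y] by blast
  have ab: "a \<in> kern w" "b \<in> kern w" "cross a b \<noteq> 0" using ch w by (auto simp: chart_def)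
  have par: "cross v (\<theta> v) = dot w' (cross v (\<theta> v)) *s w" if "v \<in> H" for v
  proof (rule cross_in_kern_parallel)
    have "\<theta> v \<in> H" using \<theta>(2)[of H] that by (auto simp: tangent_def)
    then show "dot w v = 0" "dot w (\<theta> v) = 0" using that w by (simp_all add: kern_def)
    show "dot w' w = 1" using w' by (simp add: dot_commute)
  qed
  have F: "hom (Suc q) (\<lambda>v. dot w' (cross v (\<theta> v)))" by (intro homv_dot homv_cross \<theta>)
  obtain f where f: "degree f \<le> Suc q" "\<And>t. dot w' (cross (a + t *s b) (\<theta> (a + t *s b))) = poly f t"
    using hom_on_line[OF F, of a b] by blast
  have root: "poly f (\<tau> K) = 0" if K: "K \<in> Y" for K
  proof -
    define p where "p = a + \<tau> K *s b"
    have p: "p \<in> H" "p \<in> K" using ch K ab w by (auto simp: p_def chart_def kern_closed)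
    then have tp: "\<theta> p \<in> K" "\<theta> p \<in> H" using \<theta>(2) K by (auto simp: tangent_def)
    have "cross w (normal K) \<noteq> 0"
      unfolding w_def by (rule cross_normals_nonzero) (use H Y K in auto)
    then obtain u where u: "dot w u = 1" "dot (normal K) u = 0" by (rule ex_dual_vector_kern)
    have nK: "normal K \<noteq> 0" "K = kern (normal K)" using normal Y(2) K by blast+
    then have k0: "dot (normal K) p = 0" "dot (normal K) (\<theta> p) = 0"
      using p tp by (auto simp: kern_def)
    obtain y where y: "dot (normal K) y = 1" by (rule ex_dual_vector[OF nK(1)])
    have "cross p (\<theta> p) = dot y (cross p (\<theta> p)) *s normal K"
      by (rule cross_in_kern_parallel) (use k0 y in \<open>simp_all add: dot_commute\<close>)
    then have "dot u (cross p (\<theta> p)) = dot y (cross p (\<theta> p)) * dot u (normal K)"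
      by (metis dot_linear(3))
    also have "\<dots> = 0" using u by (simp add: dot_commute)
    finally have "dot w' (cross p (\<theta> p)) * dot u w = 0"
      using par[OF p(1)] by (metis dot_linear(3))
    then show ?thesis using u f(2)[of "\<tau> K"] by (simp add: p_def dot_commute[of u])
  qed
  have "f = 0"
  proof (rule ccontr)
    assume "f \<noteq> 0"
    then have "card (\<tau> ` Y) \<le> card {t. poly f t = 0}"
      by (intro card_mono poly_roots_finite) (use root in auto)
    also have "\<dots> \<le> degree f" by (rule card_poly_roots_bound[OF \<open>f \<noteq> 0\<close>])
    finally show False using f(1) n card_chart[OF ch Y(1)] by simp
  qed
  then have "dot w' (cross (a + t *s b) (\<theta> (a + t *s b))) = 0" for t using f(2) by simp
  then have "dot w' (cross v (\<theta> v)) = 0"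
    using vanish_on_plane[OF F w(1) ab] v w by blast
  then show ?thesis using par[OF v] by simp
qed

text \<open>The two inverse constructions: divide the nonradial part by the equation of \<open>H\<close>, and
  multiply by it.\<close>

lemma has_tangent_field_delete_many_points:
  assumes Y: "finite Y" "\<And>K. K \<in> Y \<Longrightarrow> is_plane K" and H: "H \<in> Y"
    and n: "q + 2 \<le> npoints Y H"
  shows "has_tangent_field Y q \<longleftrightarrow> 0 < q \<and> has_tangent_field (Y - {H}) (q - 1)"
proof -
  have pH: "is_plane H" using Y H by blast
  define w where "w = normal H"
  have w: "w \<noteq> 0" "H = kern w" using normal[OF pH] by (simp_all add: w_def)
  show ?thesis
  proof
    assume "has_tangent_field Y q"
    then obtain \<theta> v0 where \<theta>: "homv q \<theta>" "\<And>K. K \<in> Y \<Longrightarrow> tangent \<theta> K" "cross v0 (\<theta> v0) \<noteq> 0"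
      unfolding has_tangent_field_def by blast
    have "cross v (\<theta> v) = 0" if "v \<in> H" for v
      by (rule radial_on_plane_if_many_points[OF pH, of "Y - {H}" q \<theta> v])
        (use Y H \<theta> n that in \<open>auto simp: npoints_def\<close>)
    then obtain g \<eta> where g: "hom (q - 1) g" and \<eta>: "homv (q - 1) \<eta>" and q0: "q = 0 \<Longrightarrow> \<theta> = (\<lambda>v. 0)"
      and eq: "\<And>v. \<theta> v = g v *s v + dot w v *s \<eta> v"
      using radial_on_plane_decomposition[OF w(1) \<theta>(1)] w(2) by blast
    have "0 < q" using q0 \<theta>(3) by (cases q) auto
    moreover have "tangent \<eta> K" if K: "K \<in> Y - {H}" for K
    proof -
      have nK: "normal K \<noteq> 0" "K = kern (normal K)" using normal Y(2) K by blast+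
      have c: "cross w (normal K) \<noteq> 0"
        unfolding w_def by (rule cross_normals_nonzero) (use pH Y K in auto)
      have "dot (normal K) (\<eta> v) = 0" if v: "v \<in> kern (normal K)" for v
      proof (rule hom_cancel_dot_kern[OF homv_dot[OF \<eta>] c _ v])
        fix v assume v: "v \<in> kern (normal K)"
        then have "\<theta> v \<in> kern (normal K)" using \<theta>(2)[of K] K nK by (auto simp: tangent_def)
        then have "dot (normal K) (g v *s v + dot w v *s \<eta> v) = 0" by (simp add: kern_def eq)
        then show "dot w v * dot (normal K) (\<eta> v) = 0" using v by (simp add: kern_def)
      qed
      then show ?thesis using nK(2) by (auto simp: tangent_def kern_def)
    qed
    moreover have "cross v0 (\<eta> v0) \<noteq> 0" using \<theta>(3) by (auto simp: eq)
    ultimately show "0 < q \<and> has_tangent_field (Y - {H}) (q - 1)"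
      unfolding has_tangent_field_def using \<eta> by blast
  next
    assume "0 < q \<and> has_tangent_field (Y - {H}) (q - 1)"
    then obtain \<theta> v0 where q: "0 < q" and \<theta>: "homv (q - 1) \<theta>" "\<And>K. K \<in> Y - {H} \<Longrightarrow> tangent \<theta> K"
      "cross v0 (\<theta> v0) \<noteq> 0"
      unfolding has_tangent_field_def by blast
    define \<eta> where "\<eta> = (\<lambda>v. dot w v *s \<theta> v)"
    have "homv q \<eta>"
      unfolding homv_def \<eta>_def using hom_dot[of "q - 1" "\<lambda>v. \<theta> v $ i" w for i] \<theta>(1) q
      by (simp add: homv_def)
    moreover have "tangent \<eta> K" if "K \<in> Y" for K
    proof (cases "K = H")
      case True
      then show ?thesis using w(2) by (auto simp: tangent_def \<eta>_def kern_def)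
    next
      case False
      then have "tangent \<theta> K" "K = kern (normal K)" using \<theta>(2) normal Y(2) that by auto
      then show ?thesis unfolding tangent_def \<eta>_def
        by (metis (no_types, lifting) image_subset_iff kern_closed(1))
    qed
    moreover have "\<exists>v. cross v (\<eta> v) \<noteq> 0"
    proof (rule ccontr)
      assume "\<not> ?thesis"
      then have z: "dot w v *s cross v (\<theta> v) = 0" for v by (simp add: \<eta>_def)
      have "cross v0 (\<theta> v0) $ i = 0" for i
      proof (rule hom_cancel_dot[of q "\<lambda>v. cross v (\<theta> v) $ i" w v0])
        show "hom q (\<lambda>v. cross v (\<theta> v) $ i)"
          using homv_cross[OF \<theta>(1)] q by (simp add: homv_def)
        show "dot w v * cross v (\<theta> v) $ i = 0" for v
          using z[of v] by (metis vector_smult_component zero_index)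
      qed (rule w(1))
      then show False using \<theta>(3) by (simp add: vec_eq_iff)
    qed
    ultimately show "has_tangent_field Y q" unfolding has_tangent_field_def by blast
  qed
qed

section \<open>Existence of tangent fields by counting conditions\<close>

lemma ex_nontrivial_solution:
  fixes A :: "'i \<Rightarrow> 'j \<Rightarrow> complex"
  assumes "finite J" "finite I" "card J < card I"
  shows "\<exists>c. (\<exists>i\<in>I. c i \<noteq> 0) \<and> (\<forall>j\<in>J. (\<Sum>i\<in>I. c i * A i j) = 0)"
  using assms
proof (induction J arbitrary: I A rule: finite_induct)
  case empty
  then obtain i where "i \<in> I" by (auto simp: card_gt_0_iff)
  then show ?case by (intro exI[of _ "\<lambda>_. 1"]) auto
next
  case (insert j J)
  show ?case
  proof (cases "\<forall>i\<in>I. A i j = 0")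
    case True
    obtain c where "\<exists>i\<in>I. c i \<noteq> 0" "\<forall>k\<in>J. (\<Sum>i\<in>I. c i * A i k) = 0"
      using insert.IH[of I A] insert.prems insert.hyps by auto
    then show ?thesis using True by (intro exI[of _ c]) auto
  next
    case False
    then obtain i0 where i0: "i0 \<in> I" "A i0 j \<noteq> 0" by blast
    define B where "B = (\<lambda>i k. A i k - A i j / A i0 j * A i0 k)"
    have "card J < card (I - {i0})" using insert.prems insert.hyps i0 by simp
    then obtain c where c: "\<exists>i\<in>I - {i0}. c i \<noteq> 0" "\<And>k. k \<in> J \<Longrightarrow> (\<Sum>i\<in>I - {i0}. c i * B i k) = 0"
      using insert.IH[of "I - {i0}" B] insert.prems by auto
    define s where "s = (\<Sum>i\<in>I - {i0}. c i * A i j)"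
    define c' where "c' = (\<lambda>i. if i = i0 then - s / A i0 j else c i)"
    have sum: "(\<Sum>i\<in>I. c' i * A i k) = - s / A i0 j * A i0 k + (\<Sum>i\<in>I - {i0}. c i * A i k)" for k
    proof -
      have "(\<Sum>i\<in>I. c' i * A i k) = c' i0 * A i0 k + (\<Sum>i\<in>I - {i0}. c' i * A i k)"
        using insert.prems i0 by (simp add: sum.remove)
      then show ?thesis by (simp add: c'_def)
    qed
    have "(\<Sum>i\<in>I. c' i * A i k) = 0" if "k \<in> insert j J" for k
    proof (cases "k = j")
      case True
      then show ?thesis using i0 by (simp add: sum s_def)
    next
      case False
      then have "k \<in> J" using that by simp
      have "(\<Sum>i\<in>I - {i0}. c i * B i k) = (\<Sum>i\<in>I - {i0}. c i * A i k) - s / A i0 j * A i0 k"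
        by (simp add: B_def s_def algebra_simps sum_subtractf sum_distrib_left sum_distrib_right sum_divide_distrib)
      then show ?thesis using c(2)[OF \<open>k \<in> J\<close>] by (simp add: sum)
    qed
    moreover have "\<exists>i\<in>I. c' i \<noteq> 0" using c(1) by (auto simp: c'_def)
    ultimately show ?thesis by blast
  qed
qed

text \<open>Representatives of the fields of degree \<open>q\<close> modulo multiples of the Euler field: the third
  component is a polynomial in \<open>x\<close> and \<open>y\<close> only.\<close>

definition exps :: "nat \<Rightarrow> (nat \<times> nat) set" where
  "exps q = {(i, j). i + j \<le> q}"

definition top_exps :: "nat \<Rightarrow> (nat \<times> nat) set" where
  "top_exps q = {(i, j). i + j = q}"

definition field_index :: "nat \<Rightarrow> (3 \<times> nat \<times> nat) set" where
  "field_index q = ({1} \<times> exps q) \<union> ({2} \<times> exps q) \<union> ({3} \<times> top_exps q)"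

definition monomial3 :: "nat \<Rightarrow> nat \<times> nat \<Rightarrow> cvec \<Rightarrow> complex" where
  "monomial3 q m v = v $ 1 ^ fst m * v $ 2 ^ snd m * v $ 3 ^ (q - fst m - snd m)"

definition mono_field :: "nat \<Rightarrow> (3 \<times> nat \<times> nat \<Rightarrow> complex) \<Rightarrow> cvec \<Rightarrow> cvec" where
  "mono_field q c v = (\<Sum>(k, m)\<in>field_index q. (c (k, m) * monomial3 q m v) *s axis k 1)"

lemma exps_eq: "exps q = (SIGMA i:{..q}. {..q - i})"
  by (auto simp: exps_def)

lemma top_exps_eq: "top_exps q = (\<lambda>j. (q - j, j)) ` {..q}"
  by (auto simp: top_exps_def image_iff)

lemma finite_exps: "finite (exps q)" "finite (top_exps q)" "finite (field_index q)"
  by (auto simp: exps_eq top_exps_eq field_index_def)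

lemma card_field_index: "card (field_index q) = (q + 1) * (q + 3)"
proof -
  have c1: "2 * card (exps q) = (q + 1) * (q + 2)"
  proof -
    have "card (exps q) = (\<Sum>i\<le>q. q - i + 1)" by (simp add: exps_eq)
    also have "\<dots> = (\<Sum>i\<le>q. i + 1)" by (rule sum.reindex_bij_witness[of _ "\<lambda>i. q - i" "\<lambda>i. q - i"]) auto
    also have "2 * \<dots> = (q + 1) * (q + 2)" by (induction q) auto
    finally show ?thesis .
  qed
  have c2: "card (top_exps q) = q + 1"
    unfolding top_exps_eq by (subst card_image) (auto simp: inj_on_def)
  have "card (field_index q) = 2 * card (exps q) + card (top_exps q)"
  proof -
    have "({1} \<times> exps q \<union> {2} \<times> exps q) \<inter> {3::3} \<times> top_exps q = {}"
      "{1} \<times> exps q \<inter> {2::3} \<times> exps q = {}" by auto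
    then show ?thesis
      by (simp add: field_index_def card_Un_disjoint finite_exps card_cartesian_product)
  qed
  then show ?thesis using c1 c2 by (simp add: algebra_simps)
qed

lemma hom_monomial3:
  assumes "m \<in> exps q"
  shows "hom q (monomial3 q m)"
proof -
  have "hom (fst m + snd m + (q - fst m - snd m)) (monomial3 q m)"
    unfolding monomial3_def[abs_def] by (intro hom_mult hom_power1 hom_nth[unfolded One_nat_def])
  then show ?thesis using assms by (auto simp: exps_def)
qed

lemma mono_field_nth:
  "mono_field q c v $ 1 = (\<Sum>m\<in>exps q. c (1, m) * monomial3 q m v)"
  "mono_field q c v $ 2 = (\<Sum>m\<in>exps q. c (2, m) * monomial3 q m v)"
  "mono_field q c v $ 3 = (\<Sum>m\<in>top_exps q. c (3, m) * monomial3 q m v)"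
proof -
  have d: "({1} \<times> exps q \<union> {2} \<times> exps q) \<inter> {3::3} \<times> top_exps q = {}"
    "{1} \<times> exps q \<inter> {2::3} \<times> exps q = {}" by auto
  have s: "mono_field q c v $ i = (\<Sum>(k, m)\<in>{1} \<times> exps q. c (k, m) * monomial3 q m v * axis k 1 $ i)
     + (\<Sum>(k, m)\<in>{2} \<times> exps q. c (k, m) * monomial3 q m v * axis k 1 $ i)
     + (\<Sum>(k, m)\<in>{3} \<times> top_exps q. c (k, m) * monomial3 q m v * axis k 1 $ i)" for i
    unfolding mono_field_def field_index_def sum_component case_prod_beta
    by (subst sum.union_disjoint; (subst sum.union_disjoint)?)
      (use d in \<open>auto simp: finite_exps\<close>)
  show "mono_field q c v $ 1 = (\<Sum>m\<in>exps q. c (1, m) * monomial3 q m v)"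
    "mono_field q c v $ 2 = (\<Sum>m\<in>exps q. c (2, m) * monomial3 q m v)"
    "mono_field q c v $ 3 = (\<Sum>m\<in>top_exps q. c (3, m) * monomial3 q m v)"
    unfolding s sum.cartesian_product[symmetric] by (simp_all add: axis_def)
qed

lemma homv_mono_field: "homv q (mono_field q c)"
proof -
  have "top_exps q \<subseteq> exps q" by (auto simp: exps_def top_exps_def)
  then show ?thesis
    unfolding homv_def forall_3 mono_field_nth
    by (intro conjI hom_sum hom_cmult hom_monomial3 finite_exps) auto
qed

lemma bivariate_coeffs_zero:
  assumes "\<And>x y :: complex. (\<Sum>(i, j)\<in>exps q. c i j * x ^ i * y ^ j) = 0" "(i, j) \<in> exps q"
  shows "c i j = 0"
proof -
  have 1: "(\<Sum>i\<le>q. (\<Sum>j\<le>q - i. c i j * y ^ j) * x ^ i) = 0" for x y :: complex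
    using assms(1)[of x y] unfolding exps_eq
    by (subst (asm) sum.Sigma[symmetric]) (auto simp: sum_distrib_left sum_distrib_right mult_ac)
  have 2: "(\<Sum>j\<le>q - i. c i j * y ^ j) = 0" for y
    using iffD1[OF polyfun_eq_0, rule_format, of "\<lambda>i. \<Sum>j\<le>q - i. c i j * y ^ j" q i] 1 assms(2)
    by (auto simp: exps_def)
  show ?thesis
    using iffD1[OF polyfun_eq_0, rule_format, of "c i" "q - i" j] 2 assms(2) by (auto simp: exps_def)
qed

lemma mono_field_not_radial:
  assumes "i \<in> field_index q" "c i \<noteq> 0"
  shows "\<exists>v. cross v (mono_field q c v) \<noteq> 0"
proof (rule ccontr)
  assume "\<not> ?thesis"
  then have rad: "cross v (mono_field q c v) = 0" for v by blast
  define \<theta> where "\<theta> = mono_field q c"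
  have top: "c (3, q - j, j) = 0" if "j \<le> q" for j
  proof -
    have "(\<Sum>j\<le>q. c (3, q - j, j) * y ^ j) = 0" for y
    proof -
      let ?v = "vector [1, y, 0] :: cvec"
      have "cross ?v (\<theta> ?v) $ 2 = 0" using rad by (simp add: \<theta>_def)
      then have "\<theta> ?v $ 3 = 0" by simp
      then have "(\<Sum>m\<in>top_exps q. c (3, m) * monomial3 q m ?v) = 0" by (simp add: \<theta>_def mono_field_nth)
      then show ?thesis unfolding top_exps_eq
        by (subst (asm) sum.reindex) (auto simp: inj_on_def monomial3_def)
    qed
    then show ?thesis
      using iffD1[OF polyfun_eq_0, rule_format, of "\<lambda>j. c (3, q - j, j)" q j] that by blast
  qed
  then have top': "c (3, m) = 0" if "m \<in> top_exps q" for m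
    using that by (auto simp: top_exps_eq)
  have th3: "\<theta> v $ 3 = 0" for v unfolding \<theta>_def mono_field_nth using top' by simp
  have affine: "\<theta> (vector [x, y, 1]) $ 1 = 0" "\<theta> (vector [x, y, 1]) $ 2 = 0" for x y
  proof -
    let ?v = "vector [x, y, 1] :: cvec"
    have "cross ?v (\<theta> ?v) $ 2 = 0" "cross ?v (\<theta> ?v) $ 1 = 0" using rad by (simp_all add: \<theta>_def)
    then show "\<theta> ?v $ 1 = 0" "\<theta> ?v $ 2 = 0" using th3[of ?v] by simp_all
  qed
  have "c (1, i, j) = 0" if "(i, j) \<in> exps q" for i j
    by (rule bivariate_coeffs_zero[of "\<lambda>i j. c (1, i, j)", OF _ that])
      (use affine(1) in \<open>simp add: \<theta>_def mono_field_nth monomial3_def case_prod_beta mult.assoc\<close>)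
  moreover have "c (2, i, j) = 0" if "(i, j) \<in> exps q" for i j
    by (rule bivariate_coeffs_zero[of "\<lambda>i j. c (2, i, j)", OF _ that])
      (use affine(2) in \<open>simp add: \<theta>_def mono_field_nth monomial3_def case_prod_beta mult.assoc\<close>)
  ultimately show False using top' assms by (auto simp: field_index_def)
qed

lemma ex_field_satisfying_conditions:
  assumes "finite C" "card C < (q + 1) * (q + 3)"
  obtains \<theta> where "homv q \<theta>" "\<And>w v. (w, v) \<in> C \<Longrightarrow> dot w (\<theta> v) = 0" "\<exists>v. cross v (\<theta> v) \<noteq> 0"
proof -
  define A where "A = (\<lambda>(k, m) (w, v). monomial3 q m v * dot w (axis k 1))"
  obtain c where c: "\<exists>i\<in>field_index q. c i \<noteq> 0"
    "\<And>j. j \<in> C \<Longrightarrow> (\<Sum>i\<in>field_index q. c i * A i j) = 0"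
    using ex_nontrivial_solution[OF assms(1) finite_exps(3)[of q], of A] assms(2) card_field_index
    by metis
  have dot_sum: "dot w (sum f S) = (\<Sum>i\<in>S. dot w (f i))" for w f and S :: "(3 \<times> nat \<times> nat) set"
    by (induction S rule: infinite_finite_induct) auto
  have "dot w (mono_field q c v) = (\<Sum>i\<in>field_index q. c i * A i (w, v))" for w v
    unfolding mono_field_def dot_sum by (rule sum.cong) (auto simp: A_def)
  then show thesis
    using that[OF homv_mono_field, of c] c mono_field_not_radial by metis
qed

subsection \<open>Counting the lines of intersection\<close>

definition crossings :: "cvec set set \<Rightarrow> cvec set set" where
  "crossings Y = {H \<inter> K | H K. H \<in> Y \<and> K \<in> Y \<and> H \<noteq> K}"

definition pencil_size :: "cvec set set \<Rightarrow> cvec set \<Rightarrow> nat" where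
  "pencil_size X p = card {K \<in> X. p \<subseteq> K}"

text \<open>Both intersections are lines.\<close>

lemma Int_planes_eq_if_subset:
  assumes "is_plane H" "is_plane K" "H \<noteq> K" "is_plane H'" "is_plane K'" "H' \<noteq> K'"
    and "H \<inter> K \<subseteq> H' \<inter> K'"
  shows "H \<inter> K = H' \<inter> K'"
proof -
  have line: "\<exists>d. d \<noteq> 0 \<and> H \<inter> K = range (\<lambda>c. c *s d)"
    if "is_plane H" "is_plane K" "H \<noteq> K" for H K
    using kern_Int_kern[OF cross_normals_nonzero[OF that]] cross_normals_nonzero[OF that] normal that
    by metis
  obtain d where d: "d \<noteq> 0" "H \<inter> K = range (\<lambda>c. c *s d)" using line[OF assms(1-3)] by blast
  obtain d' where d': "H' \<inter> K' = range (\<lambda>c. c *s d')" using line[OF assms(4-6)] by blast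
  have "1 *s d \<in> H \<inter> K" unfolding d(2) by blast
  then have "d \<in> range (\<lambda>c. c *s d')" using assms(7) d' by auto
  then obtain c where c: "d = c *s d'" by blast
  then have "c \<noteq> 0" using d(1) by auto
  have "range (\<lambda>c. c *s d') \<subseteq> range (\<lambda>c. c *s d)"
  proof
    fix v assume "v \<in> range (\<lambda>c. c *s d')"
    then obtain e where "v = e *s d'" by blast
    then have "v = (e / c) *s d" using c \<open>c \<noteq> 0\<close> by simp
    then show "v \<in> range (\<lambda>c. c *s d)" by blast
  qed
  then show ?thesis using assms(7) d(2) d' by auto
qed

text \<open>The MacLane arrangement: planes and triple crossings correspond to the points and the
  three-point lines of the affine plane over the field with three elements with one point removed.
  Counting shows that every plane carries three triple crossings and a double one.\<close>

definition is_maclane :: "cvec set set \<Rightarrow> bool" where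
  "is_maclane Y \<longleftrightarrow> card Y = 8 \<and> (\<forall>H\<in>Y. npoints Y H = 4) \<and>
     (\<forall>H\<in>Y. \<forall>K\<in>Y - {H}. card {K' \<in> Y - {H}. H \<inter> K' = H \<inter> K} \<le> 2)"

locale plane_arrangement =
  fixes Y :: "cvec set set"
  assumes finite_Y: "finite Y" and planes: "\<And>H. H \<in> Y \<Longrightarrow> is_plane H"
begin

lemma finite_crossings: "finite (crossings Y)"
proof -
  have "crossings Y \<subseteq> (\<lambda>(H, K). H \<inter> K) ` (Y \<times> Y)" by (auto simp: crossings_def)
  then show ?thesis using finite_Y by (meson finite_SigmaI finite_imageI finite_subset)
qed

lemma crossing_eq:
  assumes "p \<in> crossings Y" "H \<in> Y" "K \<in> Y" "H \<noteq> K" "p \<subseteq> H" "p \<subseteq> K"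
  shows "p = H \<inter> K"
proof -
  obtain H' K' where "p = H' \<inter> K'" "H' \<in> Y" "K' \<in> Y" "H' \<noteq> K'"
    using assms(1) by (auto simp: crossings_def)
  then show ?thesis using Int_planes_eq_if_subset[of H' K' H K] assms planes by blast
qed

lemma crossings_in_plane:
  assumes "H \<in> Y"
  shows "{p \<in> crossings Y. p \<subseteq> H} = (\<lambda>K. H \<inter> K) ` (Y - {H})"
proof (intro equalityI subsetI)
  fix p assume p: "p \<in> {p \<in> crossings Y. p \<subseteq> H}"
  then obtain H' K' where "p = H' \<inter> K'" "H' \<in> Y" "K' \<in> Y" "H' \<noteq> K'"
    by (auto simp: crossings_def)
  then obtain K where "K \<in> Y" "K \<noteq> H" "p \<subseteq> K" by blast
  then show "p \<in> (\<lambda>K. H \<inter> K) ` (Y - {H})" using crossing_eq[of p H K] p assms by blast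
qed (use assms in \<open>auto simp: crossings_def\<close>)

lemma pencil_fibre:
  assumes "p \<in> crossings Y" "p \<subseteq> H" "H \<in> Y" "X \<subseteq> Y" "H \<notin> X"
  shows "pencil_size X p = card {K \<in> X. H \<inter> K = p}"
proof -
  have "{K \<in> X. p \<subseteq> K} = {K \<in> X. H \<inter> K = p}"
    using crossing_eq[of p H] assms by blast
  then show ?thesis by (simp add: pencil_size_def)
qed

lemma pencil_insert:
  assumes "X \<subseteq> Y" "H \<notin> X"
  shows "pencil_size (insert H X) p = pencil_size X p + (if p \<subseteq> H then 1 else 0)"
proof -
  have "{K \<in> insert H X. p \<subseteq> K} = (if p \<subseteq> H then insert H {K \<in> X. p \<subseteq> K} else {K \<in> X. p \<subseteq> K})"
    by auto
  then show ?thesis using assms finite_subset[OF assms(1) finite_Y] by (simp add: pencil_size_def)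
qed

text \<open>Conditions saved when planes are added one at a time: a plane arriving at a crossing that
  already lies on \<open>k\<close> planes saves \<open>k - 1\<close>, and these numbers add up to a binomial coefficient.
  For crossings on no plane of \<open>X\<close> the truncated difference gives 0.\<close>

definition savings :: "cvec set set \<Rightarrow> nat" where
  "savings X = (\<Sum>p\<in>crossings Y. (pencil_size X p - 1) choose 2)"

lemma choose_2_pred: "m choose 2 = ((m - 1) choose 2) + (m - 1)" for m :: nat
  by (cases m) (simp_all add: numeral_2_eq_2)

lemma savings_insert:
  assumes "X \<subseteq> Y" "H \<in> Y" "H \<notin> X"
  shows "savings (insert H X) + card ((\<lambda>K. H \<inter> K) ` X) = savings X + card X"
proof -
  have X: "finite X" using assms(1) finite_Y by (rule finite_subset)
  let ?P = "{p \<in> crossings Y. p \<subseteq> H}"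
  let ?I = "(\<lambda>K. H \<inter> K) ` X"
  have I: "?I \<subseteq> ?P" using assms by (auto simp: crossings_def)
  have "savings (insert H X) = (\<Sum>p\<in>crossings Y. ((pencil_size X p - 1) choose 2) + (if p \<subseteq> H then pencil_size X p - 1 else 0))"
    unfolding savings_def
  proof (rule sum.cong)
    fix p
    show "(pencil_size (insert H X) p - 1) choose 2 =
        ((pencil_size X p - 1) choose 2) + (if p \<subseteq> H then pencil_size X p - 1 else 0)"
      using choose_2_pred[of "pencil_size X p"] by (simp add: pencil_insert[OF assms(1,3)])
  qed simp
  also have "\<dots> = savings X + (\<Sum>p\<in>?P. pencil_size X p - 1)"
    by (simp add: savings_def sum.distrib finite_crossings flip: sum.inter_filter)
  also have "(\<Sum>p\<in>?P. pencil_size X p - 1) = (\<Sum>p\<in>?I. pencil_size X p - 1)"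
  proof (rule sum.mono_neutral_right)
    show "\<forall>p\<in>?P - ?I. pencil_size X p - 1 = 0"
    proof
      fix p assume p: "p \<in> ?P - ?I"
      then have "{K \<in> X. H \<inter> K = p} = {}" by auto
      moreover have "pencil_size X p = card {K \<in> X. H \<inter> K = p}"
        by (rule pencil_fibre) (use p assms in auto)
      ultimately show "pencil_size X p - 1 = 0" by (metis card.empty diff_0_eq_0)
    qed
  qed (use finite_crossings I in auto)
  finally have 1: "savings (insert H X) = savings X + (\<Sum>p\<in>?I. pencil_size X p - 1)" .
  have "(\<Sum>p\<in>?I. pencil_size X p - 1) + card ?I = (\<Sum>p\<in>?I. (pencil_size X p - 1) + 1)"
    by (simp only: sum.distrib card_eq_sum)
  also have "\<dots> = (\<Sum>p\<in>?I. card {K \<in> X. H \<inter> K = p})"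
  proof (rule sum.cong)
    fix p assume p: "p \<in> ?I"
    then have "{K \<in> X. H \<inter> K = p} \<noteq> {}" by auto
    then have "card {K \<in> X. H \<inter> K = p} > 0" using X by (simp add: card_gt_0_iff)
    moreover have "pencil_size X p = card {K \<in> X. H \<inter> K = p}"
      by (rule pencil_fibre) (use p I assms in blast)+
    ultimately show "(pencil_size X p - 1) + 1 = card {K \<in> X. H \<inter> K = p}" by linarith
  qed simp
  also have "\<dots> = card X"
    using card_eq_sum sum.image_gen[OF X, of "\<lambda>_. 1::nat" "\<lambda>K. H \<inter> K"] by simp
  finally show ?thesis using 1 by simp
qed

lemma sum_over_flags:
  "(\<Sum>p\<in>crossings Y. pencil_size Y p * g p) = (\<Sum>H\<in>Y. \<Sum>p\<in>(\<lambda>K. H \<inter> K) ` (Y - {H}). g p)" for g :: "_ \<Rightarrow> nat"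
proof -
  have "(\<Sum>p\<in>crossings Y. pencil_size Y p * g p) = (\<Sum>p\<in>crossings Y. \<Sum>H\<in>{H \<in> Y. p \<subseteq> H}. g p)"
    by (simp add: pencil_size_def)
  also have "\<dots> = (\<Sum>H\<in>Y. \<Sum>p\<in>{p \<in> crossings Y. p \<subseteq> H}. g p)"
    by (rule sum.swap_restrict) (simp_all add: finite_Y finite_crossings)
  also have "\<dots> = (\<Sum>H\<in>Y. \<Sum>p\<in>(\<lambda>K. H \<inter> K) ` (Y - {H}). g p)"
    by (rule sum.cong) (simp_all add: crossings_in_plane)
  finally show ?thesis .
qed

lemma sum_pencil: "(\<Sum>p\<in>crossings Y. pencil_size Y p) = (\<Sum>H\<in>Y. npoints Y H)"
  using sum_over_flags[of "\<lambda>_. 1"] by (simp add: npoints_def)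

lemma pencil_minus_one:
  assumes "H \<in> Y" "p \<in> (\<lambda>K. H \<inter> K) ` (Y - {H})"
  shows "pencil_size Y p - 1 = card {K \<in> Y - {H}. H \<inter> K = p}"
proof -
  have p: "p \<in> crossings Y" "p \<subseteq> H" using crossings_in_plane[OF assms(1)] assms(2) by auto
  have "pencil_size (insert H (Y - {H})) p = pencil_size (Y - {H}) p + 1"
    using pencil_insert[of "Y - {H}" H p] p by auto
  then show ?thesis using pencil_fibre[OF p assms(1), of "Y - {H}"] assms(1) by (simp add: insert_absorb)
qed

lemma sum_pencil_pairs: "(\<Sum>p\<in>crossings Y. pencil_size Y p * (pencil_size Y p - 1)) = card Y * (card Y - 1)"
proof -
  have "(\<Sum>p\<in>(\<lambda>K. H \<inter> K) ` (Y - {H}). pencil_size Y p - 1) = card Y - 1" if H: "H \<in> Y" for H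
  proof -
    have "(\<Sum>p\<in>(\<lambda>K. H \<inter> K) ` (Y - {H}). pencil_size Y p - 1) =
        (\<Sum>p\<in>(\<lambda>K. H \<inter> K) ` (Y - {H}). card {K \<in> Y - {H}. H \<inter> K = p})"
      using pencil_minus_one[OF H] by (rule sum.cong[OF refl])
    also have "\<dots> = card (Y - {H})"
      using card_eq_sum sum.image_gen[of "Y - {H}" "\<lambda>_. 1::nat" "\<lambda>K. H \<inter> K"] finite_Y by simp
    finally show ?thesis using H by simp
  qed
  then show ?thesis by (simp add: sum_over_flags)
qed

lemma pencil_ge_2:
  assumes "p \<in> crossings Y"
  shows "pencil_size Y p \<ge> 2"
proof -
  obtain H K where HK: "p = H \<inter> K" "H \<in> Y" "K \<in> Y" "H \<noteq> K" using assms by (auto simp: crossings_def)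
  then have "card {H, K} \<le> pencil_size Y p" unfolding pencil_size_def using finite_Y by (intro card_mono) auto
  then show ?thesis using HK by simp
qed

text \<open>\<open>6 C(m - 1, 2) = 2 (m (m - 1) - m) + (m - 2) (m - 3)\<close>, summed over the crossings.\<close>

lemma savings_formula:
  "6 * int (savings Y) = 2 * (int (card Y) * (int (card Y) - 1)) - 2 * int (\<Sum>H\<in>Y. npoints Y H)
     + (\<Sum>p\<in>crossings Y. (int (pencil_size Y p) - 2) * (int (pencil_size Y p) - 3))"
proof -
  have c: "2 * int ((m - 1) choose 2) = (int m - 1) * (int m - 2)" if m: "m \<ge> 2" for m
  proof -
    have "2 * (n choose 2) = n * (n - 1)" for n :: nat
    proof (induction n)
      case (Suc n)
      then show ?case by (cases n) (simp_all add: numeral_2_eq_2)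
    qed simp
    from this[of "m - 1"] have "2 * ((m - 1) choose 2) = (m - 1) * (m - 2)"
      by (simp add: numeral_2_eq_2)
    then have "int (2 * ((m - 1) choose 2)) = int (m - 1) * int (m - 2)" by simp
    then show ?thesis using m by (simp add: of_nat_diff)
  qed
  have pairs: "int (card Y) * (int (card Y) - 1) = (\<Sum>p\<in>crossings Y. int (pencil_size Y p) * (int (pencil_size Y p) - 1))"
  proof -
    have "int (card Y) * (int (card Y) - 1) = int (card Y * (card Y - 1))"
      by (cases "card Y") (auto simp: algebra_simps)
    also have "\<dots> = (\<Sum>p\<in>crossings Y. int (pencil_size Y p * (pencil_size Y p - 1)))"
      by (simp only: sum_pencil_pairs flip: of_nat_sum)
    also have "\<dots> = (\<Sum>p\<in>crossings Y. int (pencil_size Y p) * (int (pencil_size Y p) - 1))"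
    proof (rule sum.cong)
      fix p assume "p \<in> crossings Y"
      then have "pencil_size Y p \<ge> 2" by (rule pencil_ge_2)
      then show "int (pencil_size Y p * (pencil_size Y p - 1)) = int (pencil_size Y p) * (int (pencil_size Y p) - 1)"
        by (simp add: of_nat_diff)
    qed simp
    finally show ?thesis .
  qed
  have "6 * int (savings Y) = (\<Sum>p\<in>crossings Y. 3 * (2 * int ((pencil_size Y p - 1) choose 2)))"
    by (simp add: savings_def sum_distrib_left)
  also have "\<dots> = (\<Sum>p\<in>crossings Y. 2 * (int (pencil_size Y p) * (int (pencil_size Y p) - 1)) - 2 * int (pencil_size Y p)
      + (int (pencil_size Y p) - 2) * (int (pencil_size Y p) - 3))"
  proof (rule sum.cong)
    fix p assume "p \<in> crossings Y"
    from c[OF pencil_ge_2[OF this]]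
    show "3 * (2 * int ((pencil_size Y p - 1) choose 2)) = 2 * (int (pencil_size Y p) * (int (pencil_size Y p) - 1))
        - 2 * int (pencil_size Y p) + (int (pencil_size Y p) - 2) * (int (pencil_size Y p) - 3)"
      by (simp only:) (simp add: algebra_simps)
  qed simp
  also have "\<dots> = 2 * (int (card Y) * (int (card Y) - 1)) - 2 * int (\<Sum>H\<in>Y. npoints Y H)
     + (\<Sum>p\<in>crossings Y. (int (pencil_size Y p) - 2) * (int (pencil_size Y p) - 3))"
    unfolding pairs sum_pencil[symmetric] by (simp add: sum.distrib sum_subtractf sum_distrib_left)
  finally show ?thesis .
qed

text \<open>The zeros forced on \<open>H\<close> by some of the planes number at most those forced by all of them, so
  a bound for the whole arrangement holds at every stage of its construction.\<close>

lemma excess_mono: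
  assumes "X \<subseteq> Y" "H \<in> Y" "H \<notin> X"
  shows "card X + npoints Y H \<le> card ((\<lambda>K. H \<inter> K) ` X) + (card Y - 1)"
proof -
  let ?f = "\<lambda>K. H \<inter> K"
  let ?Z = "Y - {H} - X"
  have fin: "finite X" "finite ?Z" using finite_Y assms by (auto intro: finite_subset)
  have YH: "Y - {H} = X \<union> ?Z" using assms by blast
  have "npoints Y H = card (?f ` X \<union> ?f ` ?Z)" unfolding npoints_def by (subst YH) (simp only: image_Un)
  also have "\<dots> \<le> card (?f ` X) + card (?f ` ?Z)" by (rule card_Un_le)
  also have "card (?f ` ?Z) \<le> card ?Z" by (rule card_image_le[OF fin(2)])
  finally have 1: "npoints Y H \<le> card (?f ` X) + card ?Z" by simp
  have "card (Y - {H}) = card X + card ?Z"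
    by (subst YH) (rule card_Un_disjoint, use fin in auto)
  then show ?thesis using 1 assms finite_Y by simp
qed

text \<open>Adding a plane \<open>H\<close> to those in \<open>X\<close>, tangency to \<open>H\<close> follows from the vanishing of the normal
  component at \<open>q + 1 - (card X - n)\<close> further points, \<open>n\<close> being the number of crossings
  with \<open>X\<close> on \<open>H\<close>.\<close>

lemma ex_conditions:
  assumes "X \<subseteq> Y" and excess: "\<And>H. H \<in> Y \<Longrightarrow> card Y \<le> npoints Y H + q + 1"
  shows "\<exists>C. finite C \<and> card C + savings X \<le> card X * (q + 1) \<and>
    (\<forall>\<theta>. homv q \<theta> \<longrightarrow> (\<forall>(w, v)\<in>C. dot w (\<theta> v) = 0) \<longrightarrow> (\<forall>H\<in>X. tangent \<theta> H))"
  using finite_subset[OF assms(1) finite_Y] assms(1)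
proof (induction X rule: finite_induct)
  case empty
  have "savings {} = 0" by (simp add: savings_def pencil_size_def)
  then show ?case by (intro exI[of _ "{}"]) simp
next
  case (insert H X)
  then obtain C where C: "finite C" "card C + savings X \<le> card X * (q + 1)"
    "\<And>\<theta>. homv q \<theta> \<Longrightarrow> (\<forall>(w, v)\<in>C. dot w (\<theta> v) = 0) \<Longrightarrow> (\<forall>H\<in>X. tangent \<theta> H)"
    by blast
  have H: "H \<in> Y" "X \<subseteq> Y" "H \<notin> X" using insert by auto
  have pX: "is_plane K" if "K \<in> X" for K using planes H that by blast
  obtain a b \<tau> where ch: "chart H X a b \<tau>"
    using ex_chart[OF planes[OF H(1)] insert.hyps(1) pX H(3)] by blast
  define n where "n = card ((\<lambda>K. H \<inter> K) ` X)"
  have n: "card (\<tau> ` X) = n" "n \<le> card X"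
    using card_chart[OF ch insert.hyps(1)] insert.hyps(1) by (auto simp: n_def card_image_le)
  have "card X + npoints Y H \<le> n + (card Y - 1)"
    unfolding n_def by (rule excess_mono[OF H(2,1,3)])
  then have e: "card X \<le> n + q" using excess[OF H(1)] by linarith
  have "infinite (- \<tau> ` X)" using insert.hyps(1) by (simp add: infinite_UNIV_char_0 Compl_eq_Diff_UNIV)
  then obtain E where E: "finite E" "card E = q + 1 + n - card X" "E \<subseteq> - \<tau> ` X"
    using infinite_arbitrarily_large by blast
  define C' where "C' = C \<union> (\<lambda>s. (normal H, a + s *s b)) ` E"
  have "card C' \<le> card C + card E"
    unfolding C'_def by (meson add_mono card_Un_le card_image_le E(1) le_refl order_trans)
  moreover have "savings (insert H X) + n = savings X + card X"
    unfolding n_def by (rule savings_insert[OF H(2,1,3)])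
  moreover have "card (insert H X) * (q + 1) = card X * (q + 1) + (q + 1)"
    using insert.hyps by simp
  ultimately have "card C' + savings (insert H X) \<le> card (insert H X) * (q + 1)"
    using C(2) E(2) e n(2) by linarith
  moreover have "\<forall>K\<in>insert H X. tangent \<theta> K"
    if th: "homv q \<theta>" and c: "\<forall>(w, v)\<in>C'. dot w (\<theta> v) = 0" for \<theta>
  proof -
    have tX: "tangent \<theta> K" if "K \<in> X" for K using C(3)[OF th] c that by (auto simp: C'_def)
    have "tangent \<theta> H"
    proof (rule tangent_if_many_zeros[OF planes[OF H(1)] insert.hyps(1) pX ch th tX E(1)])
      show "E \<inter> \<tau> ` X = {}" using E(3) by blast
      show "dot (normal H) (\<theta> (a + s *s b)) = 0" if "s \<in> E" for s
        using c that by (auto simp: C'_def)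
      show "q + card (\<tau> ` X) < card E + card X" using E(2) e n by linarith
    qed
    then show ?thesis using tX by blast
  qed
  moreover have "finite C'" using C(1) E(1) by (simp add: C'_def)
  ultimately show ?case by blast
qed

lemma has_tangent_field_if_few_conditions:
  assumes "\<And>H. H \<in> Y \<Longrightarrow> card Y \<le> npoints Y H + q + 1"
    and "card Y * (q + 1) < (q + 1) * (q + 3) + savings Y"
  shows "has_tangent_field Y q"
proof -
  obtain C where C: "finite C" "card C + savings Y \<le> card Y * (q + 1)"
    "\<And>\<theta>. homv q \<theta> \<Longrightarrow> (\<forall>(w, v)\<in>C. dot w (\<theta> v) = 0) \<Longrightarrow> (\<forall>H\<in>Y. tangent \<theta> H)"
    using ex_conditions[OF order_refl assms(1)] by blast
  have "card C < (q + 1) * (q + 3)" using C(2) assms(2) by linarith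
  then obtain \<theta> where "homv q \<theta>" "\<And>w v. (w, v) \<in> C \<Longrightarrow> dot w (\<theta> v) = 0" "\<exists>v. cross v (\<theta> v) \<noteq> 0"
    using ex_field_satisfying_conditions[OF C(1)] by blast
  then show ?thesis unfolding has_tangent_field_def using C(3)[of \<theta>] by auto
qed

text \<open>Put \<open>e = d - 2 - q\<close>. If \<open>n\<^sub>H \<le> q + 1\<close> for all \<open>H\<close>, three times the surplus of unknowns over
  conditions is at least \<open>3 (d - 1 - e) (1 - e) + d e\<close>. For \<open>e = 2\<close> this is \<open>9 - d\<close>, which is where
  the bound on the number of planes comes from. For \<open>d \<le> 8\<close> the only value that is not positive
  is 0, at \<open>d = 8\<close> and \<open>e = 3\<close>; there the surplus is positive unless all \<open>n\<^sub>H\<close> equal 4 and all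
  crossings have multiplicity at most 3.\<close>

lemma has_tangent_field_if_few_points:
  assumes d: "card Y < 9"
    and excess: "\<And>H. H \<in> Y \<Longrightarrow> card Y \<le> npoints Y H + q + 1"
    and few: "\<And>H. H \<in> Y \<Longrightarrow> npoints Y H \<le> q + 1"
    and exc: "\<not> (q = 3 \<and> is_maclane Y)"
  shows "has_tangent_field Y q"
proof (rule has_tangent_field_if_few_conditions[OF excess])
  define d where "d = int (card Y)"
  define N where "N = int (\<Sum>H\<in>Y. npoints Y H)"
  define S where "S = (\<Sum>p\<in>crossings Y. (int (pencil_size Y p) - 2) * (int (pencil_size Y p) - 3))"
  have d8: "0 \<le> d" "d \<le> 8" using d by (auto simp: d_def)
  have "(\<Sum>H\<in>Y. npoints Y H) \<le> card Y * (q + 1)"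
    using sum_bounded_above[of Y "npoints Y" "q + 1"] few by simp
  then have "int (\<Sum>H\<in>Y. npoints Y H) \<le> int (card Y * (q + 1))" by (simp only: of_nat_le_iff)
  then have N: "N \<le> d * (int q + 1)" by (simp add: N_def d_def algebra_simps)
  have term0: "(int (pencil_size Y p) - 2) * (int (pencil_size Y p) - 3) \<ge> 0" if "p \<in> crossings Y" for p
    using pencil_ge_2[OF that] by (cases "pencil_size Y p = 2") auto
  then have S: "S \<ge> 0" unfolding S_def by (intro sum_nonneg) auto
  have sav: "6 * int (savings Y) = 2 * (d * (d - 1)) - 2 * N + S"
    unfolding d_def N_def S_def by (rule savings_formula)
  have goal: "6 * (d * (int q + 1)) < 6 * ((int q + 1) * (int q + 3)) + 6 * int (savings Y)"
  proof (cases "d \<le> int q + 2")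
    case True
    then have "d * (int q + 1) < (int q + 3) * (int q + 1)" by (intro mult_strict_right_mono) auto
    then have "d * (int q + 1) < (int q + 1) * (int q + 3)" by (simp only: mult.commute)
    moreover have "0 \<le> int (savings Y)" by simp
    ultimately show ?thesis by linarith
  next
    case False
    show ?thesis
    proof (cases "d = 8 \<and> q = 3")
      case True
      have "N < 32 \<or> S > 0"
      proof (rule ccontr)
        assume "\<not> ?thesis"
        then have NS: "N \<ge> 32" "S = 0" using S by auto
        have p4: "npoints Y H = 4" if H: "H \<in> Y" for H
        proof (rule ccontr)
          assume "npoints Y H \<noteq> 4"
          then have "npoints Y H < 4" using few[OF H] True by simp
          then have "(\<Sum>H\<in>Y. npoints Y H) < (\<Sum>H\<in>Y. 4)"
            using few True H by (intro sum_strict_mono_ex1[OF finite_Y]) auto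
          then have "(\<Sum>H\<in>Y. npoints Y H) < 32" using True by (simp add: d_def)
          then have "N < 32" unfolding N_def by linarith
          then show False using NS by simp
        qed
        have le3: "pencil_size Y p \<le> 3" if p: "p \<in> crossings Y" for p
        proof (rule ccontr)
          assume "\<not> pencil_size Y p \<le> 3"
          then have "(int (pencil_size Y p) - 2) * (int (pencil_size Y p) - 3) > 0" by simp
          then have "S > 0" unfolding S_def
            using p term0 finite_crossings by (intro sum_pos2[of _ p]) auto
          then show False using NS by simp
        qed
        have "card {K' \<in> Y - {H}. H \<inter> K' = H \<inter> K} \<le> 2" if "H \<in> Y" "K \<in> Y - {H}" for H K
        proof -
          have "H \<inter> K \<in> crossings Y" using that by (auto simp: crossings_def)
          then show ?thesis using pencil_minus_one[of H "H \<inter> K"] le3[of "H \<inter> K"] that by auto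
        qed
        then have "is_maclane Y" unfolding is_maclane_def using p4 True by (auto simp: d_def)
        then show False using exc True by blast
      qed
      then show ?thesis using True sav N S by auto
    next
      case False': False
      have q: "q \<le> 5" using False d8 by linarith
      have "d \<in> {0, 1, 2, 3, 4, 5, 6, 7, 8}" using d8 by auto
      moreover have "q \<in> {0, 1, 2, 3, 4, 5}" using q by auto
      ultimately have "6 * (d * (int q + 1)) <
          6 * ((int q + 1) * (int q + 3)) + (2 * (d * (d - 1)) - 2 * (d * (int q + 1)))"
        using False False' by (elim insertE emptyE) simp_all
      then show ?thesis using sav N S by linarith
    qed
  qed
  then show "card Y * (q + 1) < (q + 1) * (q + 3) + savings Y"
  proof -
    have "int (card Y * (q + 1)) < int ((q + 1) * (q + 3) + savings Y)"
      using goal by (simp add: d_def algebra_simps)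
    then show ?thesis by (simp only: of_nat_less_iff)
  qed
qed

end

section \<open>The MacLane arrangement\<close>

lemma poly_eq_prod_if_roots:
  fixes p :: "complex poly"
  assumes "finite T" "degree p \<le> card T" "\<And>t. t \<in> T \<Longrightarrow> poly p t = 0"
  shows "p = smult (coeff p (card T)) (\<Prod>t\<in>T. [:-t, 1:])"
proof (rule ccontr)
  define m where "m = (\<Prod>t\<in>T. [:-t, 1:])"
  define r where "r = p - smult (coeff p (card T)) m"
  assume "p \<noteq> smult (coeff p (card T)) (\<Prod>t\<in>T. [:-t, 1:])"
  then have r: "r \<noteq> 0" by (simp add: r_def m_def)
  have dm: "degree m = card T"
    unfolding m_def by (subst degree_prod_sum_eq) auto
  have "lead_coeff m = 1" unfolding m_def by (subst lead_coeff_prod) simp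
  then have "coeff r (card T) = 0" using dm by (simp add: r_def)
  moreover have "degree r \<le> card T" using assms(2) dm by (auto simp: r_def intro!: degree_diff_le)
  ultimately have "degree r < card T"
    using r by (metis le_neq_implies_less leading_coeff_0_iff)
  moreover have "card T \<le> card {t. poly r t = 0}"
    by (intro card_mono poly_roots_finite r)
      (use assms(1,3) in \<open>auto simp: r_def m_def poly_prod prod_zero_iff\<close>)
  ultimately show False using card_poly_roots_bound[OF r] by linarith
qed

lemma in_plane_iff:
  assumes "is_plane K"
  shows "v \<in> K \<longleftrightarrow> dot (normal K) v = 0"
  by (subst normal(2)[OF assms]) (simp add: kern_def)

lemma tangent_quotient:
  assumes "is_plane K" "homv (Suc q) \<theta>" "tangent \<theta> K"
  obtains h where "hom q h" "\<And>v. dot (normal K) (\<theta> v) = dot (normal K) v * h v"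
proof -
  have K: "normal K \<noteq> 0" "K = kern (normal K)" using normal assms(1) by blast+
  have "dot (normal K) (\<theta> v) = 0" if "v \<in> kern (normal K)" for v
  proof -
    have "v \<in> K" using that by (simp add: kern_def in_plane_iff[OF assms(1)])
    then have "\<theta> v \<in> K" using assms(3) by (auto simp: tangent_def)
    then show ?thesis by (simp add: in_plane_iff[OF assms(1)])
  qed
  then obtain h where "hom (Suc q - 1) h" "\<And>v. dot (normal K) (\<theta> v) = dot (normal K) v * h v"
    using hom_divide[OF homv_dot[OF assms(2)] K(1)] by blast
  then show thesis using that by simp
qed

text \<open>The residue theorem for the foliation induced by a cubic field on the projective line of \<open>H\<close>.
  At a crossing, with \<open>\<theta> p = e p\<close>, the transversal and tangential eigenvalues are
  \<open>h H p - e\<close> and \<open>h K p - e\<close>; if they agree at three of the four crossings, their ratio at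
  the fourth is \<open>1 - 3\<close>. In the chart the tangential ones are the values of the derivative of
  the quartic \<open>s\<close> defining the restricted foliation, and the argument is Lagrange
  interpolation.\<close>

lemma transversal_eigenvalue_at_fourth_crossing:
  assumes H: "is_plane H" and Z: "finite Z" "\<And>K. K \<in> Z \<Longrightarrow> is_plane K"
    and ch: "chart H Z a b \<tau>" and \<theta>: "homv 3 \<theta>" "\<And>K. K \<in> insert H Z \<Longrightarrow> tangent \<theta> K"
    and h: "\<And>K. K \<in> insert H Z \<Longrightarrow> hom 2 (h K)"
      "\<And>K v. K \<in> insert H Z \<Longrightarrow> dot (normal K) (\<theta> v) = dot (normal K) v * h K v"
    and K: "K \<in> Z" "card (\<tau> ` Z) = 4"
    and eq: "\<And>K'. K' \<in> Z \<Longrightarrow> \<tau> K' \<noteq> \<tau> K \<Longrightarrow> h H (a + \<tau> K' *s b) = h K' (a + \<tau> K' *s b)"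
    and p: "p \<in> H" "p \<in> K" "p \<noteq> 0"
  shows "\<exists>e. \<theta> p = e *s p \<and> h H p - e = -2 * (h K p - e) \<and>
    (h K p = e \<longrightarrow> (\<forall>v\<in>H. cross v (\<theta> v) = 0))"
proof -
  define w where "w = normal H"
  have w: "w \<noteq> 0" "H = kern w" using normal[OF H] by (simp_all add: w_def)
  have ab: "a \<in> kern w" "b \<in> kern w" "cross a b \<noteq> 0" using ch w by (auto simp: chart_def)
  obtain \<alpha> where \<alpha>: "dot a \<alpha> = 1" "dot b \<alpha> = 0" by (rule ex_dual_vector_kern[OF ab(3)])
  have "cross b a \<noteq> 0" using ab(3) by (subst cross_commute) simp
  then obtain \<beta> where \<beta>: "dot b \<beta> = 1" "dot a \<beta> = 0" by (rule ex_dual_vector_kern)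
  have coords: "v = dot \<alpha> v *s a + dot \<beta> v *s b" if v: "v \<in> H" for v
  proof -
    obtain x y where xy: "v = x *s a + y *s b"
      using plane_coordinates[OF w(1) ab] v w by blast
    then show ?thesis using \<alpha> \<beta> by (simp add: dot_commute[of \<alpha>] dot_commute[of \<beta>])
  qed
  obtain A where A: "degree A \<le> 3" "\<And>t. dot \<alpha> (\<theta> (a + t *s b)) = poly A t"
    using hom_on_line[OF homv_dot[OF \<theta>(1), of \<alpha>], of a b] by blast
  obtain B where B: "degree B \<le> 3" "\<And>t. dot \<beta> (\<theta> (a + t *s b)) = poly B t"
    using hom_on_line[OF homv_dot[OF \<theta>(1), of \<beta>], of a b] by blast
  have in_H: "a + t *s b \<in> H" for t using ab w by (simp add: kern_closed)
  have "\<theta> (a + t *s b) \<in> H" for t using in_H[of t] \<theta>(2)[of H] by (auto simp: tangent_def)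
  then have line: "\<theta> (a + t *s b) = poly A t *s a + poly B t *s b" for t
    using coords A(2) B(2) by metis
  \<comment> \<open>The restricted foliation in the affine coordinate \<open>t\<close>. As \<open>B\<close> has degree at most 3, the
    coefficient of \<open>s\<close> in degree 4 is minus that of \<open>A\<close> in degree 3.\<close>
  define s where "s = B - [:0, 1:] * A"
  have deg_s: "degree s \<le> 4"
    unfolding s_def using A(1) B(1)
    by (intro degree_diff_le) (auto intro!: order_trans[OF degree_pCons_le])
  have coeff_s: "coeff s 4 = - coeff A 3"
    using coeff_eq_0[of B 4] B(1) by (simp add: s_def coeff_pCons numeral_eq_Suc)
  obtain g where g: "degree g \<le> 2" "\<And>t. h H (a + t *s b) = poly g t"
    using hom_on_line[OF h(1)[of H], of a b] by blast
  have deriv: "h K' (a + \<tau> K' *s b) - poly A (\<tau> K') = poly (pderiv s) (\<tau> K')"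
    and root: "poly s (\<tau> K') = 0" if K': "K' \<in> Z" for K'
  proof -
    define t where "t = \<tau> K'"
    obtain k where k: "\<And>t. h K' (a + t *s b) = poly k t"
      using hom_on_line[OF h(1)[of K'], of a b] K' by blast
    have "b \<notin> K'" "a + t *s b \<in> K'" using ch K' by (auto simp: chart_def t_def)
    then have n: "dot (normal K') b \<noteq> 0" "dot (normal K') a = - t * dot (normal K') b"
      by (auto simp: in_plane_iff[OF Z(2)[OF K']] eq_neg_iff_add_eq_0)
    have "s = [:-t, 1:] * (k - A)"
    proof -
      have "s - [:-t, 1:] * (k - A) = 0"
      proof (rule poly_eq_if_cofinite[of "{}"])
        fix r
        have "dot (normal K') (poly A r *s a + poly B r *s b) =
            dot (normal K') (a + r *s b) * poly k r"
          using h(2)[of K' "a + r *s b"] K' by (simp only: line k) simp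
        then have "dot (normal K') b * (poly B r - t * poly A r) = dot (normal K') b * ((r - t) * poly k r)"
          by (simp add: n(2) algebra_simps)
        then have "poly B r - t * poly A r = (r - t) * poly k r" using n(1) by simp
        then show "poly (s - [:-t, 1:] * (k - A)) r = 0" by (simp add: s_def algebra_simps)
      qed simp
      then show ?thesis by simp
    qed
    moreover from this have "pderiv s = [:-t, 1:] * pderiv (k - A) + (k - A) * pderiv [:-t, 1:]"
      by (simp only: pderiv_mult)
    ultimately show "h K' (a + \<tau> K' *s b) - poly A (\<tau> K') = poly (pderiv s) (\<tau> K')" "poly s (\<tau> K') = 0"
      by (simp_all add: pderiv_pCons k t_def)
  qed
  define T where "T = \<tau> ` Z - {\<tau> K}"
  have T: "finite T" "card T = 3" "\<tau> K \<notin> T" "\<tau> ` Z = insert (\<tau> K) T"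
    using Z(1) K by (auto simp: T_def)
  define m where "m = (\<Prod>t\<in>T. [:-t, 1:])"
  have s: "s = smult (coeff s 4) ([:-\<tau> K, 1:] * m)"
  proof -
    have "s = smult (coeff s (card (\<tau> ` Z))) (\<Prod>t\<in>\<tau> ` Z. [:-t, 1:])"
      by (rule poly_eq_prod_if_roots) (use root deg_s K(2) Z(1) in auto)
    also have "(\<Prod>t\<in>\<tau> ` Z. [:-t, 1:]) = [:-\<tau> K, 1:] * m"
      unfolding T(4) m_def by (rule prod.insert[OF T(1,3)])
    finally show ?thesis by (simp only: K(2))
  qed
  \<comment> \<open>\<open>R\<close> is the difference of the two eigenvalues at the crossings. It has degree 3 and vanishes
    at three crossings, so it is determined by its leading coefficient.\<close>
  define R where "R = g - A - pderiv s"
  have "degree R \<le> 3" unfolding R_def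
    using g(1) A(1) deg_s by (intro degree_diff_le) (auto simp: degree_pderiv)
  moreover have "coeff R 3 = -3 * coeff s 4"
  proof -
    have "coeff g 3 = 0" using g(1) by (intro coeff_eq_0) simp
    moreover have "coeff (pderiv s) 3 = 4 * coeff s 4"
      by (simp add: coeff_pderiv numeral_eq_Suc)
    ultimately show ?thesis using coeff_s by (simp add: R_def)
  qed
  moreover have "poly R t = 0" if "t \<in> T" for t
  proof -
    obtain K' where K': "K' \<in> Z" "t = \<tau> K'" using \<open>t \<in> T\<close> by (auto simp: T_def)
    then have "\<tau> K' \<noteq> \<tau> K" using that T(3) by auto
    then show ?thesis using eq[OF K'(1)] deriv[OF K'(1)] g(2) K'(2) by (simp add: R_def)
  qed
  ultimately have R: "R = smult (-3 * coeff s 4) m"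
    using poly_eq_prod_if_roots[OF T(1), of R] T(2) by (simp add: m_def)
  have s': "poly (pderiv s) (\<tau> K) = coeff s 4 * poly m (\<tau> K)"
  proof -
    have "pderiv s = smult (coeff s 4) ([:-\<tau> K, 1:] * pderiv m + m * pderiv [:-\<tau> K, 1:])"
      by (subst s) (simp only: pderiv_smult pderiv_mult)
    then show ?thesis by (simp add: pderiv_pCons)
  qed
  define p0 where "p0 = a + \<tau> K *s b"
  define e0 where "e0 = poly A (\<tau> K)"
  have tang: "h K p0 - e0 = poly (pderiv s) (\<tau> K)"
    using deriv[OF K(1)] by (simp add: p0_def e0_def)
  have "h H p0 - e0 - poly (pderiv s) (\<tau> K) = poly R (\<tau> K)"
    by (simp add: R_def p0_def e0_def g(2))
  also have "\<dots> = -3 * poly (pderiv s) (\<tau> K)" by (simp add: R s')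
  finally have "h H p0 - e0 - poly (pderiv s) (\<tau> K) = -3 * poly (pderiv s) (\<tau> K)" .
  moreover have "x = -2 * y" if "x - y = -3 * y" for x y :: complex
    using that by (simp add: diff_eq_eq)
  ultimately have trans: "h H p0 - e0 = -2 * (h K p0 - e0)" unfolding tang by blast
  have th0: "\<theta> p0 = e0 *s p0"
  proof -
    have "poly B (\<tau> K) = \<tau> K * poly A (\<tau> K)" using root[OF K(1)] by (simp add: s_def)
    then show ?thesis
      by (simp add: p0_def e0_def line vec.scale_right_distrib mult.commute)
  qed
  have radial: "cross v (\<theta> v) = 0" if "h K p0 = e0" and v: "v \<in> H" for v
  proof -
    have "poly m (\<tau> K) \<noteq> 0" using T by (auto simp: m_def poly_prod prod_zero_iff)
    then have "coeff s 4 = 0" using that(1) tang s' by simp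
    then have "s = 0" using s by simp
    then have B_eq: "poly B t = t * poly A t" for t by (simp add: s_def)
    have "cross (a + t *s b) (\<theta> (a + t *s b)) $ i = 0" for t i
    proof -
      have "\<theta> (a + t *s b) = poly A t *s (a + t *s b)"
        by (simp add: line B_eq vec.scale_right_distrib mult.commute)
      then show ?thesis by (metis cross_linear(3,6) vec.scale_zero_right zero_index)
    qed
    then have "cross v (\<theta> v) $ i = 0" for i
      using vanish_on_plane[of 4 "\<lambda>v. cross v (\<theta> v) $ i", OF _ w(1) ab _ v[unfolded w(2)]]
        homv_cross[OF \<theta>(1)] by (simp add: homv_def)
    then show ?thesis by (simp add: vec_eq_iff)
  qed
  have p0: "p0 \<in> H" "p0 \<in> K" "p0 \<noteq> 0"
  proof -
    show "p0 \<in> H" using in_H by (simp add: p0_def)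
    show "p0 \<in> K" using ch K(1) by (auto simp: chart_def p0_def)
    have "cross p0 b \<noteq> 0" using ab(3) by (simp add: p0_def)
    then show "p0 \<noteq> 0" by auto
  qed
  have "\<exists>c. p = c *s p0"
  proof -
    obtain x y where xy: "p = x *s a + y *s b"
      using plane_coordinates[OF w(1) ab] p(1) w by blast
    note in_K = in_plane_iff[OF Z(2)[OF K(1)]]
    have "b \<notin> K" using ch K(1) by (auto simp: chart_def)
    then have nb: "dot (normal K) b \<noteq> 0" by (simp add: in_K)
    have "dot (normal K) (a + \<tau> K *s b) = 0" "dot (normal K) (x *s a + y *s b) = 0"
      using p0(2) p(2) xy unfolding in_K p0_def by simp_all
    then have "dot (normal K) a = - \<tau> K * dot (normal K) b" "x * dot (normal K) a + y * dot (normal K) b = 0"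
      by (auto simp: eq_neg_iff_add_eq_0)
    then have "(y - x * \<tau> K) * dot (normal K) b = 0" by (simp add: algebra_simps)
    then have "y = x * \<tau> K" using nb by simp
    then have "p = x *s p0" using xy by (simp add: p0_def vec.scale_right_distrib)
    then show ?thesis by blast
  qed
  then obtain c where c: "p = c *s p0" by blast
  then have "c \<noteq> 0" using p(3) by auto
  have hc: "h K' p = c ^ 2 * h K' p0" if "K' \<in> insert H Z" for K'
    using hom_scale[OF h(1)[OF that]] c by simp
  have "\<theta> p = (c ^ 2 * e0) *s p"
  proof -
    have "\<theta> p $ i = c ^ 3 * \<theta> p0 $ i" for i
      using hom_scale[of 3 "\<lambda>v. \<theta> v $ i" c p0] \<theta>(1) c by (simp add: homv_def)
    then show ?thesis by (simp add: vec_eq_iff c th0 power3_eq_cube power2_eq_square)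
  qed
  moreover have "h H p - c ^ 2 * e0 = -2 * (h K p - c ^ 2 * e0)"
  proof -
    have "c ^ 2 * (h H p0 - e0) = c ^ 2 * (-2 * (h K p0 - e0))" using trans by (rule arg_cong)
    then show ?thesis using hc K(1) by (simp add: algebra_simps)
  qed
  moreover have "\<forall>v\<in>H. cross v (\<theta> v) = 0" if "h K p = c ^ 2 * e0"
    using that hc[of K] K(1) \<open>c \<noteq> 0\<close> radial by simp
  ultimately show ?thesis by blast
qed

text \<open>At a triple crossing this applies with each of the three planes as \<open>H\<close>, so that all three
  quotients take the same value there.\<close>

lemma tangent_quotients_agree:
  assumes H: "is_plane H" and K: "is_plane K" "H \<noteq> K" and K': "is_plane K'" "H \<noteq> K'" and eq: "H \<inter> K = H \<inter> K'"
    and \<theta>: "tangent \<theta> H" and h: "hom q h" "\<And>v. dot (normal K) (\<theta> v) = dot (normal K) v * h v"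
    and h': "hom q h'" "\<And>v. dot (normal K') (\<theta> v) = dot (normal K') v * h' v" and v: "v \<in> H"
  shows "h v = h' v"
proof -
  define w where "w = normal H"
  have w: "w \<noteq> 0" "H = kern w" using normal[OF H] by (simp_all add: w_def)
  have c: "cross (normal K) w \<noteq> 0" "cross (normal K') w \<noteq> 0"
    unfolding w_def by (intro cross_normals_nonzero assms K(2)[symmetric] K'(2)[symmetric])+
  obtain u where u: "dot (normal K) u = 1" "dot w u = 0" by (rule ex_dual_vector_kern[OF c(1)])
  define r where "r = dot (normal K') u"
  have uH: "u \<in> H" using u w by (simp add: kern_def)
  have "u \<notin> K" using u by (simp add: in_plane_iff[OF K(1)])
  then have "u \<notin> K'" using eq uH by blast
  then have r: "r \<noteq> 0" by (simp add: r_def in_plane_iff[OF K'(1)])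
  \<comment> \<open>On \<open>H\<close> the equations of \<open>K\<close> and \<open>K'\<close> have the same zeros, so they are proportional.\<close>
  have scaled: "dot (normal K') x = r * dot (normal K) x" if x: "x \<in> H" for x
  proof -
    have "x - dot (normal K) x *s u \<in> H" using x uH w by (simp add: kern_closed)
    moreover have "x - dot (normal K) x *s u \<in> K" using u by (simp add: in_plane_iff[OF K(1)])
    ultimately have "x - dot (normal K) x *s u \<in> K'" using eq by blast
    then show ?thesis by (simp add: in_plane_iff[OF K'(1)] r_def mult.commute)
  qed
  have "h v - h' v = 0"
  proof (rule hom_cancel_dot_kern[OF hom_diff[OF h(1) h'(1)] c(1)])
    show "v \<in> kern w" using v w by simp
    fix x assume x: "x \<in> kern w"
    then have "\<theta> x \<in> H" using \<theta> w by (auto simp: tangent_def)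
    then have "dot (normal K') x * h' x = r * (dot (normal K) x * h x)"
      using scaled[of "\<theta> x"] by (simp add: h(2) h'(2))
    then have "r * dot (normal K) x * h' x = r * (dot (normal K) x * h x)"
      using scaled[of x] x w(2) by metis
    then have "dot (normal K) x * h x = dot (normal K) x * h' x"
      using r unfolding mult.assoc by (metis mult_left_cancel)
    then show "dot (normal K) x * (h x - h' x) = 0" by (simp only: right_diff_distrib diff_self)
  qed
  then show ?thesis by simp
qed

context plane_arrangement
begin

text \<open>Seven planes meet \<open>H\<close> in four lines, at most two of them in the same one, so the fibres have
  the sizes 2, 2, 2, 1.\<close>

lemma maclane_unique_double:
  assumes "is_maclane Y" "H \<in> Y"
  obtains K where "K \<in> Y - {H}" "{K' \<in> Y - {H}. H \<inter> K' = H \<inter> K} = {K}"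
    "\<And>K'. K' \<in> Y - {H} \<Longrightarrow> H \<inter> K' \<noteq> H \<inter> K \<Longrightarrow> \<exists>K''\<in>Y - {H}. K'' \<noteq> K' \<and> H \<inter> K'' = H \<inter> K'"
proof -
  let ?Z = "Y - {H}" and ?f = "\<lambda>K. H \<inter> K"
  define m where "m = (\<lambda>p. card {K \<in> ?Z. ?f K = p})"
  have Z: "finite ?Z" "card ?Z = 7" using finite_Y assms by (auto simp: is_maclane_def)
  have I: "card (?f ` ?Z) = 4" using assms by (auto simp: is_maclane_def npoints_def)
  have m2: "m p \<le> 2" if "p \<in> ?f ` ?Z" for p using assms that by (auto simp: is_maclane_def m_def)
  have m1: "m p \<ge> 1" if "p \<in> ?f ` ?Z" for p
  proof -
    have "{K \<in> ?Z. ?f K = p} \<noteq> {}" "finite {K \<in> ?Z. ?f K = p}" using that Z by auto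
    then have "0 < card {K \<in> ?Z. ?f K = p}" by (simp only: card_gt_0_iff simp_thms)
    then show ?thesis unfolding m_def by linarith
  qed
  have "(\<Sum>p\<in>?f ` ?Z. m p) = 7"
    unfolding m_def using card_eq_sum sum.image_gen[OF Z(1), of "\<lambda>_. 1::nat" ?f] Z(2) by simp
  moreover have "(\<Sum>p\<in>?f ` ?Z. 2 - m p) + (\<Sum>p\<in>?f ` ?Z. m p) = (\<Sum>p\<in>?f ` ?Z. 2)"
    unfolding sum.distrib[symmetric] by (rule sum.cong) (use m2 in auto)
  ultimately have "(\<Sum>p\<in>?f ` ?Z. 2 - m p) = 1" using I by simp
  then obtain p where p: "p \<in> ?f ` ?Z" "2 - m p = 1" "\<And>p'. p' \<in> ?f ` ?Z \<Longrightarrow> p' \<noteq> p \<Longrightarrow> 2 - m p' = 0"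
    using sum_eq_1_iff[of "?f ` ?Z" "\<lambda>p. 2 - m p"] Z(1) by auto
  obtain K where K: "K \<in> ?Z" "p = H \<inter> K" using p(1) by blast
  have "card {K' \<in> ?Z. H \<inter> K' = H \<inter> K} = 1" using p(2) K(2) by (simp add: m_def)
  then obtain K1 where K1: "{K' \<in> ?Z. H \<inter> K' = H \<inter> K} = {K1}" by (rule card_1_singletonE)
  have "K \<in> {K' \<in> ?Z. H \<inter> K' = H \<inter> K}" using K(1) by simp
  then have "K = K1" unfolding K1 by (rule singletonD)
  then have single: "{K' \<in> ?Z. H \<inter> K' = H \<inter> K} = {K}" using K1 by simp
  have "\<exists>K''\<in>?Z. K'' \<noteq> K' \<and> H \<inter> K'' = H \<inter> K'" if K': "K' \<in> ?Z" "H \<inter> K' \<noteq> H \<inter> K" for K'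
  proof (rule ccontr)
    assume "\<not> ?thesis"
    then have "\<And>K''. K'' \<in> ?Z \<Longrightarrow> H \<inter> K'' = H \<inter> K' \<Longrightarrow> K'' = K'" by blast
    then have "{K'' \<in> ?Z. H \<inter> K'' = H \<inter> K'} = {K'}" using K'(1) by (intro equalityI subsetI) (simp_all del: Diff_iff)
    then have "m (H \<inter> K') = 1" by (simp add: m_def)
    moreover have "2 - m (H \<inter> K') = 0" using p(3) K' K(2) by blast
    ultimately show False by simp
  qed
  then show thesis using that K(1) single by blast
qed

lemma maclane_eigenvalues:
  assumes ml: "is_maclane Y" and \<theta>: "homv 3 \<theta>" "\<And>H. H \<in> Y \<Longrightarrow> tangent \<theta> H"
    and h: "\<And>K. K \<in> Y \<Longrightarrow> hom 2 (h K)"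
      "\<And>K v. K \<in> Y \<Longrightarrow> dot (normal K) (\<theta> v) = dot (normal K) v * h K v"
    and HK: "H \<in> Y" "K \<in> Y - {H}" "{K' \<in> Y - {H}. H \<inter> K' = H \<inter> K} = {K}"
    and p: "p \<in> H" "p \<in> K" "p \<noteq> 0"
  shows "\<exists>e. \<theta> p = e *s p \<and> h H p - e = -2 * (h K p - e) \<and>
    (h K p = e \<longrightarrow> (\<forall>v\<in>H. cross v (\<theta> v) = 0))"
proof -
  let ?Z = "Y - {H}"
  have Z: "finite ?Z" "\<And>K. K \<in> ?Z \<Longrightarrow> is_plane K" "H \<notin> ?Z" using finite_Y planes by auto
  have H: "is_plane H" using planes HK by blast
  obtain K0 where K0: "K0 \<in> ?Z" "{K' \<in> ?Z. H \<inter> K' = H \<inter> K0} = {K0}"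
    "\<And>K'. K' \<in> ?Z \<Longrightarrow> H \<inter> K' \<noteq> H \<inter> K0 \<Longrightarrow> \<exists>K''\<in>?Z. K'' \<noteq> K' \<and> H \<inter> K'' = H \<inter> K'"
    using maclane_unique_double[OF ml HK(1)] by blast
  have "H \<inter> K = H \<inter> K0"
  proof (rule ccontr)
    assume "H \<inter> K \<noteq> H \<inter> K0"
    then obtain K'' where "K'' \<in> ?Z" "K'' \<noteq> K" "H \<inter> K'' = H \<inter> K" using K0(3)[OF HK(2)] by blast
    then show False using HK(3) by blast
  qed
  then have other: "\<exists>K''\<in>?Z. K'' \<noteq> K' \<and> H \<inter> K'' = H \<inter> K'" if "K' \<in> ?Z" "H \<inter> K' \<noteq> H \<inter> K" for K'
    using K0(3) that by simp
  obtain a b \<tau> where ch: "chart H ?Z a b \<tau>" using ex_chart[OF H Z] by blast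
  have c4: "card (\<tau> ` ?Z) = 4"
    using card_chart[OF ch Z(1)] ml HK(1) by (simp add: is_maclane_def npoints_def)
  show ?thesis
  proof (rule transversal_eigenvalue_at_fourth_crossing[OF H Z(1,2) ch \<theta>(1) _ _ _ HK(2) c4 _ p])
    fix K' assume K': "K' \<in> ?Z" "\<tau> K' \<noteq> \<tau> K"
    then have "H \<inter> K' \<noteq> H \<inter> K" using ch HK(2) by (auto simp: chart_def)
    then obtain K'' where K'': "K'' \<in> ?Z" "K'' \<noteq> K'" "H \<inter> K'' = H \<inter> K'" using other K'(1) by blast
    define r where "r = a + \<tau> K' *s b"
    have r: "r \<in> H" "r \<in> K'"
      using ch K' in_plane_iff[OF H] by (auto simp: chart_def r_def)
    have "H \<inter> K' \<subseteq> K' \<inter> K''" using K''(3) by blast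
    then have "H \<inter> K' = K' \<inter> K''"
      using K' K'' HK planes by (intro Int_planes_eq_if_subset) auto
    then have eq: "K' \<inter> H = K' \<inter> K''" by blast
    have "h K' r = h K'' r"
      using K' K'' HK planes h r \<theta>
      by (intro tangent_quotients_agree[of H K' K'' \<theta> 2 "h K'" "h K''" r]) auto
    moreover have "h H r = h K'' r"
      using K' K'' HK planes h r \<theta> eq
      by (intro tangent_quotients_agree[of K' H K'' \<theta> 2 "h H" "h K''" r]) auto
    ultimately show "h H (a + \<tau> K' *s b) = h K' (a + \<tau> K' *s b)" by (simp add: r_def)
  qed (use \<theta> h HK in auto)
qed

text \<open>At a double crossing each of the two reduced eigenvalues is \<open>-2\<close> times the other one, so both
  vanish and \<open>\<theta>\<close> is radial on every plane. But \<open>cross v (\<theta> v)\<close> has degree 4 and cannot vanish on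
  eight planes without being zero.\<close>

lemma no_tangent_field_maclane:
  assumes ml: "is_maclane Y"
  shows "\<not> has_tangent_field Y 3"
proof
  assume "has_tangent_field Y 3"
  then obtain \<theta> v0 where \<theta>: "homv 3 \<theta>" "\<And>H. H \<in> Y \<Longrightarrow> tangent \<theta> H" and v0: "cross v0 (\<theta> v0) \<noteq> 0"
    unfolding has_tangent_field_def by blast
  have "\<forall>K\<in>Y. \<exists>g. hom 2 g \<and> (\<forall>v. dot (normal K) (\<theta> v) = dot (normal K) v * g v)"
  proof
    fix K assume K: "K \<in> Y"
    have "homv (Suc 2) \<theta>" using \<theta>(1) by simp
    then obtain g where "hom 2 g" "\<And>v. dot (normal K) (\<theta> v) = dot (normal K) v * g v"
      using tangent_quotient[OF planes[OF K] _ \<theta>(2)[OF K]] by blast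
    then show "\<exists>g. hom 2 g \<and> (\<forall>v. dot (normal K) (\<theta> v) = dot (normal K) v * g v)" by blast
  qed
  from bchoice[OF this] obtain h where
    hh: "\<forall>K\<in>Y. hom 2 (h K) \<and> (\<forall>v. dot (normal K) (\<theta> v) = dot (normal K) v * h K v)" ..
  have h: "hom 2 (h K)" "dot (normal K) (\<theta> v) = dot (normal K) v * h K v" if "K \<in> Y" for K v
    by (rule conjunct1[OF bspec[OF hh that]], rule spec[OF conjunct2[OF bspec[OF hh that]]])
  have radial: "cross v (\<theta> v) = 0" if H: "H \<in> Y" and v: "v \<in> H" for H v
  proof -
    obtain K where K: "K \<in> Y - {H}" "{K' \<in> Y - {H}. H \<inter> K' = H \<inter> K} = {K}"
    proof (rule maclane_unique_double[OF ml H])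
      fix K assume "K \<in> Y - {H}" "{K' \<in> Y - {H}. H \<inter> K' = H \<inter> K} = {K}"
      then show thesis by (rule that)
    qed
    have HK: "{K' \<in> Y - {K}. K \<inter> K' = K \<inter> H} = {H}"
    proof (intro equalityI subsetI)
      fix K' assume K': "K' \<in> {K' \<in> Y - {K}. K \<inter> K' = K \<inter> H}"
      show "K' \<in> {H}"
      proof (rule ccontr)
        assume "K' \<notin> {H}"
        moreover have "H \<inter> K = H \<inter> K'"
          using K' K H planes \<open>K' \<notin> {H}\<close> by (intro Int_planes_eq_if_subset) auto
        ultimately have "K' \<in> {K' \<in> Y - {H}. H \<inter> K' = H \<inter> K}" using K' by auto
        then have "K' = K" unfolding K(2) by (rule singletonD)
        then show False using K' by simp
      qed
    qed (use H K in auto)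
    have c: "cross (normal H) (normal K) \<noteq> 0"
      by (rule cross_normals_nonzero) (use planes H K in auto)
    define p where "p = cross (normal H) (normal K)"
    have p: "p \<in> H" "p \<in> K" "p \<noteq> 0"
      using c planes H K by (auto simp: p_def in_plane_iff)
    obtain e where e: "\<theta> p = e *s p" "h H p - e = -2 * (h K p - e)"
      "h K p = e \<longrightarrow> (\<forall>v\<in>H. cross v (\<theta> v) = 0)"
      using maclane_eigenvalues[OF ml \<theta> h H K p] by blast
    have "H \<in> Y - {K}" "K \<in> Y" using H K by auto
    then obtain e' where e': "\<theta> p = e' *s p" "h K p - e' = -2 * (h H p - e')"
      using maclane_eigenvalues[OF ml \<theta> h _ _ HK p(2,1,3)] by blast
    have "e *s p = e' *s p" using e(1)[symmetric] e'(1) by (rule trans)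
    then have "e' = e" using p(3) by auto
    then have "h K p - e = 4 * (h K p - e)" using e(2) e'(2) by simp
    then have "h K p = e" by simp
    then show ?thesis using e(3) v by blast
  qed
  have "cross v0 (\<theta> v0) $ i = 0" for i
  proof -
    have "hom 4 (\<lambda>v. cross v (\<theta> v) $ i)" using homv_cross[OF \<theta>(1)] by (simp add: homv_def)
    moreover have "4 < card Y" using ml by (simp add: is_maclane_def)
    ultimately show ?thesis
      using hom_divide_planes[OF finite_Y planes, of 4 "\<lambda>v. cross v (\<theta> v) $ i"] radial by auto
  qed
  then show False using v0 by (simp add: vec_eq_iff)
qed

end

section \<open>Polynomials and polynomial functions\<close>

abbreviation monom_val :: "monom3 \<Rightarrow> cvec \<Rightarrow> complex" where
  "monom_val m v \<equiv> \<Prod>i\<in>UNIV. (v $ i) ^ Poly_Mapping.lookup m i"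

lemma prod_UNIV_3: "prod f (UNIV :: 3 set) = f 1 * f 2 * f 3"
  unfolding UNIV_3 by (simp add: ac_simps)

lemma monom_val_add: "monom_val (m + n) v = monom_val m v * monom_val n v"
  by (simp add: lookup_add power_add prod.distrib)

lemma eval3_superset:
  assumes "finite S" "Poly_Mapping.keys p \<subseteq> S"
  shows "eval3 p v = (\<Sum>m\<in>S. Poly_Mapping.lookup p m * monom_val m v)"
  unfolding eval3_def
  by (rule sum.mono_neutral_left) (use assms in \<open>auto simp: in_keys_iff\<close>)

lemma eval3_add: "eval3 (p + q) v = eval3 p v + eval3 q v"
proof -
  let ?S = "Poly_Mapping.keys p \<union> Poly_Mapping.keys q"
  have "Poly_Mapping.keys (p + q) \<subseteq> ?S" by (rule Poly_Mapping.keys_add)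
  then show ?thesis
    by (simp add: eval3_superset[of ?S] lookup_add distrib_right sum.distrib)
qed

lemma eval3_zero [simp]: "eval3 0 v = 0"
  by (simp add: eval3_def)

lemma eval3_sum: "eval3 (sum f I) v = (\<Sum>i\<in>I. eval3 (f i) v)"
  by (induction I rule: infinite_finite_induct) (simp_all add: eval3_add)

lemma eval3_uminus: "eval3 (- p) v = - eval3 p v"
  using eval3_add[of p "- p" v] by (simp add: eq_neg_iff_add_eq_0 add.commute)

lemma eval3_diff: "eval3 (p - q) v = eval3 p v - eval3 q v"
  using eval3_add[of p "- q" v] by (simp add: eval3_uminus)

lemma eval3_single: "eval3 (Poly_Mapping.single m c) v = c * monom_val m v"
  by (cases "c = 0") (simp_all add: eval3_def)

lemma sum_of_monomials: "p = (\<Sum>m\<in>Poly_Mapping.keys p. Poly_Mapping.single m (Poly_Mapping.lookup p m))"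
  for p :: poly3
proof (rule poly_mapping_eqI)
  fix k
  have "Poly_Mapping.lookup (\<Sum>m\<in>Poly_Mapping.keys p. Poly_Mapping.single m (Poly_Mapping.lookup p m)) k =
      (\<Sum>m\<in>Poly_Mapping.keys p. if m = k then Poly_Mapping.lookup p m else 0)"
    by (simp add: lookup_sum lookup_single when_def)
  also have "\<dots> = Poly_Mapping.lookup p k"
    by (simp add: sum.delta in_keys_iff)
  finally show "Poly_Mapping.lookup p k =
      Poly_Mapping.lookup (\<Sum>m\<in>Poly_Mapping.keys p. Poly_Mapping.single m (Poly_Mapping.lookup p m)) k" ..
qed

lemma eval3_mult: "eval3 (p * q) v = eval3 p v * eval3 q v"
proof -
  let ?s = "Poly_Mapping.single" and ?l = "Poly_Mapping.lookup"
  have "p * q = (\<Sum>m\<in>Poly_Mapping.keys p. \<Sum>n\<in>Poly_Mapping.keys q. ?s m (?l p m) * ?s n (?l q n))"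
    by (subst sum_of_monomials[of p], subst sum_of_monomials[of q]) (rule sum_product)
  then have "eval3 (p * q) v = (\<Sum>m\<in>Poly_Mapping.keys p. \<Sum>n\<in>Poly_Mapping.keys q.
      (?l p m * monom_val m v) * (?l q n * monom_val n v))"
    by (simp add: eval3_sum mult_single eval3_single monom_val_add mult_ac)
  also have "\<dots> = eval3 p v * eval3 q v"
    unfolding eval3_def by (rule sum_product[symmetric])
  finally show ?thesis .
qed

lemma eval3_const [simp]: "eval3 (const3 c) v = c"
  by (simp add: const3_def eval3_single)

lemma eval3_one [simp]: "eval3 1 v = 1"
  using eval3_const[of 1 v] by (simp add: const3_def)

lemma eval3_prod_list: "eval3 (prod_list A) v = (\<Prod>l\<leftarrow>A. eval3 l v)"
  by (induction A) (simp_all add: eval3_mult)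

text \<open>Kronecker substitution \<open>(t, t^N, t^(N^2))\<close> separates the finitely many monomials of a
  polynomial.\<close>

lemma eval3_eq_0_iff: "(\<forall>v. eval3 p v = 0) \<longleftrightarrow> p = 0"
proof
  assume 0: "\<forall>v. eval3 p v = 0"
  let ?l = "Poly_Mapping.lookup" and ?K = "Poly_Mapping.keys p"
  define B where "B = (\<lambda>(m, i). ?l m i) ` (?K \<times> (UNIV :: 3 set))"
  have "finite B" by (simp add: B_def)
  then obtain N where N: "\<And>b. b \<in> B \<Longrightarrow> b < N"
    by (meson finite_nat_set_iff_bounded)
  then have lt: "?l m i < N" if "m \<in> ?K" for m i
    using that by (auto simp: B_def)
  define e where "e = (\<lambda>m :: monom3. ?l m 1 + N * (?l m 2 + N * ?l m 3))"
  have inj: "m = n" if "m \<in> ?K" "n \<in> ?K" "e m = e n" for m n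
  proof -
    have "e m mod N = ?l m 1" "e n mod N = ?l n 1"
      using lt[OF that(1), of 1] lt[OF that(2), of 1] by (simp_all add: e_def)
    then have 1: "?l m 1 = ?l n 1" using that(3) by metis
    have "N > 0" using lt[OF that(1), of 1] by simp
    then have r: "?l m 2 + N * ?l m 3 = ?l n 2 + N * ?l n 3" using that(3) 1 by (simp add: e_def)
    have "(?l m 2 + N * ?l m 3) mod N = ?l m 2" "(?l n 2 + N * ?l n 3) mod N = ?l n 2"
      using lt[OF that(1), of 2] lt[OF that(2), of 2] by simp_all
    then have 2: "?l m 2 = ?l n 2" using r by metis
    then have 3: "?l m 3 = ?l n 3" using r \<open>N > 0\<close> by simp
    have "?l m i = ?l n i" for i using exhaust_3[of i] 1 2 3 by auto
    then show "m = n" by (rule poly_mapping_eqI)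
  qed
  define P where "P = (\<Sum>m\<in>?K. Polynomial.monom (?l p m) (e m))"
  have "P = 0"
  proof (rule poly_eq_if_cofinite[of "{}"])
    fix t
    have "poly P t = eval3 p (vector [t, t ^ N, t ^ (N * N)])"
      unfolding P_def eval3_def poly_sum
      by (rule sum.cong)
        (simp_all add: poly_monom prod_UNIV_3 e_def algebra_simps flip: power_mult power_add)
    then show "poly P t = 0" using 0 by simp
  qed simp
  have "?l p m = 0" if m: "m \<in> ?K" for m
  proof -
    have "coeff P (e m) = (\<Sum>n\<in>?K. if n = m then ?l p n else 0)"
      unfolding P_def coeff_sum by (rule sum.cong) (use inj m in auto)
    also have "\<dots> = ?l p m" using m by (simp add: sum.delta)
    finally show ?thesis using \<open>P = 0\<close> by simp
  qed
  then have "?l p m = 0" for m by (cases "m \<in> ?K") (simp_all add: in_keys_iff)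
  then show "p = 0" by (intro poly_mapping_eqI) simp
qed simp

lemma eval3_inject: "(\<And>v. eval3 p v = eval3 q v) \<Longrightarrow> p = q"
  using eval3_eq_0_iff[of "p - q"] by (simp add: eval3_diff)

lemma hom_eval3:
  assumes "homogeneous (int q) p"
  shows "hom q (eval3 p)"
proof -
  have "hom q (\<lambda>v. Poly_Mapping.lookup p m * monom_val m v)" if m: "m \<in> Poly_Mapping.keys p" for m
  proof -
    have "hom (Poly_Mapping.lookup m 1 + Poly_Mapping.lookup m 2 + Poly_Mapping.lookup m 3) (\<lambda>v. monom_val m v)"
      unfolding prod_UNIV_3 by (intro hom_mult hom_power1 hom_nth[unfolded One_nat_def])
    moreover have "Poly_Mapping.lookup m 1 + Poly_Mapping.lookup m 2 + Poly_Mapping.lookup m 3 = q"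
    proof -
      have "int (monom_degree m) = int q" using assms m unfolding homogeneous_def by blast
      then show ?thesis by (simp only: of_nat_eq_iff monom_degree_def sum_3)
    qed
    ultimately show ?thesis by (simp add: hom_cmult)
  qed
  then show ?thesis unfolding eval3_def[abs_def] by (intro hom_sum) auto
qed

definition linear_poly :: "cvec \<Rightarrow> poly3" where
  "linear_poly w = (\<Sum>i\<in>UNIV. Poly_Mapping.single (Poly_Mapping.single i 1) (w $ i))"

lemma eval3_linear_poly: "eval3 (linear_poly w) v = dot w v"
  by (simp add: linear_poly_def eval3_add eval3_single sum_3 prod_UNIV_3 dot_def lookup_single when_def)

lemma homogeneous_linear_poly_mult:
  assumes "homogeneous (int q) p"
  shows "homogeneous (int (Suc q)) (linear_poly w * p)"
  unfolding homogeneous_def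
proof
  fix m assume "m \<in> Poly_Mapping.keys (linear_poly w * p)"
  then obtain a b where ab: "m = a + b" "a \<in> Poly_Mapping.keys (linear_poly w)" "b \<in> Poly_Mapping.keys p"
    using keys_mult[of "linear_poly w" p] by blast
  have "Poly_Mapping.keys (linear_poly w) \<subseteq> (\<Union>i\<in>UNIV. Poly_Mapping.keys (Poly_Mapping.single (Poly_Mapping.single i (1::nat)) (w $ i)))"
    unfolding linear_poly_def by (rule Poly_Mapping.keys_sum)
  then obtain i where "a = Poly_Mapping.single i 1"
    using ab(2) by (auto split: if_splits)
  then have "monom_degree a = 1"
    by (simp add: monom_degree_def lookup_single when_def)
  moreover have "int (monom_degree b) = int q" using assms ab(3) by (simp add: homogeneous_def)
  ultimately show "int (monom_degree m) = int (Suc q)"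
    by (simp add: ab(1) monom_degree_def lookup_add sum.distrib)
qed

lemma ex_poly_if_hom:
  "hom q F \<Longrightarrow> \<exists>p. homogeneous (int q) p \<and> (\<forall>v. eval3 p v = F v)"
proof (induction rule: hom.induct)
  case (hom_const c)
  have "homogeneous (int 0) (const3 c)"
    by (simp add: homogeneous_def const3_def monom_degree_def)
  then show ?case by (intro exI[of _ "const3 c"]) simp
next
  case (hom_add q F G)
  then obtain f g where fg: "homogeneous (int q) f" "\<forall>v. eval3 f v = F v" "homogeneous (int q) g" "\<forall>v. eval3 g v = G v"
    by blast
  have "homogeneous (int q) (f + g)"
    using fg Poly_Mapping.keys_add[of f g] by (auto simp: homogeneous_def)
  then show ?case using fg by (intro exI[of _ "f + g"]) (simp add: eval3_add)
next
  case (hom_dot q F w)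
  then obtain f where "homogeneous (int q) f" "\<forall>v. eval3 f v = F v" by blast
  then show ?case
    by (intro exI[of _ "linear_poly w * f"] conjI homogeneous_linear_poly_mult)
      (simp_all add: eval3_mult eval3_linear_poly)
qed

lemma hom_1_eq_dot:
  assumes "hom 1 F"
  obtains w where "F = dot w"
proof -
  have "hom q F \<Longrightarrow> (q = 0 \<longrightarrow> (\<exists>c. F = (\<lambda>v. c))) \<and> (q = 1 \<longrightarrow> (\<exists>w. F = dot w))" for q
  proof (induction rule: hom.induct)
    case (hom_add q F G)
    show ?case
    proof (intro conjI impI)
      assume "q = 0"
      then show "\<exists>c. (\<lambda>v. F v + G v) = (\<lambda>v. c)" using hom_add.IH by auto
    next
      assume "q = 1"
      then obtain w x where "F = dot w" "G = dot x" using hom_add.IH by blast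
      then show "\<exists>w. (\<lambda>v. F v + G v) = dot w" by (intro exI[of _ "w + x"] ext) simp
    qed
  next
    case (hom_dot q F w)
    show ?case
    proof (intro conjI impI)
      assume "Suc q = 1"
      then obtain c where "F = (\<lambda>v. c)" using hom_dot.IH by auto
      then show "\<exists>w'. (\<lambda>v. dot w v * F v) = dot w'" by (intro exI[of _ "c *s w"] ext) simp
    qed simp
  qed auto
  then show thesis using assms that by blast
qed

lemma eval3_partial_direction:
  "((\<lambda>s. eval3 p (v + s *s u)) has_field_derivative (\<Sum>i\<in>UNIV. u $ i * eval3 (partial i p) v)) (at 0)"
proof -
  let ?l = "Poly_Mapping.lookup"
  have deriv: "((\<lambda>s. monom_val m (v + s *s u)) has_field_derivative
      (\<Sum>i\<in>UNIV. u $ i * (of_nat (?l m i) * monom_val (m - Poly_Mapping.single i 1) v))) (at 0)" for m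
    unfolding prod_UNIV_3 sum_3
    by (auto intro!: derivative_eq_intros simp: lookup_minus lookup_single when_def algebra_simps)
  have "(\<Sum>i\<in>UNIV. u $ i * eval3 (partial i p) v) =
    (\<Sum>m\<in>Poly_Mapping.keys p. ?l p m * (\<Sum>i\<in>UNIV. u $ i * (of_nat (?l m i) * monom_val (m - Poly_Mapping.single i 1) v)))"
    unfolding partial_def eval3_sum eval3_single sum_distrib_left
    by (subst sum.swap) (simp add: mult_ac)
  moreover have "((\<lambda>s. eval3 p (v + s *s u)) has_field_derivative
    (\<Sum>m\<in>Poly_Mapping.keys p. ?l p m * (\<Sum>i\<in>UNIV. u $ i * (of_nat (?l m i) * monom_val (m - Poly_Mapping.single i 1) v)))) (at 0)"
    unfolding eval3_def by (intro DERIV_sum DERIV_cmult deriv)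
  ultimately show ?thesis by simp
qed

section \<open>Jacobian relations as tangent fields\<close>

lemma hom_cancel_prod_dot:
  assumes "finite S"
  shows "hom q F \<Longrightarrow> (\<And>l. l \<in> S \<Longrightarrow> n l \<noteq> 0) \<Longrightarrow> (\<And>v. (\<Prod>l\<in>S. dot (n l) v) * F v = 0) \<Longrightarrow> F v = 0"
  using assms
proof (induction S arbitrary: q F v rule: finite_induct)
  case (insert l S)
  have "dot (n l) v * F v = 0" for v
  proof (rule insert.IH[OF hom_dot[OF insert.prems(1)]])
    show "(\<Prod>l\<in>S. dot (n l) v) * (dot (n l) v * F v) = 0" for v
      using insert.prems(3)[of v] by (simp only: prod.insert[OF insert.hyps] ac_simps)
  qed (use insert.prems(2) in blast)
  then show ?case using insert.prems(2) by (intro hom_cancel_dot[OF insert.prems(1), of "n l"]) auto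
qed simp

lemma hom_cancel_prod_dot_kern:
  assumes "finite S"
  shows "hom q F \<Longrightarrow> (\<And>l. l \<in> S \<Longrightarrow> cross (n l) x \<noteq> 0) \<Longrightarrow>
    (\<And>v. v \<in> kern x \<Longrightarrow> (\<Prod>l\<in>S. dot (n l) v) * F v = 0) \<Longrightarrow> v \<in> kern x \<Longrightarrow> F v = 0"
  using assms
proof (induction S arbitrary: q F v rule: finite_induct)
  case (insert l S)
  have 0: "dot (n l) v * F v = 0" if v: "v \<in> kern x" for v
  proof (rule insert.IH[OF hom_dot[OF insert.prems(1)] _ _ v])
    show "(\<Prod>l\<in>S. dot (n l) v) * (dot (n l) v * F v) = 0" if "v \<in> kern x" for v
      using insert.prems(3)[OF that] by (simp only: prod.insert[OF insert.hyps] ac_simps)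
  qed (use insert.prems(2) in blast)
  show ?case
    by (rule hom_cancel_dot_kern[OF insert.prems(1) insert.prems(2) 0 insert.prems(4)]) simp
qed simp

definition coeff_vec :: "poly3 \<Rightarrow> cvec" where
  "coeff_vec l = (SOME w. \<forall>v. eval3 l v = dot w v)"

locale nonempty_line_arrangement =
  fixes A :: "poly3 list"
  assumes arr: "line_arrangement A" and nonempty: "A \<noteq> []"
begin

lemma eval3_coeffs:
  assumes "l \<in> set A"
  shows "eval3 l v = dot (coeff_vec l) v"
proof -
  have "hom 1 (eval3 l)" using arr assms hom_eval3[of 1 l] by (simp add: line_arrangement_def)
  then obtain w where "eval3 l = dot w" by (rule hom_1_eq_dot)
  then have "\<exists>w. \<forall>v. eval3 l v = dot w v" by auto
  then show ?thesis unfolding coeff_vec_def by (rule someI2_ex) blast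
qed

lemma coeffs_nonzero:
  assumes "l \<in> set A"
  shows "coeff_vec l \<noteq> 0"
proof
  assume "coeff_vec l = 0"
  then have "\<forall>v. eval3 l v = 0" using eval3_coeffs[OF assms] by simp
  then have "l = 0" by (simp add: eval3_eq_0_iff)
  then show False using arr assms by (auto simp: line_arrangement_def)
qed

lemma plane_eq_kern:
  assumes "l \<in> set A"
  shows "plane l = kern (coeff_vec l)"
  by (simp add: plane_def kern_def eval3_coeffs[OF assms])

lemma is_plane_plane:
  assumes "l \<in> set A"
  shows "is_plane (plane l)"
  using plane_eq_kern[OF assms] coeffs_nonzero[OF assms] by (auto simp: is_plane_def)

lemma planes_distinct:
  assumes "i < length A" "j < length A" "plane (A ! i) = plane (A ! j)"
  shows "i = j"
proof (rule ccontr)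
  assume "i \<noteq> j"
  have mem: "A ! i \<in> set A" "A ! j \<in> set A" using assms by auto
  have "cross (coeff_vec (A ! j)) (coeff_vec (A ! i)) = 0"
    using assms(3) kern_eq_iff coeffs_nonzero mem by (metis plane_eq_kern)
  then obtain c where c: "coeff_vec (A ! i) = c *s coeff_vec (A ! j)"
    by (rule cross_eq_0_parallel) (use coeffs_nonzero mem in blast)
  then have "c \<noteq> 0" using coeffs_nonzero[OF mem(1)] by auto
  have "A ! i = const3 c * A ! j"
    by (rule eval3_inject) (simp add: eval3_mult eval3_coeffs mem c)
  then have "proportional (A ! i) (A ! j)" using \<open>c \<noteq> 0\<close> by (auto simp: proportional_def)
  then show False using arr \<open>i \<noteq> j\<close> assms by (simp add: line_arrangement_def)
qed

lemma distinct_A: "distinct A"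
  using planes_distinct by (metis distinct_conv_nth)

lemma inj_on_plane: "inj_on plane (set A)"
  unfolding inj_on_def using planes_distinct by (metis in_set_conv_nth)

lemma cross_coeffs_nonzero:
  assumes "l \<in> set A" "l' \<in> set A" "l \<noteq> l'"
  shows "cross (coeff_vec l) (coeff_vec l') \<noteq> 0"
  using assms inj_on_plane kern_eq_iff coeffs_nonzero plane_eq_kern unfolding inj_on_def by metis

lemma derivative_along_field:
  "(\<Sum>i\<in>UNIV. u $ i * eval3 (partial i (defining_poly A)) v) =
    (\<Sum>l\<in>set A. dot (coeff_vec l) u * (\<Prod>l'\<in>set A - {l}. dot (coeff_vec l') v))"
proof -
  have f: "eval3 (defining_poly A) v = (\<Prod>l\<in>set A. dot (coeff_vec l) v)" for v
    unfolding defining_poly_def eval3_prod_list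
    by (subst prod.distinct_set_conv_list[OF distinct_A, symmetric]) (simp add: eval3_coeffs)
  have "((\<lambda>s. \<Prod>l\<in>set A. dot (coeff_vec l) (v + s *s u)) has_field_derivative
      (\<Sum>l\<in>set A. dot (coeff_vec l) u * (\<Prod>l'\<in>set A - {l}. dot (coeff_vec l') (v + 0 *s u)))) (at 0)"
    by (rule has_field_derivative_prod) (auto intro!: derivative_eq_intros)
  then have "((\<lambda>s. eval3 (defining_poly A) (v + s *s u)) has_field_derivative
      (\<Sum>l\<in>set A. dot (coeff_vec l) u * (\<Prod>l'\<in>set A - {l}. dot (coeff_vec l') v))) (at 0)"
    by (simp add: f)
  then show ?thesis using eval3_partial_direction DERIV_unique by blast
qed

lemma in_AR_iff:
  "r \<in> AR (defining_poly A) \<longleftrightarrow>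
    (\<forall>v. (\<Sum>l\<in>set A. dot (coeff_vec l) (\<chi> i. eval3 (r $ i) v) * (\<Prod>l'\<in>set A - {l}. dot (coeff_vec l') v)) = 0)"
proof -
  let ?f = "defining_poly A"
  have "r \<in> AR ?f \<longleftrightarrow> (\<forall>v. eval3 (r $ 1 * partial 1 ?f + r $ 2 * partial 2 ?f + r $ 3 * partial 3 ?f) v = 0)"
    by (simp add: AR_def eval3_eq_0_iff)
  also have "\<dots> \<longleftrightarrow> (\<forall>v. (\<Sum>i\<in>UNIV. (\<chi> i. eval3 (r $ i) v) $ i * eval3 (partial i ?f) v) = 0)"
    by (simp add: eval3_add eval3_mult sum_3)
  finally show ?thesis by (simp only: derivative_along_field)
qed

lemma prod_split:
  assumes "l \<in> set A"
  shows "dot (coeff_vec l) v * (\<Prod>l'\<in>set A - {l}. dot (coeff_vec l') v) = (\<Prod>l\<in>set A. dot (coeff_vec l) v)"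
  using assms by (simp add: prod.remove)

text \<open>On the plane of \<open>l\<close> only the summand of \<open>l\<close> in the derivative of \<open>f\<close> survives, which gives
  tangency. A radial field \<open>\<theta> v = c v\<close> would satisfy \<open>0 = \<theta> f = c d f\<close>.\<close>

lemma has_tangent_field_if_relation:
  assumes r: "r \<in> AR_graded (defining_poly A) q" "r \<noteq> 0"
  shows "has_tangent_field (plane ` set A) q"
proof -
  define \<theta> where "\<theta> = (\<lambda>v. \<chi> i. eval3 (r $ i) v)"
  have \<theta>: "homv q \<theta>" unfolding homv_def
  proof
    fix i
    have "homogeneous (int q) (r $ i)" using r by (simp add: AR_graded_def)
    then show "hom q (\<lambda>v. \<theta> v $ i)" using hom_eval3[of q "r $ i"] by (simp add: \<theta>_def)
  qed
  have rel: "(\<Sum>l\<in>set A. dot (coeff_vec l) (\<theta> v) * (\<Prod>l'\<in>set A - {l}. dot (coeff_vec l') v)) = 0" for v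
    using r in_AR_iff[of r] by (simp add: AR_graded_def \<theta>_def)
  have "tangent \<theta> (plane l)" if l: "l \<in> set A" for l
  proof -
    have "dot (coeff_vec l) (\<theta> v) = 0" if v: "v \<in> kern (coeff_vec l)" for v
    proof (rule hom_cancel_prod_dot_kern[of "set A - {l}" q _ coeff_vec "coeff_vec l" v])
      show "hom q (\<lambda>v. dot (coeff_vec l) (\<theta> v))" by (rule homv_dot[OF \<theta>])
      show "(\<Prod>l'\<in>set A - {l}. dot (coeff_vec l') v) * dot (coeff_vec l) (\<theta> v) = 0" if v: "v \<in> kern (coeff_vec l)" for v
      proof -
        have "(\<Prod>l'\<in>set A - {k}. dot (coeff_vec l') v) = 0" if "k \<noteq> l" for k
          using that l v by (intro prod_zero) (auto simp: kern_def)
        then have "(\<Sum>k\<in>set A. dot (coeff_vec k) (\<theta> v) * (\<Prod>l'\<in>set A - {k}. dot (coeff_vec l') v)) =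
            (\<Sum>k\<in>set A. if k = l then dot (coeff_vec l) (\<theta> v) * (\<Prod>l'\<in>set A - {l}. dot (coeff_vec l') v) else 0)"
          by (intro sum.cong) auto
        then show ?thesis using rel[of v] l by (simp add: mult.commute)
      qed
    qed (use cross_coeffs_nonzero l v in auto)
    then show ?thesis unfolding plane_eq_kern[OF l] tangent_def by (auto simp: kern_def)
  qed
  moreover have "\<exists>v. cross v (\<theta> v) \<noteq> 0"
  proof (rule ccontr)
    assume "\<not> ?thesis"
    then have radial: "cross v (\<theta> v) = 0" for v by blast
    have P: "(\<Prod>l\<in>set A. dot (coeff_vec l) v) * \<theta> v $ i = 0" for v i
    proof (cases "v = 0")
      case True
      have "(\<Prod>l\<in>set A. dot (coeff_vec l) v) = 0"
        using True hd_in_set[OF nonempty] by (intro prod_zero) auto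
      then show ?thesis by simp
    next
      case False
      obtain c where c: "\<theta> v = c *s v" by (rule cross_eq_0_parallel[OF radial False])
      have "0 = (\<Sum>l\<in>set A. c * (dot (coeff_vec l) v * (\<Prod>l'\<in>set A - {l}. dot (coeff_vec l') v)))"
        using rel[of v] by (simp add: c mult.assoc)
      also have "\<dots> = (\<Sum>l\<in>set A. c * (\<Prod>l\<in>set A. dot (coeff_vec l) v))"
        by (rule sum.cong) (simp_all add: prod_split)
      also have "\<dots> = of_nat (card (set A)) * (c * (\<Prod>l\<in>set A. dot (coeff_vec l) v))" by simp
      finally have "c * (\<Prod>l\<in>set A. dot (coeff_vec l) v) = 0" using nonempty by auto
      then show ?thesis by (auto simp: c)
    qed
    have "eval3 (r $ i) v = 0" for i v
    proof -
      have "hom q (\<lambda>v. \<theta> v $ i)" using \<theta> by (simp add: homv_def)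
      then have "\<theta> v $ i = 0"
        by (rule hom_cancel_prod_dot[of "set A" q _ coeff_vec, rotated]) (use coeffs_nonzero P in auto)
      then show ?thesis by (simp add: \<theta>_def)
    qed
    then have "r $ i = 0" for i using eval3_eq_0_iff[of "r $ i"] by blast
    then show False using r(2) by (simp add: vec_eq_iff)
  qed
  ultimately show ?thesis unfolding has_tangent_field_def using \<theta> by blast
qed

text \<open>If \<open>\<theta> f = G f\<close> with \<open>f\<close> of degree \<open>d\<close>, Euler's identity shows that \<open>d \<theta> - G E\<close> annihilates
  \<open>f\<close>, where \<open>E\<close> is the Euler field.\<close>

lemma relation_if_has_tangent_field:
  assumes "has_tangent_field (plane ` set A) q"
  obtains r where "r \<in> AR_graded (defining_poly A) q" "r \<noteq> 0"
proof -
  obtain \<theta> v0 where \<theta>: "homv q \<theta>" "\<And>l. l \<in> set A \<Longrightarrow> tangent \<theta> (plane l)" "cross v0 (\<theta> v0) \<noteq> 0"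
    using assms unfolding has_tangent_field_def by blast
  have "\<forall>l\<in>set A. \<exists>g. hom (q - 1) g \<and> (q = 0 \<longrightarrow> g = (\<lambda>v. 0)) \<and>
      (\<forall>v. dot (coeff_vec l) (\<theta> v) = dot (coeff_vec l) v * g v)"
  proof
    fix l assume l: "l \<in> set A"
    have "dot (coeff_vec l) (\<theta> v) = 0" if "v \<in> kern (coeff_vec l)" for v
      using \<theta>(2)[OF l] that unfolding plane_eq_kern[OF l] tangent_def by (auto simp: kern_def)
    from hom_divide[OF homv_dot[OF \<theta>(1)] coeffs_nonzero[OF l] this]
    show "\<exists>g. hom (q - 1) g \<and> (q = 0 \<longrightarrow> g = (\<lambda>v. 0)) \<and>
      (\<forall>v. dot (coeff_vec l) (\<theta> v) = dot (coeff_vec l) v * g v)" by metis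
  qed
  from bchoice[OF this] obtain g where
    gg: "\<forall>l\<in>set A. hom (q - 1) (g l) \<and> (q = 0 \<longrightarrow> g l = (\<lambda>v. 0)) \<and>
      (\<forall>v. dot (coeff_vec l) (\<theta> v) = dot (coeff_vec l) v * g l v)" ..
  have g: "hom (q - 1) (g l)" "q = 0 \<Longrightarrow> g l = (\<lambda>v. 0)"
    "dot (coeff_vec l) (\<theta> v) = dot (coeff_vec l) v * g l v" if "l \<in> set A" for l v
    using bspec[OF gg that] by simp_all
  define G where "G = (\<lambda>v. \<Sum>l\<in>set A. g l v)"
  define d where "d = (of_nat (card (set A)) :: complex)"
  have d: "d \<noteq> 0" using nonempty by (simp add: d_def)
  define \<eta> where "\<eta> = (\<lambda>v. d *s \<theta> v - G v *s v)"
  have \<eta>: "hom q (\<lambda>v. \<eta> v $ i)" for i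
  proof (cases "q = 0")
    case True
    then have "G = (\<lambda>v. 0)" using g(2) by (auto simp: G_def)
    then show ?thesis using \<theta>(1) by (simp add: \<eta>_def homv_def hom_cmult)
  next
    case False
    have "hom (q - 1) G" unfolding G_def by (intro hom_sum g(1)) auto
    then have "hom (q - 1 + 1) (\<lambda>v. G v * v $ i)" by (intro hom_mult hom_nth)
    then show ?thesis using False \<theta>(1) by (simp add: \<eta>_def homv_def hom_cmult hom_diff)
  qed
  have "\<forall>i. \<exists>p. homogeneous (int q) p \<and> (\<forall>v. eval3 p v = \<eta> v $ i)"
    using ex_poly_if_hom[OF \<eta>] by blast
  then obtain p where p: "\<forall>i. homogeneous (int q) (p i) \<and> (\<forall>v. eval3 (p i) v = \<eta> v $ i)"
    by (rule choice[THEN exE])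
  define r where "r = (\<chi> i. p i)"
  have r: "(\<chi> i. eval3 (r $ i) v) = \<eta> v" for v using p by (simp add: r_def vec_eq_iff)
  have "(\<Sum>l\<in>set A. dot (coeff_vec l) (\<eta> v) * (\<Prod>l'\<in>set A - {l}. dot (coeff_vec l') v)) = 0" for v
  proof -
    let ?P = "\<Prod>l\<in>set A. dot (coeff_vec l) v"
    have "(\<Sum>l\<in>set A. dot (coeff_vec l) (\<eta> v) * (\<Prod>l'\<in>set A - {l}. dot (coeff_vec l') v)) =
        (\<Sum>l\<in>set A. (d * g l v - G v) * ?P)"
    proof (rule sum.cong)
      fix l assume l: "l \<in> set A"
      have "dot (coeff_vec l) (\<eta> v) = (d * g l v - G v) * dot (coeff_vec l) v"
        by (simp add: \<eta>_def g(3)[OF l] algebra_simps)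
      then show "dot (coeff_vec l) (\<eta> v) * (\<Prod>l'\<in>set A - {l}. dot (coeff_vec l') v) = (d * g l v - G v) * ?P"
        by (simp only: prod_split[OF l, symmetric] mult.assoc)
    qed simp
    also have "\<dots> = (\<Sum>l\<in>set A. d * g l v - G v) * ?P" by (simp only: sum_distrib_right)
    also have "(\<Sum>l\<in>set A. d * g l v - G v) = 0"
      by (simp add: sum_subtractf G_def d_def flip: sum_distrib_left)
    finally show ?thesis by simp
  qed
  then have "r \<in> AR (defining_poly A)" unfolding in_AR_iff r by blast
  then have "r \<in> AR_graded (defining_poly A) q" using p by (simp add: AR_graded_def r_def)
  moreover have "r \<noteq> 0"
  proof
    assume "r = 0"
    then have "\<eta> v0 = 0" using r[of v0] by (simp add: vec_eq_iff)
    moreover have "cross v0 (\<eta> v0) = d *s cross v0 (\<theta> v0)" by (simp add: \<eta>_def)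
    ultimately show False using d \<theta>(3) by simp
  qed
  ultimately show thesis by (rule that)
qed

lemma AR_graded_nontrivial_iff:
  "AR_graded (defining_poly A) q \<noteq> {0} \<longleftrightarrow> has_tangent_field (plane ` set A) q"
proof -
  have "0 \<in> AR_graded (defining_poly A) q"
    by (simp add: AR_graded_def AR_def homogeneous_def)
  then have "AR_graded (defining_poly A) q \<noteq> {0} \<longleftrightarrow> (\<exists>r\<in>AR_graded (defining_poly A) q. r \<noteq> 0)" by blast
  also have "\<dots> \<longleftrightarrow> has_tangent_field (plane ` set A) q"
    using has_tangent_field_if_relation by (auto elim: relation_if_has_tangent_field)
  finally show ?thesis .
qed

lemma mdr_eq: "mdr (defining_poly A) = (LEAST q. has_tangent_field (plane ` set A) q)"
  by (simp add: mdr_def AR_graded_nontrivial_iff)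

end

section \<open>Lattice isomorphisms\<close>

text \<open>The trace of a lattice isomorphism on the planes that determines all counts in the deletion
  argument. Unlike the lattice isomorphism itself it restricts to subarrangements.\<close>

definition preserves_crossings :: "(cvec set \<Rightarrow> cvec set) \<Rightarrow> cvec set set \<Rightarrow> bool" where
  "preserves_crossings \<phi> X \<longleftrightarrow> (\<forall>H\<in>X. \<forall>K\<in>X. \<forall>K'\<in>X. H \<inter> K = H \<inter> K' \<longleftrightarrow> \<phi> H \<inter> \<phi> K = \<phi> H \<inter> \<phi> K')"

lemma preserves_crossingsD:
  assumes "preserves_crossings \<phi> X" "H \<in> X" "K \<in> X" "K' \<in> X"
  shows "H \<inter> K = H \<inter> K' \<longleftrightarrow> \<phi> H \<inter> \<phi> K = \<phi> H \<inter> \<phi> K'"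
  by (rule assms(1)[unfolded preserves_crossings_def, THEN bspec, OF assms(2), THEN bspec,
    OF assms(3), THEN bspec, OF assms(4)])

lemma npoints_image:
  assumes "finite X" "inj_on \<phi> X" "preserves_crossings \<phi> X" "H \<in> X"
  shows "npoints (\<phi> ` X) (\<phi> H) = npoints X H"
proof -
  have "\<phi> ` X - {\<phi> H} = \<phi> ` (X - {H})" using assms by (auto simp: inj_on_def)
  then have "npoints (\<phi> ` X) (\<phi> H) = card ((\<lambda>K. \<phi> H \<inter> \<phi> K) ` (X - {H}))"
    by (simp add: npoints_def image_image)
  also have "\<dots> = card ((\<lambda>K. H \<inter> K) ` (X - {H}))"
  proof (rule card_image_eq_if_same_fibres)
    fix K K' assume "K \<in> X - {H}" "K' \<in> X - {H}"
    then show "H \<inter> K = H \<inter> K' \<longleftrightarrow> \<phi> H \<inter> \<phi> K = \<phi> H \<inter> \<phi> K'"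
      by (intro preserves_crossingsD[OF assms(3,4)]) simp_all
  qed (use assms(1) in simp)
  finally show ?thesis by (simp add: npoints_def)
qed

lemma is_maclane_image:
  assumes "finite X" "inj_on \<phi> X" "preserves_crossings \<phi> X"
  shows "is_maclane (\<phi> ` X) \<longleftrightarrow> is_maclane X"
proof -
  define Q where "Q = (\<lambda>X H K. card {K' \<in> X - {H}. (H :: cvec set) \<inter> K' = H \<inter> K})"
  have "Q (\<phi> ` X) (\<phi> H) (\<phi> K) = Q X H K"
    if HK: "H \<in> X" "K \<in> X" for H K
  proof -
    have img: "\<phi> ` {K' \<in> X - {H}. H \<inter> K' = H \<inter> K} = {K' \<in> \<phi> ` X - {\<phi> H}. \<phi> H \<inter> K' = \<phi> H \<inter> \<phi> K}"
    proof (intro equalityI subsetI)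
      fix L assume "L \<in> \<phi> ` {K' \<in> X - {H}. H \<inter> K' = H \<inter> K}"
      then obtain K' where "L = \<phi> K'" "K' \<in> {K' \<in> X - {H}. H \<inter> K' = H \<inter> K}" by (rule imageE)
      then have K': "K' \<in> X" "K' \<noteq> H" "H \<inter> K' = H \<inter> K" "L = \<phi> K'" by simp_all
      have "\<phi> H \<inter> \<phi> K' = \<phi> H \<inter> \<phi> K"
        using K'(3) preserves_crossingsD[OF assms(3) HK(1) K'(1) HK(2)] by (rule iffD1[rotated])
      moreover have "\<phi> K' \<noteq> \<phi> H" using K' HK assms(2) by (auto simp: inj_on_def)
      ultimately show "L \<in> {K' \<in> \<phi> ` X - {\<phi> H}. \<phi> H \<inter> K' = \<phi> H \<inter> \<phi> K}" using K' by simp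
    next
      fix L assume "L \<in> {K' \<in> \<phi> ` X - {\<phi> H}. \<phi> H \<inter> K' = \<phi> H \<inter> \<phi> K}"
      then have "L \<in> \<phi> ` X" and L: "L \<noteq> \<phi> H" "\<phi> H \<inter> L = \<phi> H \<inter> \<phi> K" by simp_all
      then obtain K' where K': "K' \<in> X" "L = \<phi> K'" by blast
      have "H \<inter> K' = H \<inter> K"
        using L(2)[unfolded K'(2)] preserves_crossingsD[OF assms(3) HK(1) K'(1) HK(2)] by (rule iffD2[rotated])
      then show "L \<in> \<phi> ` {K' \<in> X - {H}. H \<inter> K' = H \<inter> K}" using K' L(1) by auto
    qed
    have "inj_on \<phi> {K' \<in> X - {H}. H \<inter> K' = H \<inter> K}"
      using assms(2) by (rule inj_on_subset) auto
    from card_image[OF this] show ?thesis unfolding img Q_def .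
  qed
  moreover have "\<phi> ` X - {\<phi> H} = \<phi> ` (X - {H})" if "H \<in> X" for H
    using assms(2) that by (auto simp: inj_on_def)
  ultimately have "(\<forall>K\<in>\<phi> ` X - {\<phi> H}. Q (\<phi> ` X) (\<phi> H) K \<le> 2) \<longleftrightarrow> (\<forall>K\<in>X - {H}. Q X H K \<le> 2)"
    if "H \<in> X" for H using that by simp
  then have "(\<forall>H\<in>\<phi> ` X. \<forall>K\<in>\<phi> ` X - {H}. Q (\<phi> ` X) H K \<le> 2) \<longleftrightarrow> (\<forall>H\<in>X. \<forall>K\<in>X - {H}. Q X H K \<le> 2)"
    by simp
  moreover have "(\<forall>H\<in>\<phi> ` X. npoints (\<phi> ` X) H = 4) \<longleftrightarrow> (\<forall>H\<in>X. npoints X H = 4)"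
    using npoints_image[OF assms] by simp
  ultimately show ?thesis
    unfolding is_maclane_def Q_def card_image[OF assms(2)] by (simp only:)
qed

text \<open>The two deletion criteria and the counting criterion are exhaustive, and each is
  transported by \<open>\<phi>\<close>.\<close>

theorem has_tangent_field_combinatorial:
  assumes "finite X" "card X < 9" "\<And>H. H \<in> X \<Longrightarrow> is_plane H" "\<And>H. H \<in> X \<Longrightarrow> is_plane (\<phi> H)"
    "inj_on \<phi> X" "preserves_crossings \<phi> X"
  shows "has_tangent_field (\<phi> ` X) q \<longleftrightarrow> has_tangent_field X q"
  using assms
proof (induction "card X" arbitrary: X q rule: less_induct)
  case less
  note X = less.prems
  interpret X: plane_arrangement X by unfold_locales (use X in auto)
  interpret X': plane_arrangement "\<phi> ` X" by unfold_locales (use X in auto)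
  have card: "card (\<phi> ` X) = card X" by (rule card_image[OF X(5)])
  have np: "npoints (\<phi> ` X) (\<phi> H) = npoints X H" if "H \<in> X" for H
    by (rule npoints_image[OF X(1,5,6) that])
  have IH: "has_tangent_field (\<phi> ` X - {\<phi> H}) r \<longleftrightarrow> has_tangent_field (X - {H}) r" if H: "H \<in> X" for H r
  proof -
    have "\<phi> ` X - {\<phi> H} = \<phi> ` (X - {H})" using X(5) H by (auto simp: inj_on_def)
    moreover have "has_tangent_field (\<phi> ` (X - {H})) r \<longleftrightarrow> has_tangent_field (X - {H}) r"
    proof (rule less.hyps)
      show "card (X - {H}) < card X" using X(1) H by (rule card_Diff1_less)
      then show "card (X - {H}) < 9" using X(2) by simp
      show "inj_on \<phi> (X - {H})" using X(5) by (rule inj_on_subset) auto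
      show "preserves_crossings \<phi> (X - {H})" using X(6) by (simp add: preserves_crossings_def)
    qed (use X in auto)
    ultimately show ?thesis by simp
  qed
  consider H where "H \<in> X" "q + 2 \<le> npoints X H" | H where "H \<in> X" "npoints X H + q + 2 \<le> card X"
    | "\<forall>H\<in>X. npoints X H \<le> q + 1 \<and> card X \<le> npoints X H + q + 1"
    by fastforce
  then show ?case
  proof cases
    case (1 H)
    have "has_tangent_field X q \<longleftrightarrow> 0 < q \<and> has_tangent_field (X - {H}) (q - 1)"
      by (rule has_tangent_field_delete_many_points[OF X(1,3) 1])
    moreover have "has_tangent_field (\<phi> ` X) q \<longleftrightarrow> 0 < q \<and> has_tangent_field (\<phi> ` X - {\<phi> H}) (q - 1)"
      by (rule has_tangent_field_delete_many_points) (use X 1 np in auto)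
    ultimately show ?thesis using IH[OF 1(1)] by simp
  next
    case (2 H)
    have "has_tangent_field X q \<longleftrightarrow> has_tangent_field (X - {H}) q"
      by (rule has_tangent_field_delete_redundant[OF X(1,3) 2])
    moreover have "has_tangent_field (\<phi> ` X) q \<longleftrightarrow> has_tangent_field (\<phi> ` X - {\<phi> H}) q"
      by (rule has_tangent_field_delete_redundant) (use X 2 np card in auto)
    ultimately show ?thesis using IH[OF 2(1)] by simp
  next
    case 3
    have ml: "is_maclane (\<phi> ` X) \<longleftrightarrow> is_maclane X" by (rule is_maclane_image[OF X(1,5,6)])
    show ?thesis
    proof (cases "q = 3 \<and> is_maclane X")
      case True
      then show ?thesis using X.no_tangent_field_maclane X'.no_tangent_field_maclane ml by simp
    next
      case False
      have "has_tangent_field X q"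
        by (rule X.has_tangent_field_if_few_points) (use 3 X False in auto)
      moreover have "has_tangent_field (\<phi> ` X) q"
        by (rule X'.has_tangent_field_if_few_points) (use 3 X False ml np card in auto)
      ultimately show ?thesis by simp
    qed
  qed
qed

lemma plane_subset_plane:
  assumes "is_plane H" "is_plane K" "H \<subseteq> K"
  shows "H = K"
proof (rule ccontr)
  assume "H \<noteq> K"
  then have "cross (normal K) (normal H) \<noteq> 0" by (intro cross_normals_nonzero assms) simp
  then obtain u where u: "dot (normal K) u = 1" "dot (normal H) u = 0" by (rule ex_dual_vector_kern)
  have "u \<in> H" using u by (simp add: in_plane_iff[OF assms(1)])
  then have "u \<in> K" using assms(3) by blast
  then show False using u by (simp add: in_plane_iff[OF assms(2)])
qed

text \<open>An order-theoretic description, so that lattice isomorphisms map planes to planes.\<close>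

lemma mem_planes_iff:
  assumes "\<And>l. l \<in> set A \<Longrightarrow> is_plane (plane l)"
  shows "K \<in> plane ` set A \<longleftrightarrow> K \<in> intersection_lattice A \<and> K \<noteq> UNIV \<and>
    (\<forall>X\<in>intersection_lattice A. K \<subseteq> X \<longrightarrow> X = K \<or> X = UNIV)"
proof -
  let ?Y = "plane ` set A"
  have Y: "is_plane H" if "H \<in> ?Y" for H using assms that by blast
  have L: "H \<in> intersection_lattice A" if "H \<in> ?Y" for H
  proof -
    have "\<Inter>{H} = H" "{H} \<subseteq> ?Y" using that by auto
    then show ?thesis unfolding intersection_lattice_def by blast
  qed
  have below: "\<exists>H\<in>?Y. X \<subseteq> H" if X: "X \<in> intersection_lattice A" "X \<noteq> UNIV" for X
  proof -
    obtain F where F: "X = \<Inter>F" "F \<subseteq> ?Y" using X(1) unfolding intersection_lattice_def by blast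
    then obtain H where "H \<in> F" using X(2) by blast
    then show ?thesis using F by blast
  qed
  have nU: "H \<noteq> UNIV" if "H \<in> ?Y" for H
    using Y[OF that] kern_not_UNIV by (auto simp: is_plane_def)
  show ?thesis
  proof (intro iffI conjI ballI impI)
    assume K: "K \<in> ?Y"
    show "K \<in> intersection_lattice A" "K \<noteq> UNIV" using L nU K by blast+
    fix X assume X: "X \<in> intersection_lattice A" "K \<subseteq> X"
    show "X = K \<or> X = UNIV"
    proof (rule disjCI)
      assume "X \<noteq> UNIV"
      then obtain H where "H \<in> ?Y" "X \<subseteq> H" using below X(1) by blast
      moreover from this have "K = H" using plane_subset_plane[of K H] Y K X(2) by blast
      ultimately show "X = K" using X(2) by blast
    qed
  next
    assume K: "K \<in> intersection_lattice A \<and> K \<noteq> UNIV \<and>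
      (\<forall>X\<in>intersection_lattice A. K \<subseteq> X \<longrightarrow> X = K \<or> X = UNIV)"
    have K': "K \<in> intersection_lattice A" "K \<noteq> UNIV"
      by (rule K[THEN conjunct1], rule K[THEN conjunct2, THEN conjunct1])
    have max: "X = K \<or> X = UNIV" if "X \<in> intersection_lattice A" "K \<subseteq> X" for X
      by (rule K[THEN conjunct2, THEN conjunct2, THEN bspec, OF that(1), THEN mp, OF that(2)])
    from below[OF K'] obtain H where H: "H \<in> ?Y" "K \<subseteq> H" by (rule bexE)
    then have "H = K" using max[OF L[OF H(1)] H(2)] nU[OF H(1)] by simp
    then show "K \<in> ?Y" using H(1) by simp
  qed
qed

lemma lattice_isomorphism_on_planes:
  assumes A: "\<And>l. l \<in> set A \<Longrightarrow> is_plane (plane l)" and A': "\<And>l. l \<in> set A' \<Longrightarrow> is_plane (plane l)"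
    and iso: "lattice_isomorphic A A'"
  obtains \<phi> where "inj_on \<phi> (plane ` set A)" "\<phi> ` plane ` set A = plane ` set A'"
    "preserves_crossings \<phi> (plane ` set A)"
proof -
  let ?Y = "plane ` set A" and ?L = "intersection_lattice A" and ?L' = "intersection_lattice A'"
  obtain \<phi> where \<phi>: "bij_betw \<phi> ?L ?L' \<and> (\<forall>X\<in>?L. \<forall>Z\<in>?L. X \<supseteq> Z \<longleftrightarrow> \<phi> X \<supseteq> \<phi> Z)"
    using iso unfolding lattice_isomorphic_def ..
  have bij: "bij_betw \<phi> ?L ?L'" by (rule \<phi>[THEN conjunct1])
  have ord: "Z \<subseteq> X \<longleftrightarrow> \<phi> Z \<subseteq> \<phi> X" if "X \<in> ?L" "Z \<in> ?L" for X Z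
    by (rule \<phi>[THEN conjunct2, THEN bspec, OF that(1), THEN bspec, OF that(2)])
  have inj: "inj_on \<phi> ?L" and onto: "\<phi> ` ?L = ?L'" using bij by (auto simp: bij_betw_def)
  have U: "UNIV \<in> ?L" "UNIV \<in> ?L'"
    unfolding intersection_lattice_def by (auto intro!: exI[of _ "{}"])
  have Int_L: "X \<inter> Z \<in> intersection_lattice B" if X: "X \<in> intersection_lattice B" and Z: "Z \<in> intersection_lattice B" for X Z B
  proof -
    obtain F where F: "X = \<Inter>F \<and> F \<subseteq> plane ` set B"
      using X unfolding intersection_lattice_def mem_Collect_eq ..
    obtain G where G: "Z = \<Inter>G \<and> G \<subseteq> plane ` set B"
      using Z unfolding intersection_lattice_def mem_Collect_eq ..
    have "X \<inter> Z = \<Inter>(F \<union> G) \<and> F \<union> G \<subseteq> plane ` set B"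
      using F G by (simp add: Inter_Un_distrib)
    then show ?thesis unfolding intersection_lattice_def mem_Collect_eq ..
  qed
  have phi_L: "\<phi> X \<in> ?L'" if "X \<in> ?L" for X using onto that by blast
  have phi_U: "\<phi> UNIV = UNIV"
  proof -
    obtain X where X: "X \<in> ?L" "\<phi> X = UNIV" using U(2) onto by (metis imageE)
    then have "\<phi> X \<subseteq> \<phi> UNIV" using ord[OF U(1) X(1)] by simp
    then show ?thesis unfolding X(2) by (rule top.extremum_uniqueI)
  qed
  have phi_eq: "\<phi> X = \<phi> Z \<longleftrightarrow> X = Z" if "X \<in> ?L" "Z \<in> ?L" for X Z
    using inj that by (auto simp: inj_on_def)
  have mem: "K \<in> ?Y \<longleftrightarrow> K \<in> ?L \<and> K \<noteq> UNIV \<and> (\<forall>X\<in>?L. K \<subseteq> X \<longrightarrow> X = K \<or> X = UNIV)" for K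
    by (rule mem_planes_iff) (rule A)
  have mem': "K \<in> plane ` set A' \<longleftrightarrow> K \<in> ?L' \<and> K \<noteq> UNIV \<and> (\<forall>X\<in>?L'. K \<subseteq> X \<longrightarrow> X = K \<or> X = UNIV)" for K
    by (rule mem_planes_iff) (rule A')
  have max: "\<phi> K \<in> plane ` set A' \<longleftrightarrow> K \<in> ?Y" if K: "K \<in> ?L" for K
  proof -
    have "(\<forall>X'\<in>?L'. \<phi> K \<subseteq> X' \<longrightarrow> X' = \<phi> K \<or> X' = UNIV) \<longleftrightarrow>
        (\<forall>X\<in>?L. \<phi> K \<subseteq> \<phi> X \<longrightarrow> \<phi> X = \<phi> K \<or> \<phi> X = \<phi> UNIV)"
      unfolding onto[symmetric] phi_U by simp
    also have "\<dots> \<longleftrightarrow> (\<forall>X\<in>?L. K \<subseteq> X \<longrightarrow> X = K \<or> X = UNIV)"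
      by (rule ball_cong[OF refl]) (simp only: phi_eq[OF _ K] phi_eq[OF _ U(1)] ord[OF _ K])
    finally have 1: "(\<forall>X'\<in>?L'. \<phi> K \<subseteq> X' \<longrightarrow> X' = \<phi> K \<or> X' = UNIV) \<longleftrightarrow>
        (\<forall>X\<in>?L. K \<subseteq> X \<longrightarrow> X = K \<or> X = UNIV)" .
    have "\<phi> K \<noteq> UNIV \<longleftrightarrow> K \<noteq> UNIV" using phi_eq[OF K U(1)] phi_U by simp
    then show ?thesis
      unfolding mem mem' 1
      using K phi_L[OF K] by (simp only: simp_thms)
  qed
  have YL: "?Y \<subseteq> ?L" using mem by (intro subsetI) simp
  have Y'L: "plane ` set A' \<subseteq> ?L'" using mem' by (intro subsetI) simp
  have "\<phi> ` ?Y = plane ` set A'"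
  proof (intro equalityI subsetI)
    fix X assume "X \<in> \<phi> ` ?Y"
    then show "X \<in> plane ` set A'" using max YL by auto
  next
    fix X assume X: "X \<in> plane ` set A'"
    then obtain K where "K \<in> ?L" "X = \<phi> K" using Y'L onto by blast
    then show "X \<in> \<phi> ` ?Y" using max X by blast
  qed
  moreover have "inj_on \<phi> ?Y" using inj YL by (rule inj_on_subset)
  moreover have "preserves_crossings \<phi> ?Y"
  proof -
    have meet: "\<phi> (H \<inter> K) = \<phi> H \<inter> \<phi> K" if HK: "H \<in> ?L" "K \<in> ?L" for H K
    proof
      have I: "H \<inter> K \<in> ?L" by (rule Int_L[OF HK])
      show "\<phi> (H \<inter> K) \<subseteq> \<phi> H \<inter> \<phi> K" using ord[OF HK(1) I] ord[OF HK(2) I] by blast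
      have "\<phi> H \<inter> \<phi> K \<in> ?L'" by (intro Int_L phi_L HK)
      then obtain Z where Z: "Z \<in> ?L" "\<phi> H \<inter> \<phi> K = \<phi> Z" using onto by (metis imageE)
      then have "Z \<subseteq> H" "Z \<subseteq> K" using ord[OF HK(1) Z(1)] ord[OF HK(2) Z(1)] by blast+
      then show "\<phi> H \<inter> \<phi> K \<subseteq> \<phi> (H \<inter> K)" using ord[OF I Z(1)] Z(2) by blast
    qed
    show ?thesis unfolding preserves_crossings_def
    proof (intro ballI)
      fix H K K' assume "H \<in> ?Y" "K \<in> ?Y" "K' \<in> ?Y"
      then have "H \<in> ?L" "K \<in> ?L" "K' \<in> ?L" using YL by blast+
      then show "H \<inter> K = H \<inter> K' \<longleftrightarrow> \<phi> H \<inter> \<phi> K = \<phi> H \<inter> \<phi> K'"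
        using phi_eq[OF Int_L Int_L] meet by simp
    qed
  qed
  ultimately show thesis using that by blast
qed

lemma lattice_isomorphic_planes:
  assumes "line_arrangement A" "line_arrangement A'" "lattice_isomorphic A A'"
  obtains \<phi> where "inj_on \<phi> (plane ` set A)" "\<phi> ` plane ` set A = plane ` set A'"
    "preserves_crossings \<phi> (plane ` set A)"
proof -
  have pl: "is_plane (plane l)" if "line_arrangement B" "l \<in> set B" for B l
  proof -
    interpret B: nonempty_line_arrangement B by unfold_locales (use that in auto)
    show ?thesis by (rule B.is_plane_plane[OF that(2)])
  qed
  show thesis
  proof (rule lattice_isomorphism_on_planes[OF _ _ assms(3)])
    show "is_plane (plane l)" if "l \<in> set A" for l using pl[OF assms(1) that] .
    show "is_plane (plane l)" if "l \<in> set A'" for l using pl[OF assms(2) that] .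
  qed (rule that)
qed

lemma card_planes:
  assumes "line_arrangement A"
  shows "card (plane ` set A) = length A"
proof (cases "A = []")
  case False
  interpret A: nonempty_line_arrangement A by unfold_locales (use assms False in auto)
  show ?thesis using card_image[OF A.inj_on_plane] distinct_card[OF A.distinct_A] by simp
qed simp

lemma length_eq_if_lattice_isomorphic:
  assumes "line_arrangement A" "line_arrangement A'" "lattice_isomorphic A A'"
  shows "length A = length A'"
proof -
  obtain \<phi> where \<phi>: "inj_on \<phi> (plane ` set A)" "\<phi> ` plane ` set A = plane ` set A'"
    "preserves_crossings \<phi> (plane ` set A)"
    by (rule lattice_isomorphic_planes[OF assms])
  have "card (plane ` set A') = card (plane ` set A)" using card_image[OF \<phi>(1)] unfolding \<phi>(2) .
  then show ?thesis by (simp only: card_planes assms)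
qed

lemma mdr_eq_if_lattice_isomorphic:
  assumes arr: "line_arrangement A" "line_arrangement A'" and iso: "lattice_isomorphic A A'" and d: "length A < 9"
  shows "mdr (defining_poly A) = mdr (defining_poly A')"
proof (cases "A = []")
  case True
  then show ?thesis using length_eq_if_lattice_isomorphic[OF arr iso] by simp
next
  case False
  then have "A' \<noteq> []" using length_eq_if_lattice_isomorphic[OF arr iso] by auto
  interpret A: nonempty_line_arrangement A by unfold_locales (use arr False in auto)
  interpret A': nonempty_line_arrangement A' by unfold_locales (use arr \<open>A' \<noteq> []\<close> in auto)
  obtain \<phi> where \<phi>: "inj_on \<phi> (plane ` set A)" "\<phi> ` plane ` set A = plane ` set A'"
    "preserves_crossings \<phi> (plane ` set A)"
    by (rule lattice_isomorphic_planes[OF arr iso])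
  have "has_tangent_field (\<phi> ` plane ` set A) q \<longleftrightarrow> has_tangent_field (plane ` set A) q" for q
  proof (rule has_tangent_field_combinatorial[OF _ _ _ _ \<phi>(1,3)])
    show "card (plane ` set A) < 9" using d card_planes[OF arr(1)] by simp
    show "is_plane H" if "H \<in> plane ` set A" for H using that A.is_plane_plane by (elim imageE) simp
    show "is_plane (\<phi> H)" if "H \<in> plane ` set A" for H
    proof -
      have "\<phi> H \<in> plane ` set A'" unfolding \<phi>(2)[symmetric] using that by (rule imageI)
      then show ?thesis using A'.is_plane_plane by (elim imageE) simp
    qed
  qed simp
  then have "has_tangent_field (plane ` set A') = has_tangent_field (plane ` set A)"
    unfolding \<phi>(2) by (rule ext)
  then show ?thesis unfolding A.mdr_eq A'.mdr_eq by (rule arg_cong[symmetric])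
qed

theorem corollary4p8:
  shows "(\<forall>d A A'. d < 9 \<longrightarrow>
            line_arrangement A \<and> length A = d \<longrightarrow>
            line_arrangement A' \<and> length A' = d \<longrightarrow>
            lattice_isomorphic A A' \<longrightarrow>
            mdr (defining_poly A) = mdr (defining_poly A')) \<and>
         \<not> (\<exists>A A'. classical_Ziegler_pair A A' \<and> length A < 9 \<and> length A' < 9)"
proof (intro conjI allI impI notI)
  fix d A A'
  assume "d < 9" "line_arrangement A \<and> length A = d" "line_arrangement A' \<and> length A' = d"
    "lattice_isomorphic A A'"
  then show "mdr (defining_poly A) = mdr (defining_poly A')"
    by (intro mdr_eq_if_lattice_isomorphic) simp_all
next
  assume "\<exists>A A'. classical_Ziegler_pair A A' \<and> length A < 9 \<and> length A' < 9"
  then obtain A A' where Z: "classical_Ziegler_pair A A'" and d: "length A < 9" by (elim exE conjE)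
  have "line_arrangement A" "line_arrangement A'" "lattice_isomorphic A A'"
    and neq: "mdr (defining_poly A) \<noteq> mdr (defining_poly A')"
    using Z by (simp_all add: classical_Ziegler_pair_def Ziegler_pair_def)
  from mdr_eq_if_lattice_isomorphic[OF this(1-3) d] neq show False by simp
qed

end
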